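(* Consider the index-2 integral-algebraic equation $$x_1(t)+\int_0^t [K_{11}(t,s)x_1(s)+K_{12}(t,s)x_2(s)]\,ds=f_1(t),\qquad \int_0^t K_{21}(t,s)x_1(s)\,ds=f_2(t),\qquad t\in I=[0,T],$$ where $f_2(0)=0$ and $|K_{21}(t,t)K_{12}(t,t)|\ge k_0>0$ for all $t\in I$. Let $m\ge1$ be an integer and assume that, with $d=m+2$, one has $f_1\in C^{d+1}(I)$, $f_2\in C^{d+2}(I)$, $K_{11}\in C^{d+1}(D)$ and $K_{12},K_{21}\in C^{d+2}(D)$, so that the exact solution satisfies $x_1,x_2\in C^{m+2}(I)$. Let $\bar h>0$ be such that for every uniform mesh $I_h$ with $h<\bar h$ the discontinuous Galerkin solution is uniquely defined (such an $\bar h$ exists). Then, for all uniform meshes $I_h$ with $h<\bar h$, the discontinuous Galerkin solution $x_{1,h},x_{2,h}\in S_{m-1}^{(-1)}(I_h)$ converges to the exact solution uniformly on $I$ with the attainable global order of convergence described by $$\|x_1-x_{1,h}\|_\infty=\sup_{t\in I}|x_1(t)-x_{1,h}(t)|\le C\times\begin{cases}h^m,&m\text{ odd},\\ h^{m-1},&m\text{ even},\end{cases}$$ $$\|x_2-x_{2,h}\|_\infty=\sup_{t\in I}|x_2(t)-x_{2,h}(t)|\le C\times\begin{cases}h^{m-2},&m\text{ odd},\\ h^{m-3},&m\text{ even},\end{cases}$$ where $C$ is a constant independent of $h$.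
   Context: $I=[0,T]$, $D=\{(t,s):0\le s\le t\le T\}$; all functions are real-valued. For an integer $N\ge2$, the uniform mesh is $I_h=\{t_n=nh:0\le n\le N\}$ with $h=T/N$, and $\sigma_n=(t_n,t_{n+1}]$. $S_{m-1}^{(-1)}(I_h)$ is the space of functions $v$ such that $v|_{\sigma_n}$ is a real polynomial of degree at most $m-1$ for each $0\le n\le N-1$ (no continuity at mesh points); the value at $t=0$ is understood as the limit from the right. The discontinuous Galerkin (DG) solution is the pair $x_{1,h},x_{2,h}\in S_{m-1}^{(-1)}(I_h)$ satisfying, for all $\phi\in S_{m-1}^{(-1)}(I_h)$ and $0\le n\le N-1$, $$\int_{t_n}^{t_{n+1}}\Bigl[x_{1,h}(s)+\int_0^s\bigl(K_{11}(s,\tau)x_{1,h}(\tau)+K_{12}(s,\tau)x_{2,h}(\tau)\bigr)d\tau\Bigr]\phi(s)\,ds=\int_{t_n}^{t_{n+1}}f_1(s)\phi(s)\,ds,$$ $$\int_{t_n}^{t_{n+1}}\Bigl(\int_0^s K_{21}(s,\tau)x_{1,h}(\tau)\,d\tau\Bigr)\phi(s)\,ds=\int_{t_n}^{t_{n+1}}f_2(s)\phi(s)\,ds.$$ *)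

theory Defs
  imports "HOL-Analysis.Analysis" "HOL-Computational_Algebra.Polynomial"
begin

text \<open>
  \<open>C\<^sup>k\<close> functions on a closed set \<open>S\<close>, with one-sided derivatives at boundary points; \<open>g\<close> is the
  gradient. It is used for the interval \<open>{0..T}\<close> and for the triangle \<open>kernel_domain T\<close>. These are convex
  with nonempty interior, so \<open>g\<close> is unique on \<open>S\<close>, and the notion is the classical one: all
  partial derivatives up to order \<open>k\<close> exist in the interior and extend continuously to \<open>S\<close>.
\<close>

primrec Ck_on :: "nat \<Rightarrow> 'a::euclidean_space set \<Rightarrow> ('a \<Rightarrow> real) \<Rightarrow> bool" where
  "Ck_on 0 S f \<longleftrightarrow> continuous_on S f"
| "Ck_on (Suc k) S f \<longleftrightarrow>
     (\<exists>g. (\<forall>x\<in>S. (f has_derivative (\<lambda>v. g x \<bullet> v)) (at x within S)) \<and>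
          (\<forall>b\<in>Basis. Ck_on k S (\<lambda>x. g x \<bullet> b)))"

definition kernel_domain :: "real \<Rightarrow> (real \<times> real) set" where
  "kernel_domain T = {(t, s). 0 \<le> s \<and> s \<le> t \<and> t \<le> T}"

definition iae_solution ::
  "real \<Rightarrow> (real \<Rightarrow> real \<Rightarrow> real) \<Rightarrow> (real \<Rightarrow> real \<Rightarrow> real) \<Rightarrow> (real \<Rightarrow> real \<Rightarrow> real) \<Rightarrow>
   (real \<Rightarrow> real) \<Rightarrow> (real \<Rightarrow> real) \<Rightarrow> (real \<Rightarrow> real) \<Rightarrow> (real \<Rightarrow> real) \<Rightarrow> bool" where
  "iae_solution T K11 K12 K21 f1 f2 x1 x2 \<longleftrightarrow>
     continuous_on {0..T} x1 \<and> continuous_on {0..T} x2 \<and>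
     (\<forall>t\<in>{0..T}.
        x1 t + integral {0..t} (\<lambda>s. K11 t s * x1 s + K12 t s * x2 s) = f1 t \<and>
        integral {0..t} (\<lambda>s. K21 t s * x1 s) = f2 t)"

definition mesh_pt :: "real \<Rightarrow> nat \<Rightarrow> nat \<Rightarrow> real" where
  "mesh_pt T N n = real n * (T / real N)"

text \<open>
  The space \<open>S\<^sub>m\<^sub>-\<^sub>1\<^sup>(\<^sup>-\<^sup>1\<^sup>)(I\<^sub>h)\<close>, for \<open>m \<ge> 1\<close>. Its elements are functions on \<open>{0..T}\<close>; they are
  represented by total functions with the fixed value \<open>undefined\<close> outside this interval, so
  that equality (and hence uniqueness of the discrete solution) is equality on \<open>{0..T}\<close>.
\<close>

definition dg_space :: "real \<Rightarrow> nat \<Rightarrow> nat \<Rightarrow> (real \<Rightarrow> real) set" where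
  "dg_space T N m =
     {v \<in> extensional {0..T}.
        (\<forall>n<N. \<exists>p :: real poly. degree p \<le> m - 1 \<and>
           (\<forall>t\<in>{mesh_pt T N n<..mesh_pt T N (Suc n)}. v t = poly p t)) \<and>
        (v \<longlongrightarrow> v 0) (at_right 0)}"

definition dg_solution ::
  "real \<Rightarrow> nat \<Rightarrow> nat \<Rightarrow>
   (real \<Rightarrow> real \<Rightarrow> real) \<Rightarrow> (real \<Rightarrow> real \<Rightarrow> real) \<Rightarrow> (real \<Rightarrow> real \<Rightarrow> real) \<Rightarrow>
   (real \<Rightarrow> real) \<Rightarrow> (real \<Rightarrow> real) \<Rightarrow> (real \<Rightarrow> real) \<Rightarrow> (real \<Rightarrow> real) \<Rightarrow> bool" where
  "dg_solution T N m K11 K12 K21 f1 f2 u1 u2 \<longleftrightarrow>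
     u1 \<in> dg_space T N m \<and> u2 \<in> dg_space T N m \<and>
     (\<forall>\<phi>\<in>dg_space T N m. \<forall>n<N.
        integral {mesh_pt T N n..mesh_pt T N (Suc n)}
          (\<lambda>s. (u1 s + integral {0..s} (\<lambda>\<tau>. K11 s \<tau> * u1 \<tau> + K12 s \<tau> * u2 \<tau>)) * \<phi> s)
        = integral {mesh_pt T N n..mesh_pt T N (Suc n)} (\<lambda>s. f1 s * \<phi> s) \<and>
        integral {mesh_pt T N n..mesh_pt T N (Suc n)}
          (\<lambda>s. integral {0..s} (\<lambda>\<tau>. K21 s \<tau> * u1 \<tau>) * \<phi> s)
        = integral {mesh_pt T N n..mesh_pt T N (Suc n)} (\<lambda>s. f2 s * \<phi> s))"

definition dg_uniquely_solvable_below ::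
  "real \<Rightarrow> real \<Rightarrow> nat \<Rightarrow>
   (real \<Rightarrow> real \<Rightarrow> real) \<Rightarrow> (real \<Rightarrow> real \<Rightarrow> real) \<Rightarrow> (real \<Rightarrow> real \<Rightarrow> real) \<Rightarrow>
   (real \<Rightarrow> real) \<Rightarrow> (real \<Rightarrow> real) \<Rightarrow> bool" where
  "dg_uniquely_solvable_below hbar T m K11 K12 K21 f1 f2 \<longleftrightarrow>
     (\<forall>N\<ge>2. T / real N < hbar \<longrightarrow>
        (\<exists>!u. dg_solution T N m K11 K12 K21 f1 f2 (fst u) (snd u)))"

definition sup_norm_on :: "real set \<Rightarrow> (real \<Rightarrow> real) \<Rightarrow> real" where
  "sup_norm_on S g = (SUP t\<in>S. \<bar>g t\<bar>)"

end

theory Submission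
  imports Defs
begin

text \<open>
  Both discrete equations are, up to perturbations, first-kind Volterra equations for a primitive
  \<open>U\<close> of a piecewise polynomial. Integration by parts turns \<open>\<integral>\<^sub>0\<^sup>t K(t,s) u(s) ds\<close> into
  \<open>K(t,t) U(t) - \<integral>\<^sub>0\<^sup>t \<partial>\<^sub>s K(t,s) U(s) ds\<close>, and orthogonality of the residual to polynomials of degree
  below \<open>m\<close> on a cell fixes \<open>U\<close> there up to a multiple of the Legendre polynomial of degree \<open>m\<close>, whose
  end values have the same modulus. So a residual \<open>\<epsilon>\<close> costs one factor \<open>1/h\<close> over the \<open>N\<close> cells, and
  differentiating \<open>U\<close> costs another: \<open>u = O(\<epsilon>/h\<^sup>2)\<close>. With \<open>\<epsilon> = 0\<close> this is uniqueness, hence existence.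

  The comparison function is the primitive \<open>V\<close> solving the problem with kernel \<open>1\<close>. Its error
  \<open>W = V - \<integral>x\<close> is orthogonal on every cell, and so contributes to the residual of the second equation
  only \<open>O(h |W|)\<close>. Parity enters in \<open>W\<close>: the leading local errors accumulate for even \<open>m\<close>
  (\<open>W = O(h\<^sup>m)\<close>), and cancel at the two ends of a cell for odd \<open>m\<close> (\<open>W = O(h\<^sup>m\<^sup>+\<^sup>1)\<close>). The error of \<open>x\<^sub>1\<close> is
  then of the size \<open>|W|/h\<close>; it is the residual of the first equation, so that \<open>x\<^sub>2\<close> loses two more orders.
\<close>

section \<open>Orthogonal polynomials and projections\<close>

text \<open>The discrete equations cannot be differentiated, so the index-2 structure is met by
  applying one stability estimate for first-kind equations twice, to \<open>K21\<close> and then to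
  \<open>K12\<close>. The growth factor per cell must be 1 + O(h), since any fixed factor above 1
  would be raised to the power \<open>N\<close>. Hence the equality of moduli at the ends of a cell
  has to be used exactly, with the same frozen kernel value at both ends. Stability itself costs a
  factor \<open>N\<close>: a residual of the size of W would already spoil the order. The comparison
  function is chosen so that the main part \<open>K(t_n, t_n) W\<close> of this residual is
  invisible to the test functions, and the \<open>h\<close> gained in the rest pays for
  \<open>N\<close>. Throughout, \<open>k = m - 1\<close>, and the exponent \<rho> is
  \<open>k + 1\<close> for even \<open>k\<close> and \<open>k\<close> for odd \<open>k\<close>: W is
  \<open>O(h ^ (\<rho> + 1))\<close>, the error of the first component \<open>O(h ^ \<rho>)\<close>.
  The estimates hold below some \<open>h0\<close>, whereas the claim concerns every mesh below a
  given \<open>hbar\<close>; the finitely many meshes in between are absorbed by the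
  constant.\<close>

definition poly_orth :: "nat \<Rightarrow> real \<Rightarrow> real \<Rightarrow> (real \<Rightarrow> real) \<Rightarrow> bool" where
  "poly_orth k a b f \<longleftrightarrow> (\<forall>p::real poly. degree p \<le> k \<longrightarrow> integral {a..b} (\<lambda>s. f s * poly p s) = 0)"

lemma poly_orthD: "poly_orth k a b f \<Longrightarrow> degree p \<le> k \<Longrightarrow> integral {a..b} (\<lambda>s. f s * poly p s) = 0"
  by (simp add: poly_orth_def)

lemma continuous_on_poly_real [continuous_intros]: "continuous_on S (poly (p :: real poly))"
  by (intro continuous_intros)

lemma poly_orth_cong:
  assumes "poly_orth k a b f" "\<And>s. s \<in> {a..b} \<Longrightarrow> f s = g s"
  shows "poly_orth k a b g"
  unfolding poly_orth_def
proof (intro allI impI)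
  fix p :: "real poly" assume "degree p \<le> k"
  then have "integral {a..b} (\<lambda>s. f s * poly p s) = 0" using poly_orthD[OF assms(1)] by blast
  then show "integral {a..b} (\<lambda>s. g s * poly p s) = 0"
    using integral_cong[of "{a..b}" "\<lambda>s. f s * poly p s" "\<lambda>s. g s * poly p s"] assms(2) by simp
qed

lemma poly_orth_add:
  assumes "continuous_on {a..b} f" "continuous_on {a..b} g" "poly_orth k a b f" "poly_orth k a b g"
  shows "poly_orth k a b (\<lambda>s. f s + g s)"
  unfolding poly_orth_def
proof (intro allI impI)
  fix p :: "real poly" assume p: "degree p \<le> k"
  have "integral {a..b} (\<lambda>s. f s * poly p s + g s * poly p s) = 0"
    using assms p by (subst integral_add) (auto intro!: integrable_continuous_real continuous_intros simp: poly_orth_def)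
  then show "integral {a..b} (\<lambda>s. (f s + g s) * poly p s) = 0" by (simp add: distrib_right)
qed

lemma poly_orth_cmult:
  assumes "poly_orth k a b f" shows "poly_orth k a b (\<lambda>s. c * f s)"
  using assms by (simp add: poly_orth_def mult.assoc)

lemma poly_orth_diff:
  assumes "continuous_on {a..b} f" "continuous_on {a..b} g" "poly_orth k a b f" "poly_orth k a b g"
  shows "poly_orth k a b (\<lambda>s. f s - g s)"
proof -
  have "poly_orth k a b (\<lambda>s. f s + (- 1) * g s)"
    by (intro poly_orth_add poly_orth_cmult continuous_on_mult continuous_on_const assms)
  then show ?thesis by simp
qed

lemma poly_orth_mono: "poly_orth k a b f \<Longrightarrow> j \<le> k \<Longrightarrow> poly_orth j a b f"
  by (auto simp: poly_orth_def)

lemma integral_poly_square_pos: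
  assumes "a < b" "(p::real poly) \<noteq> 0"
  shows "integral {a..b} (\<lambda>s. poly p s * poly p s) > 0"
proof -
  have c: "continuous_on {a..b} (\<lambda>s. poly p s * poly p s)" by (intro continuous_intros)
  have "integral {a..b} (\<lambda>s. poly p s * poly p s) \<ge> 0"
    by (intro integral_nonneg integrable_continuous_real c) simp
  moreover have "integral {a..b} (\<lambda>s. poly p s * poly p s) \<noteq> 0"
  proof
    assume "integral {a..b} (\<lambda>s. poly p s * poly p s) = 0"
    then have "\<forall>s\<in>cbox a b. poly p s * poly p s = 0"
      using integral_eq_0_iff[of a b "\<lambda>s. poly p s * poly p s"] assms(1) c by simp
    then have "{a..b} \<subseteq> {s. poly p s = 0}" by auto
    then have "infinite {s. poly p s = 0}" using infinite_Icc[OF assms(1)] by (meson finite_subset)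
    then show False using poly_roots_finite[of p] assms(2) by simp
  qed
  ultimately show ?thesis by linarith
qed

lemma continuous_bounded_interval:
  fixes f :: "real \<Rightarrow> real"
  assumes "continuous_on {a..b} f"
  obtains M where "M \<ge> 0" "\<And>x. x \<in> {a..b} \<Longrightarrow> \<bar>f x\<bar> \<le> M"
proof -
  have "bounded (f ` {a..b})"
    by (intro compact_imp_bounded compact_continuous_image assms compact_Icc)
  then obtain B where "\<forall>y\<in>f ` {a..b}. \<bar>y\<bar> \<le> B" unfolding bounded_iff by auto
  then have "\<bar>f x\<bar> \<le> max B 0" if "x \<in> {a..b}" for x using that by (meson image_eqI max.coboundedI1)
  then show ?thesis using that[of "max B 0"] by simp
qed

lemma poly_orth_self_imp_zero:
  assumes "a < b" "degree p \<le> k" "poly_orth k a b (poly p)"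
  shows "p = 0"
  using integral_poly_square_pos[of a b p] poly_orthD[OF assms(3,2)] assms(1) by auto

lemma integral_affine:
  fixes f :: "real \<Rightarrow> real"
  assumes "a < b" "continuous_on {a..b} f"
  shows "integral {a..b} f = (b - a) * integral {0..1} (\<lambda>\<theta>. f (a + (b - a) * \<theta>))"
proof -
  have "(f has_integral integral {a..b} f) (cbox a b)"
    using assms by (auto intro!: integrable_integral integrable_continuous_real)
  from has_integral_affinity'[OF this, of "b - a" a] assms(1)
  have "((\<lambda>x. f ((b - a) * x + a)) has_integral integral {a..b} f / (b - a)) {0..1}"
    by (simp add: field_simps)
  then have "integral {0..1} (\<lambda>x. f ((b - a) * x + a)) = integral {a..b} f / (b - a)"
    by (rule integral_unique)
  then show ?thesis using assms(1) by (simp add: add.commute)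
qed

lemma continuous_on_affine:
  fixes f :: "real \<Rightarrow> real"
  assumes "a < b" "continuous_on {a..b} f"
  shows "continuous_on {0..1} (\<lambda>\<theta>. f (a + (b - a) * \<theta>))"
proof (rule continuous_on_compose2[OF assms(2)])
  show "(\<lambda>\<theta>. a + (b - a) * \<theta>) ` {0..1} \<subseteq> {a..b}"
  proof
    fix s assume "s \<in> (\<lambda>\<theta>. a + (b - a) * \<theta>) ` {0..1}"
    then obtain t where t: "0 \<le> t" "t \<le> 1" "s = a + (b - a) * t" by auto
    have "(b - a) * t \<le> (b - a) * 1" using t assms(1) by (intro mult_left_mono) auto
    moreover have "0 \<le> (b - a) * t" using t assms(1) by simp
    ultimately show "s \<in> {a..b}" using t by simp
  qed
qed (auto intro!: continuous_intros)

text \<open>Constants are computed once on the unit interval. Affine substitutions respect the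
  degree bound, so orthogonality moves between the reference interval and every cell, and the
  constants do not depend on \<open>h\<close>.\<close>

lemma poly_orth_affine:
  assumes "a < b" "continuous_on {a..b} f"
  shows "poly_orth k a b f \<longleftrightarrow> poly_orth k 0 1 (\<lambda>\<theta>. f (a + (b - a) * \<theta>))"
proof
  assume L: "poly_orth k a b f"
  show "poly_orth k 0 1 (\<lambda>\<theta>. f (a + (b - a) * \<theta>))" unfolding poly_orth_def
  proof (intro allI impI)
    fix p :: "real poly" assume p: "degree p \<le> k"
    define r where "r = pcompose p [:- a / (b - a), 1 / (b - a):]"
    have "degree r \<le> k" using p degree_pcompose_le[of p "[:- a / (b - a), 1 / (b - a):]"]
      unfolding r_def by (simp split: if_splits)
    then have "integral {a..b} (\<lambda>s. f s * poly r s) = 0" by (rule poly_orthD[OF L])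
    moreover have "integral {a..b} (\<lambda>s. f s * poly r s)
        = (b - a) * integral {0..1} (\<lambda>\<theta>. f (a + (b - a) * \<theta>) * poly r (a + (b - a) * \<theta>))"
      by (rule integral_affine) (use assms in \<open>auto intro!: continuous_intros\<close>)
    moreover have "poly r (a + (b - a) * \<theta>) = poly p \<theta>" for \<theta>
    proof -
      have "- a / (b - a) + (a + (b - a) * \<theta>) / (b - a) = ((b - a) * \<theta>) / (b - a)"
        by (simp add: add_divide_distrib)
      also have "\<dots> = \<theta>" using assms(1) by simp
      finally have "- a / (b - a) + (a + (b - a) * \<theta>) / (b - a) = \<theta>" .
      then show ?thesis by (simp add: r_def poly_pcompose)
    qed
    ultimately show "integral {0..1} (\<lambda>\<theta>. f (a + (b - a) * \<theta>) * poly p \<theta>) = 0" using assms(1) by simp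
  qed
next
  assume R: "poly_orth k 0 1 (\<lambda>\<theta>. f (a + (b - a) * \<theta>))"
  show "poly_orth k a b f" unfolding poly_orth_def
  proof (intro allI impI)
    fix p :: "real poly" assume p: "degree p \<le> k"
    have "degree (pcompose p [:a, b - a:]) \<le> k" using p degree_pcompose_le[of p "[:a, b - a:]"]
      by (simp split: if_splits)
    then have "integral {0..1} (\<lambda>\<theta>. f (a + (b - a) * \<theta>) * poly (pcompose p [:a, b - a:]) \<theta>) = 0"
      by (rule poly_orthD[OF R])
    moreover have "integral {a..b} (\<lambda>s. f s * poly p s)
        = (b - a) * integral {0..1} (\<lambda>\<theta>. f (a + (b - a) * \<theta>) * poly p (a + (b - a) * \<theta>))"
      by (rule integral_affine) (use assms in \<open>auto intro!: continuous_intros\<close>)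
    ultimately show "integral {a..b} (\<lambda>s. f s * poly p s) = 0"
      by (simp add: poly_pcompose mult.commute)
  qed
qed

section \<open>Bounded L2 projection onto polynomials\<close>

lemma abs_integral_le_bound:
  fixes f :: "real \<Rightarrow> real"
  assumes "a \<le> b" "continuous_on {a..b} f" "\<And>s. s \<in> {a..b} \<Longrightarrow> \<bar>f s\<bar> \<le> M"
  shows "\<bar>integral {a..b} f\<bar> \<le> M * (b - a)"
  using integral_bound[OF assms(1,2), of M] assms(3) by simp

text \<open>The L2 projection onto degree \<open>k\<close>. Its coefficients, rather than a norm,
  are bounded by the supremum of \<open>f\<close>, because that controls values and derivatives
  alike. It is a predicate in \<open>k\<close> so that induction applies, each stage producing the
  next orthogonal polynomial.\<close>

definition poly_projectable :: "nat \<Rightarrow> bool" where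
  "poly_projectable k \<longleftrightarrow> (\<exists>C\<ge>0. \<forall>f M. continuous_on {0..1} f \<longrightarrow> (\<forall>x\<in>{0..1}. \<bar>f x\<bar> \<le> M) \<longrightarrow>
     (\<exists>p::real poly. degree p \<le> k \<and> poly_orth k 0 1 (\<lambda>x. f x - poly p x) \<and> (\<forall>i. \<bar>coeff p i\<bar> \<le> C * M)))"

lemma poly_projectableE:
  assumes "poly_projectable k"
  obtains C where "C \<ge> 0" "\<And>f M. continuous_on {0..1} f \<Longrightarrow> (\<And>x. x \<in> {0..1} \<Longrightarrow> \<bar>f x\<bar> \<le> M) \<Longrightarrow>
     \<exists>p::real poly. degree p \<le> k \<and> poly_orth k 0 1 (\<lambda>x. f x - poly p x) \<and> (\<forall>i. \<bar>coeff p i\<bar> \<le> C * M)"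
  using assms unfolding poly_projectable_def by blast

lemma poly_projectable_0: "poly_projectable 0"
  unfolding poly_projectable_def
proof (intro exI[of _ "1::real"] conjI allI impI)
      fix f :: "real \<Rightarrow> real" and M :: real
      assume c: "continuous_on {0..1} f" and M: "\<forall>x\<in>{0..1}. \<bar>f x\<bar> \<le> M"
      define I where "I = integral {0..1} f"
      have I: "\<bar>I\<bar> \<le> M" using abs_integral_le_bound[of 0 1 f M] c M by (simp add: I_def)
      have M0: "M \<ge> 0" using I by linarith
      show "\<exists>p::real poly. degree p \<le> 0 \<and> poly_orth 0 0 1 (\<lambda>x. f x - poly p x) \<and> (\<forall>i. \<bar>coeff p i\<bar> \<le> 1 * M)"
      proof (intro exI[of _ "[:I:]"] conjI allI)
        show "poly_orth 0 0 1 (\<lambda>x. f x - poly [:I:] x)" unfolding poly_orth_def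
        proof (intro allI impI)
          fix p :: "real poly" assume "degree p \<le> 0"
          then obtain c0 where p: "p = [:c0:]" using degree_eq_zeroE by blast
          have "integral {0..1} (\<lambda>s. f s - I) = 0"
            using c by (subst integral_diff) (auto simp: I_def intro!: integrable_continuous_real)
          then show "integral {0..1} (\<lambda>s. (f s - poly [:I:] s) * poly p s) = 0" by (simp add: p)
        qed
      qed (use I M0 in \<open>auto simp: coeff_pCons split: nat.split\<close>)
    qed simp

text \<open>One Gram-Schmidt step: the remainder of \<open>x ^ Suc k\<close> after projection. It is
  the shifted Legendre polynomial, normalised to be monic.\<close>

lemma monic_orthogonal_poly_aux:
  assumes "poly_projectable k"
  shows "\<exists>q::real poly. degree q = Suc k \<and> lead_coeff q = 1 \<and> poly_orth k 0 1 (poly q)"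
proof -
    obtain C where C: "\<And>f M. continuous_on {0..1} f \<Longrightarrow> (\<And>x. x \<in> {0..1} \<Longrightarrow> \<bar>f x\<bar> \<le> M) \<Longrightarrow>
       \<exists>p::real poly. degree p \<le> k \<and> poly_orth k 0 1 (\<lambda>x. f x - poly p x) \<and> (\<forall>i. \<bar>coeff p i\<bar> \<le> C * M)"
      by (rule poly_projectableE[OF assms]) blast
    have c: "continuous_on {0..1::real} (\<lambda>x. x ^ Suc k)" by (intro continuous_intros)
    have b: "\<bar>x ^ Suc k\<bar> \<le> 1" if "x \<in> {0..1}" for x :: real
      using that by (auto simp del: power_Suc intro: power_le_one)
    obtain p :: "real poly" where p: "degree p \<le> k" "poly_orth k 0 1 (\<lambda>x. x ^ Suc k - poly p x)"
      using C[OF c b] by blast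
    let ?q = "monom 1 (Suc k) - p"
    have deg: "degree ?q = Suc k"
      using p(1) degree_add_eq_left[of "-p" "monom (1::real) (Suc k)"] by (simp add: degree_monom_eq)
    have "poly_orth k 0 1 (poly ?q)"
      by (rule poly_orth_cong[OF p(2)]) (simp add: poly_monom)
    moreover have "lead_coeff ?q = 1" unfolding deg using p(1) by (simp add: coeff_eq_0)
    ultimately show ?thesis using deg by blast
qed

text \<open>The projection gains the Fourier term \<open>I / nu\<close> along the new orthogonal
  polynomial \<open>q\<close>; the lower part is kept, because \<open>q\<close> is orthogonal to
  degree \<open>k\<close>.\<close>

lemma poly_projectable_Suc:
  assumes "poly_projectable k"
  shows "poly_projectable (Suc k)"
proof -
    obtain q :: "real poly" where q: "degree q = Suc k" "lead_coeff q = 1" "poly_orth k 0 1 (poly q)"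
      using monic_orthogonal_poly_aux[OF assms] by blast
    obtain C where C: "C \<ge> 0" "\<And>f M. continuous_on {0..1} f \<Longrightarrow> (\<And>x. x \<in> {0..1} \<Longrightarrow> \<bar>f x\<bar> \<le> M) \<Longrightarrow>
     \<exists>p::real poly. degree p \<le> k \<and> poly_orth k 0 1 (\<lambda>x. f x - poly p x) \<and> (\<forall>i. \<bar>coeff p i\<bar> \<le> C * M)"
      by (rule poly_projectableE[OF assms]) blast
    define nu where "nu = integral {0..1} (\<lambda>s. poly q s * poly q s)"
    have nu: "nu > 0" unfolding nu_def by (rule integral_poly_square_pos) (use q in auto)
    obtain Q where Q0: "Q \<ge> 0" and Q: "\<And>x. x \<in> {0..1} \<Longrightarrow> \<bar>poly q x\<bar> \<le> Q"
      using continuous_bounded_interval[OF continuous_on_poly_real] by metis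
    define A where "A = (\<Sum>i\<le>degree q. \<bar>coeff q i\<bar>)"
    have A: "\<bar>coeff q i\<bar> \<le> A" "A \<ge> 0" for i
    proof -
      show "A \<ge> 0" by (simp add: A_def sum_nonneg)
      then show "\<bar>coeff q i\<bar> \<le> A"
        by (cases "i \<le> degree q") (auto simp: A_def coeff_eq_0 intro!: member_le_sum)
    qed
    show ?thesis unfolding poly_projectable_def
    \<comment> \<open>\<open>Q\<close> bounds \<open>q\<close> on the interval, hence |I| by
      \<open>M * Q\<close>; \<open>nu\<close> is the squared norm of \<open>q\<close>, and
      \<open>A\<close> bounds each of its coefficients.\<close>
    proof (intro exI[of _ "C + Q / nu * A"] conjI allI impI)
      show "0 \<le> C + Q / nu * A" using C Q0 nu A by simp
      fix f :: "real \<Rightarrow> real" and M :: real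
      assume c: "continuous_on {0..1} f" and M: "\<forall>x\<in>{0..1}. \<bar>f x\<bar> \<le> M"
      have M0: "M \<ge> 0" using M[rule_format, of 0] by simp
      obtain p :: "real poly" where p: "degree p \<le> k" "poly_orth k 0 1 (\<lambda>x. f x - poly p x)" "\<And>i. \<bar>coeff p i\<bar> \<le> C * M"
        using C(2)[OF c] M by blast
      define I where "I = integral {0..1} (\<lambda>s. f s * poly q s)"
      have I: "\<bar>I\<bar> \<le> M * Q"
      proof -
        have "\<bar>I\<bar> \<le> (M * Q) * (1 - 0)" unfolding I_def
          by (rule abs_integral_le_bound)
            (use c M Q M0 in \<open>auto intro!: continuous_on_mult continuous_on_poly_real mult_mono simp: abs_mult\<close>)
        then show ?thesis by simp
      qed
      show "\<exists>p::real poly. degree p \<le> Suc k \<and> poly_orth (Suc k) 0 1 (\<lambda>x. f x - poly p x) \<and> (\<forall>i. \<bar>coeff p i\<bar> \<le> (C + Q / nu * A) * M)"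
      proof (intro exI[of _ "p + smult (I / nu) q"] conjI allI)
        show "degree (p + smult (I / nu) q) \<le> Suc k"
          by (intro degree_add_le) (use p(1) q(1) in auto)
        fix i
        have "\<bar>coeff (p + smult (I / nu) q) i\<bar> \<le> C * M + \<bar>I\<bar> / nu * A"
        proof -
          have "\<bar>I / nu * coeff q i\<bar> \<le> \<bar>I\<bar> / nu * A"
            unfolding abs_mult abs_divide using A(1)[of i] A(2) nu by (intro mult_mono) auto
          moreover have "coeff (p + smult (I / nu) q) i = coeff p i + I / nu * coeff q i" by simp
          ultimately show ?thesis using p(3)[of i] by linarith
        qed
        also have "\<dots> \<le> C * M + (M * Q) / nu * A" using I nu A
          by (intro add_left_mono mult_right_mono divide_right_mono) auto
        finally show "\<bar>coeff (p + smult (I / nu) q) i\<bar> \<le> (C + Q / nu * A) * M" by (simp add: algebra_simps)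
      next
        have orthk: "poly_orth k 0 1 (\<lambda>x. f x - poly (p + smult (I / nu) q) x)"
        proof (rule poly_orth_cong)
          show "poly_orth k 0 1 (\<lambda>x. (f x - poly p x) - I / nu * poly q x)"
            by (rule poly_orth_diff[OF _ _ p(2) poly_orth_cmult[OF q(3)]])
              (intro continuous_on_mult continuous_on_diff c continuous_on_const continuous_on_poly_real)+
        qed (simp add: algebra_simps)
        have orthq: "integral {0..1} (\<lambda>x. (f x - poly (p + smult (I / nu) q) x) * poly q x) = 0"
        proof -
          have "integral {0..1} (\<lambda>x. poly q x * poly p x) = 0" by (rule poly_orthD[OF q(3) p(1)])
          moreover have "integral {0..1} (\<lambda>x. (f x - poly (p + smult (I / nu) q) x) * poly q x)
             = integral {0..1} (\<lambda>x. (f x * poly q x - poly q x * poly p x) - (I/nu) * (poly q x * poly q x))"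
            by (intro integral_cong) (simp add: algebra_simps)
          moreover have "integral {0..1} (\<lambda>x. (f x * poly q x - poly q x * poly p x) - (I/nu) * (poly q x * poly q x))
             = integral {0..1} (\<lambda>x. f x * poly q x - poly q x * poly p x) - integral {0..1} (\<lambda>x. (I/nu) * (poly q x * poly q x))"
            by (intro integral_diff integrable_continuous_real continuous_on_mult continuous_on_diff c
                 continuous_on_const continuous_on_poly_real)
          moreover have "integral {0..1} (\<lambda>x. f x * poly q x - poly q x * poly p x)
             = I - integral {0..1} (\<lambda>x. poly q x * poly p x)" unfolding I_def
            by (intro integral_diff integrable_continuous_real continuous_on_mult continuous_on_diff c
                 continuous_on_const continuous_on_poly_real)
          ultimately show ?thesis using nu by (simp add: nu_def)
        qed
        show "poly_orth (Suc k) 0 1 (\<lambda>x. f x - poly (p + smult (I / nu) q) x)" unfolding poly_orth_def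
        proof (intro allI impI)
          fix r :: "real poly" assume r: "degree r \<le> Suc k"
          \<comment> \<open>As \<open>q\<close> is monic, subtracting its multiple leaves degree
            \<open>k\<close>; testing with \<open>r\<close> thus splits into \<open>orthk\<close>
            and \<open>orthq\<close>.\<close>
          define r0 where "r0 = r - smult (coeff r (Suc k)) q"
          have "degree r0 \<le> k" unfolding r0_def
          proof (rule degree_le, intro allI impI)
            fix i assume "k < i"
            then consider "i = Suc k" | "i > Suc k" by linarith
            then show "coeff (r - smult (coeff r (Suc k)) q) i = 0"
              using q(1,2) r by cases (auto simp: coeff_eq_0)
          qed
          then have 0: "integral {0..1} (\<lambda>x. (f x - poly (p + smult (I / nu) q) x) * poly r0 x) = 0"
            by (rule poly_orthD[OF orthk])
          have "integral {0..1} (\<lambda>x. (f x - poly (p + smult (I / nu) q) x) * poly r x)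
             = integral {0..1} (\<lambda>x. (f x - poly (p + smult (I / nu) q) x) * poly r0 x
                  + coeff r (Suc k) * ((f x - poly (p + smult (I / nu) q) x) * poly q x))"
            by (intro integral_cong) (simp add: r0_def algebra_simps)
          also have "\<dots> = 0"
            using 0 orthq by (subst integral_add) (auto intro!: integrable_continuous_real
              continuous_on_mult continuous_on_diff c continuous_on_const continuous_on_poly_real simp del: poly_add poly_smult)
          finally show "integral {0..1} (\<lambda>x. (f x - poly (p + smult (I / nu) q) x) * poly r x) = 0" .
        qed
      qed
    qed
qed

lemma poly_projectable: "poly_projectable k"
  by (induction k) (simp_all add: poly_projectable_0 poly_projectable_Suc)

lemma monic_orthogonal_poly:
  "\<exists>q::real poly. degree q = Suc k \<and> lead_coeff q = 1 \<and> poly_orth k 0 1 (poly q)"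
  using monic_orthogonal_poly_aux poly_projectable by blast

section \<open>Uniqueness and endpoint values of the orthogonal polynomials\<close>

lemma integral_reflect_unit:
  fixes g :: "real \<Rightarrow> real"
  assumes "continuous_on {0..1} g"
  shows "integral {0..1} (\<lambda>s. g (1 - s)) = integral {0..1} g"
proof -
  have c: "continuous_on {-1..0} (\<lambda>x. g (- x))"
    by (rule continuous_on_compose2[OF assms]) (auto intro!: continuous_intros)
  have "integral {0..1} g = integral {-1..0} (\<lambda>x. g (- x))"
    using Henstock_Kurzweil_Integration.integral_reflect_real[of 1 0 g] by simp
  also have "\<dots> = integral {0..1} (\<lambda>s. g (1 - s))"
    using integral_affine[OF _ c] by simp
  finally show ?thesis by simp
qed

lemma degree_diff_monic_le:
  fixes p q :: "real poly"
  assumes "degree p \<le> Suc k" "degree q = Suc k" "lead_coeff q = 1"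
  shows "degree (p - smult (coeff p (Suc k)) q) \<le> k"
proof (rule degree_le, intro allI impI)
  fix i assume "k < i"
  then consider "i = Suc k" | "i > Suc k" by linarith
  then show "coeff (p - smult (coeff p (Suc k)) q) i = 0"
    using assms by cases (auto simp: coeff_eq_0)
qed

text \<open>The leading terms cancel in the difference, which is then orthogonal to itself. This is
  why each cell leaves exactly one free parameter.\<close>

lemma poly_orth_multiple:
  fixes p q :: "real poly"
  assumes "a < b" "degree p \<le> Suc k" "degree q = Suc k" "lead_coeff q = 1"
    and "poly_orth k a b (poly p)" "poly_orth k a b (poly q)"
  shows "p = smult (coeff p (Suc k)) q"
proof -
  let ?r = "p - smult (coeff p (Suc k)) q"
  have "poly_orth k a b (\<lambda>s. poly p s - coeff p (Suc k) * poly q s)"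
    by (rule poly_orth_diff[OF _ _ assms(5) poly_orth_cmult[OF assms(6)]])
       (intro continuous_on_mult continuous_on_const continuous_on_poly_real)+
  then have "poly_orth k a b (poly ?r)" by (rule poly_orth_cong) simp
  with poly_orth_self_imp_zero[OF assms(1) degree_diff_monic_le[OF assms(2-4)]] show ?thesis by simp
qed

text \<open>A zero at \<open>0\<close> would give \<open>q = x p\<close>, and testing with
  \<open>p\<close> would make the integral of \<open>x p ^ 2\<close> vanish. The reflection
  \<open>x -> 1 - x\<close> preserves orthogonality and hence reproduces \<open>q\<close> up to the
  sign of the leading coefficient.\<close>

lemma orthogonal_poly_endpoints:
  fixes q :: "real poly"
  assumes q: "degree q = Suc k" "lead_coeff q = 1" "poly_orth k 0 1 (poly q)"
  shows "poly q 0 \<noteq> 0" "poly q 1 = (- 1) ^ Suc k * poly q 0"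
proof -
  show "poly q 0 \<noteq> 0"
  proof
    assume "poly q 0 = 0"
    then have "[:0, 1:] dvd q" using poly_eq_0_iff_dvd[of q 0] by simp
    then obtain p where p: "q = [:0, 1:] * p" unfolding dvd_def by (elim exE) (rule that)
    have pn: "p \<noteq> 0" using p q(1) by auto
    then have "degree p = k" using degree_mult_eq[of "[:0, 1::real:]" p] q(1)[unfolded p] by simp
    then have "integral {0..1} (\<lambda>s. poly q s * poly p s) = 0"
      using poly_orthD[OF q(3), of p] by simp
    moreover have "continuous_on (cbox 0 1) (\<lambda>s. poly q s * poly p s)"
      by (intro continuous_on_mult continuous_on_poly_real)
    moreover have "0 \<le> poly q s * poly p s" if "s \<in> cbox 0 1" for s
    proof -
      have "poly q s * poly p s = s * (poly p s)\<^sup>2" by (simp add: p power2_eq_square)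
      then show ?thesis using that by simp
    qed
    ultimately have "\<forall>s\<in>cbox 0 1. poly q s * poly p s = 0"
      using integral_eq_0_iff[of 0 1 "\<lambda>s. poly q s * poly p s"] by (simp only: box_real cbox_interval, simp)
    moreover have "poly q s = s * poly p s" for s by (simp add: p)
    ultimately have "\<forall>s\<in>cbox 0 1. s * poly p s = 0" by simp
    then have "poly p s = 0" if "s \<in> {0<..1}" for s using that bspec[of "cbox 0 1" "\<lambda>s. s * poly p s = 0" s] by simp
    then have "{0<..1} \<subseteq> {s. poly p s = 0}" by blast
    moreover have "infinite {0<..1::real}" by simp
    ultimately have "infinite {s. poly p s = 0}" by (meson finite_subset)
    then show False using poly_roots_finite[OF pn] by simp
  qed
next
  let ?q = "pcompose q [:1, -1:]"
  have deg: "degree ?q = Suc k" using q(1) by (simp add: degree_pcompose)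
  have lc: "coeff ?q (Suc k) = (- 1) ^ Suc k"
    using lead_coeff_comp[of "[:1, -1::real:]" q] q(1,2) deg by simp
  have "poly_orth k 0 1 (poly ?q)" unfolding poly_orth_def
  proof (intro allI impI)
    fix p :: "real poly" assume "degree p \<le> k"
    then have "degree (pcompose p [:1, -1:]) \<le> k" by (simp add: degree_pcompose)
    then have "integral {0..1} (\<lambda>s. poly q s * poly (pcompose p [:1, -1:]) s) = 0"
      by (rule poly_orthD[OF q(3)])
    then show "integral {0..1} (\<lambda>s. poly ?q s * poly p s) = 0"
      using integral_reflect_unit[of "\<lambda>s. poly ?q s * poly p s"]
      using continuous_on_mult[OF continuous_on_poly_real continuous_on_poly_real, of "{0..1}" ?q p]
      by (simp add: poly_pcompose)
  qed
  from poly_orth_multiple[OF _ _ q(1,2) this q(3)] deg lc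
  have "?q = smult ((- 1) ^ Suc k) q" by simp
  then have "poly ?q 0 = (- 1) ^ Suc k * poly q 0" by simp
  then show "poly q 1 = (- 1) ^ Suc k * poly q 0" by (simp add: poly_pcompose)
qed

section \<open>Inverse inequality and the recursion over one cell\<close>

lemma poly_bound_unit_interval:
  fixes p :: "real poly"
  assumes "degree p \<le> k" "\<And>i. \<bar>coeff p i\<bar> \<le> B" "x \<in> {0..1}"
  shows "\<bar>poly p x\<bar> \<le> real (Suc k) * B"
proof -
  have B: "B \<ge> 0" using assms(2)[of 0] by linarith
  have "poly p x = (\<Sum>i\<le>degree p. coeff p i * x ^ i)" by (rule poly_altdef)
  also have "\<bar>\<dots>\<bar> \<le> (\<Sum>i\<le>degree p. B)"
  proof (rule order_trans[OF sum_abs sum_mono])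
    fix i
    have "\<bar>coeff p i\<bar> * \<bar>x ^ i\<bar> \<le> B * 1"
      using assms B by (intro mult_mono) (auto intro: power_le_one)
    then show "\<bar>coeff p i * x ^ i\<bar> \<le> B" by (simp add: abs_mult)
  qed
  also have "\<dots> = real (Suc (degree p)) * B" by simp
  also have "\<dots> \<le> real (Suc k) * B" using assms(1) B by (intro mult_right_mono) auto
  finally show ?thesis .
qed

lemma pcompose_affine:
  fixes p :: "real poly"
  shows "degree (pcompose p [:a, c:]) \<le> degree p" "poly (pcompose p [:a, c:]) x = poly p (a + c * x)"
  using degree_pcompose_le[of p "[:a, c:]"]
  by (auto simp: poly_pcompose mult.commute split: if_splits)

lemma affine_unit_interval:
  assumes "a < b" "s \<in> {a..b}"
  shows "(s - a) / (b - a) \<in> {0..1::real}" "a + (b - a) * ((s - a) / (b - a)) = s"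
  using assms by (auto simp: divide_le_eq)

text \<open>A crude Markov inequality, in which only the scaling \<open>1 / (b - a)\<close> matters:
  it is the power of \<open>h\<close> lost when passing from primitives to their
  derivatives.\<close>

lemma poly_markov_inequality:
  "\<exists>C\<ge>0. \<forall>a b (p::real poly) M. a < b \<longrightarrow> degree p \<le> k \<longrightarrow> (\<forall>s\<in>{a..b}. \<bar>poly p s\<bar> \<le> M) \<longrightarrow>
     (\<forall>s\<in>{a..b}. \<bar>poly (pderiv p) s\<bar> \<le> C * M / (b - a))"
proof -
  obtain C where C: "C \<ge> 0" "\<And>f M. continuous_on {0..1} f \<Longrightarrow> (\<And>x. x \<in> {0..1} \<Longrightarrow> \<bar>f x\<bar> \<le> M) \<Longrightarrow>
     \<exists>p::real poly. degree p \<le> k \<and> poly_orth k 0 1 (\<lambda>x. f x - poly p x) \<and> (\<forall>i. \<bar>coeff p i\<bar> \<le> C * M)"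
    by (rule poly_projectableE[OF poly_projectable[of k]]) blast
  \<comment> \<open>A polynomial of degree \<open>k\<close> is its own projection, so the projection
    bound controls its coefficients by its values.\<close>
  have coeffs: "\<bar>coeff p i\<bar> \<le> C * M"
    if p: "degree p \<le> k" "\<And>x. x \<in> {0..1} \<Longrightarrow> \<bar>poly p x\<bar> \<le> M" for p M i
  proof -
    obtain r where r: "degree r \<le> k" "poly_orth k 0 1 (\<lambda>x. poly p x - poly r x)" "\<And>i. \<bar>coeff r i\<bar> \<le> C * M"
      using C(2)[OF continuous_on_poly_real p(2)] by blast
    have "poly_orth k 0 1 (poly (p - r))" by (rule poly_orth_cong[OF r(2)]) simp
    moreover have "degree (p - r) \<le> k" using p(1) r(1) by (rule degree_diff_le)
    ultimately have "p - r = 0" using poly_orth_self_imp_zero[of 0 1 "p - r" k] by simp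
    then show ?thesis using r(3) by simp
  qed
  show ?thesis
  proof (intro exI[of _ "real (Suc k) * (real (Suc k) * C)"] conjI allI impI ballI)
    fix a b :: real and p :: "real poly" and M s :: real
    assume ab: "a < b" and deg: "degree p \<le> k" and M: "\<forall>s\<in>{a..b}. \<bar>poly p s\<bar> \<le> M" and s: "s \<in> {a..b}"
    have M0: "M \<ge> 0" using M s by fastforce
    let ?q = "pcompose p [:a, b - a:]"
    have dq: "degree ?q \<le> k" using pcompose_affine(1)[of p a "b - a"] deg by linarith
    have q: "\<bar>coeff ?q i\<bar> \<le> C * M" for i
    proof (rule coeffs[OF dq])
      fix x :: real assume x: "x \<in> {0..1}"
      have "(b - a) * x \<le> (b - a) * 1" using x ab by (intro mult_left_mono) auto
      moreover have "0 \<le> (b - a) * x" using x ab by simp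
      ultimately show "\<bar>poly ?q x\<bar> \<le> M" using M by (simp add: pcompose_affine(2))
    qed
    have d: "\<bar>coeff (pderiv ?q) i\<bar> \<le> real (Suc k) * (C * M)" for i
    proof (cases "Suc i \<le> k")
      case True
      then have "real (Suc i) * \<bar>coeff ?q (Suc i)\<bar> \<le> real (Suc k) * (C * M)"
        using q by (intro mult_mono) auto
      then show ?thesis by (simp add: coeff_pderiv abs_mult)
    next
      case False
      then have "coeff ?q (Suc i) = 0" using dq by (intro coeff_eq_0) linarith
      then show ?thesis using C(1) M0 by (simp add: coeff_pderiv)
    qed
    have "\<bar>poly (pderiv ?q) ((s - a) / (b - a))\<bar> \<le> real (Suc k) * (real (Suc k) * (C * M))"
      by (rule poly_bound_unit_interval[OF _ d affine_unit_interval(1)[OF ab s]])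
        (use dq degree_pderiv[of ?q] in linarith)
    moreover have "poly (pderiv ?q) ((s - a) / (b - a)) = (b - a) * poly (pderiv p) s"
      using affine_unit_interval(2)[OF ab s]
      by (simp add: pderiv_pcompose pcompose_affine(2) pderiv_pCons)
    ultimately have "(b - a) * \<bar>poly (pderiv p) s\<bar> \<le> real (Suc k) * (real (Suc k) * (C * M))"
      using ab by (simp add: abs_mult)
    then show "\<bar>poly (pderiv p) s\<bar> \<le> real (Suc k) * (real (Suc k) * C) * M / (b - a)"
      using ab by (simp only: pos_le_divide_eq diff_gt_0_iff_gt mult_ac)
  qed (use C in simp)
qed

text \<open>\<open>p\<close> minus the projection \<open>r\<close> of \<open>g\<close> is a multiple
  of the orthogonal polynomial \<open>q\<close>. Since |q 1| = |q 0|, the initial value reaches the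
  right end with factor exactly 1; only the perturbation \<open>e\<close> carries a
  constant.\<close>

lemma orthogonal_step_unit:
  "\<exists>C\<ge>0. \<forall>p g e. degree p \<le> Suc k \<longrightarrow> continuous_on {0..1} g \<longrightarrow>
     (\<forall>s\<in>{0..1}. \<bar>g s\<bar> \<le> e) \<longrightarrow> poly_orth k 0 1 (\<lambda>s. poly p s - g s) \<longrightarrow>
     (\<forall>s\<in>{0..1}. \<bar>poly p s\<bar> \<le> C * (\<bar>poly p 0\<bar> + e)) \<and> \<bar>poly p 1\<bar> \<le> \<bar>poly p 0\<bar> + C * e"
proof -
  obtain C where C: "C \<ge> 0" "\<And>f M. continuous_on {0..1} f \<Longrightarrow> (\<And>x. x \<in> {0..1} \<Longrightarrow> \<bar>f x\<bar> \<le> M) \<Longrightarrow>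
     \<exists>p::real poly. degree p \<le> k \<and> poly_orth k 0 1 (\<lambda>x. f x - poly p x) \<and> (\<forall>i. \<bar>coeff p i\<bar> \<le> C * M)"
    by (rule poly_projectableE[OF poly_projectable[of k]]) blast
  obtain q :: "real poly" where q: "degree q = Suc k" "lead_coeff q = 1" "poly_orth k 0 1 (poly q)"
    using monic_orthogonal_poly by blast
  note q01 = orthogonal_poly_endpoints[OF q]
  obtain Q where Q: "Q \<ge> 0" "\<And>x. x \<in> {0..1} \<Longrightarrow> \<bar>poly q x\<bar> \<le> Q"
    using continuous_bounded_interval[OF continuous_on_poly_real] by metis
  define q0 where "q0 = \<bar>poly q 0\<bar>"
  have q0: "q0 > 0" using q01(1) by (simp add: q0_def)
  define A where "A = real (Suc k) * C"
  have A: "A \<ge> 0" using C by (simp add: A_def)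
  \<comment> \<open>A sum dominating every factor that occurs: \<open>Q / q0\<close> and
    \<open>A + A * Q / q0\<close> for values inside the interval, \<open>2 * A\<close> for the right
    end.\<close>
  define D where "D = A + Q / q0 + A * Q / q0 + 2 * A"
  have D: "D \<ge> 0" "2 * A \<le> D" "Q / q0 \<le> D" "A + A * Q / q0 \<le> D"
    using A Q(1) q0 by (auto simp: D_def intro!: add_nonneg_nonneg)
  show ?thesis
  proof (intro exI[of _ D] conjI allI impI)
    fix p :: "real poly" and g :: "real \<Rightarrow> real" and e :: real
    assume deg: "degree p \<le> Suc k" and cg: "continuous_on {0..1} g"
      and e: "\<forall>s\<in>{0..1}. \<bar>g s\<bar> \<le> e" and o: "poly_orth k 0 1 (\<lambda>s. poly p s - g s)"
    have e0: "e \<ge> 0" using e[rule_format, of 0] by simp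
    obtain r where r: "degree r \<le> k" "poly_orth k 0 1 (\<lambda>x. g x - poly r x)" "\<And>i. \<bar>coeff r i\<bar> \<le> C * e"
      using C(2)[OF cg, of e] e by blast
    have rb: "\<bar>poly r x\<bar> \<le> A * e" if "x \<in> {0..1}" for x
      using poly_bound_unit_interval[OF r(1) r(3) that] by (simp add: A_def)
    have "poly_orth k 0 1 (\<lambda>s. (poly p s - g s) + (g s - poly r s))"
      by (rule poly_orth_add[OF _ _ o r(2)]) (intro continuous_on_diff cg continuous_on_poly_real)+
    then have "poly_orth k 0 1 (poly (p - r))" by (rule poly_orth_cong) simp
    moreover have "degree (p - r) \<le> Suc k" using deg r(1) by (intro degree_diff_le) auto
    ultimately obtain c where c: "p - r = smult c q"
      using poly_orth_multiple[OF zero_less_one _ q(1,2) _ q(3)] by blast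
    have pc: "poly p x = poly r x + c * poly q x" for x
      using arg_cong[OF c, of "\<lambda>u. poly u x"] by simp
    have "\<bar>c\<bar> * q0 = \<bar>poly p 0 - poly r 0\<bar>" by (simp add: pc q0_def abs_mult)
    also have "\<dots> \<le> \<bar>poly p 0\<bar> + A * e" using rb[of 0] by auto
    finally have cb: "\<bar>c\<bar> \<le> (\<bar>poly p 0\<bar> + A * e) / q0" using q0 by (simp add: field_simps)
    show "\<forall>s\<in>{0..1}. \<bar>poly p s\<bar> \<le> D * (\<bar>poly p 0\<bar> + e)"
    proof
      fix s :: real assume s: "s \<in> {0..1}"
      have "\<bar>c * poly q s\<bar> \<le> (\<bar>poly p 0\<bar> + A * e) / q0 * Q"
        unfolding abs_mult using cb Q(2)[OF s] by (intro mult_mono) auto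
      then have "\<bar>poly p s\<bar> \<le> A * e + (\<bar>poly p 0\<bar> + A * e) / q0 * Q"
        using rb[OF s] unfolding pc[of s] by linarith
      also have "\<dots> = (Q / q0) * \<bar>poly p 0\<bar> + (A + A * Q / q0) * e"
        using q0 by (simp add: field_simps)
      also have "\<dots> \<le> D * \<bar>poly p 0\<bar> + D * e"
        using D e0 by (intro add_mono mult_right_mono) auto
      finally show "\<bar>poly p s\<bar> \<le> D * (\<bar>poly p 0\<bar> + e)" by (simp add: algebra_simps)
    qed
    \<comment> \<open>The multiple of \<open>q\<close> keeps its modulus from end to end; the values
      of \<open>r\<close> at the two ends cost \<open>2 * A * e\<close>.\<close>
    have "c * poly q 1 = (- 1) ^ Suc k * (poly p 0 - poly r 0)"
      using pc[of 0] by (simp add: q01(2))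
    then have "\<bar>c * poly q 1\<bar> = \<bar>poly p 0 - poly r 0\<bar>" by (simp add: abs_mult power_abs)
    then have "\<bar>poly p 1\<bar> \<le> \<bar>poly p 0\<bar> + 2 * A * e"
      using pc[of 1] rb[of 0] rb[of 1] by auto
    also have "\<dots> \<le> \<bar>poly p 0\<bar> + D * e"
      using D e0 by (intro add_left_mono mult_right_mono) auto
    finally show "\<bar>poly p 1\<bar> \<le> \<bar>poly p 0\<bar> + D * e" .
  qed (rule D)
qed

text \<open>A predicate of the constant alone, quantified over all intervals, so that one
  \<open>C\<close> serves every cell of every mesh.\<close>

definition orthogonal_step_bound :: "nat \<Rightarrow> real \<Rightarrow> bool" where
  "orthogonal_step_bound k C \<longleftrightarrow> (\<forall>a b p g e. a < b \<longrightarrow> degree p \<le> Suc k \<longrightarrow> continuous_on {a..b} g \<longrightarrow>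
     (\<forall>s\<in>{a..b}. \<bar>g s\<bar> \<le> e) \<longrightarrow> poly_orth k a b (\<lambda>s. poly p s - g s) \<longrightarrow>
     (\<forall>s\<in>{a..b}. \<bar>poly p s\<bar> \<le> C * (\<bar>poly p a\<bar> + e)) \<and> \<bar>poly p b\<bar> \<le> \<bar>poly p a\<bar> + C * e)"

lemma orthogonal_step_boundD:
  assumes "orthogonal_step_bound k C" "a < b" "degree p \<le> Suc k" "continuous_on {a..b} g"
    "\<And>s. s \<in> {a..b} \<Longrightarrow> \<bar>g s\<bar> \<le> e" "poly_orth k a b (\<lambda>s. poly p s - g s)"
  shows "\<And>s. s \<in> {a..b} \<Longrightarrow> \<bar>poly p s\<bar> \<le> C * (\<bar>poly p a\<bar> + e)" "\<bar>poly p b\<bar> \<le> \<bar>poly p a\<bar> + C * e"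
  using assms unfolding orthogonal_step_bound_def by simp_all

lemma orthogonal_step: "\<exists>C\<ge>0. orthogonal_step_bound k C"
proof -
  obtain C where C0: "C \<ge> 0" and C1: "\<forall>p g e. degree p \<le> Suc k \<longrightarrow> continuous_on {0..1} g \<longrightarrow>
     (\<forall>s\<in>{0..1}. \<bar>g s\<bar> \<le> e) \<longrightarrow> poly_orth k 0 1 (\<lambda>s. poly p s - g s) \<longrightarrow>
     (\<forall>s\<in>{0..1}. \<bar>poly p s\<bar> \<le> C * (\<bar>poly p 0\<bar> + e)) \<and> \<bar>poly p 1\<bar> \<le> \<bar>poly p 0\<bar> + C * e"
    using orthogonal_step_unit[of k] by (elim exE conjE) (rule that)
  show ?thesis unfolding orthogonal_step_bound_def
  proof (rule exI[of _ C], intro conjI allI impI)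
    fix a b :: real and p :: "real poly" and g :: "real \<Rightarrow> real" and e :: real
    assume ab: "a < b" and deg: "degree p \<le> Suc k" and cg: "continuous_on {a..b} g"
      and e: "\<forall>s\<in>{a..b}. \<bar>g s\<bar> \<le> e" and o: "poly_orth k a b (\<lambda>s. poly p s - g s)"
    let ?q = "pcompose p [:a, b - a:]"
    let ?g = "\<lambda>t. g (a + (b - a) * t)"
    have in_ab: "a + (b - a) * x \<in> {a..b}" if x: "x \<in> {0..1}" for x :: real
    proof -
      have "(b - a) * x \<le> (b - a) * 1" using x ab by (intro mult_left_mono) auto
      moreover have "0 \<le> (b - a) * x" using x ab by simp
      ultimately show ?thesis by simp
    qed
    have "degree ?q \<le> Suc k" using pcompose_affine(1)[of p a "b - a"] deg by linarith
    moreover have "continuous_on {0..1} ?g" by (rule continuous_on_affine[OF ab cg])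
    moreover have "\<forall>s\<in>{0..1}. \<bar>?g s\<bar> \<le> e" using e in_ab by blast
    moreover have "poly_orth k 0 1 (\<lambda>s. poly ?q s - ?g s)"
      using poly_orth_affine[OF ab, of "\<lambda>s. poly p s - g s" k] o
      by (simp add: pcompose_affine(2) continuous_on_diff continuous_on_poly_real cg)
    ultimately have "(\<forall>s\<in>{0..1}. \<bar>poly ?q s\<bar> \<le> C * (\<bar>poly ?q 0\<bar> + e)) \<and> \<bar>poly ?q 1\<bar> \<le> \<bar>poly ?q 0\<bar> + C * e"
      by (intro C1[THEN spec, THEN spec, THEN spec, THEN mp, THEN mp, THEN mp, THEN mp, of ?q ?g e])
    then have 1: "\<And>s. s \<in> {0..1} \<Longrightarrow> \<bar>poly ?q s\<bar> \<le> C * (\<bar>poly ?q 0\<bar> + e)"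
      and 2: "\<bar>poly ?q 1\<bar> \<le> \<bar>poly ?q 0\<bar> + C * e" by simp_all
    show "\<bar>poly p b\<bar> \<le> \<bar>poly p a\<bar> + C * e" using 2 by (simp add: pcompose_affine(2))
    show "\<forall>s\<in>{a..b}. \<bar>poly p s\<bar> \<le> C * (\<bar>poly p a\<bar> + e)"
    proof
      fix s assume s: "s \<in> {a..b}"
      show "\<bar>poly p s\<bar> \<le> C * (\<bar>poly p a\<bar> + e)"
        using 1[OF affine_unit_interval(1)[OF ab s]] affine_unit_interval(2)[OF ab s]
        by (simp add: pcompose_affine(2))
    qed
  qed (rule C0)
qed

text \<open>The projection of \<open>g\<close> leaves a multiple of \<open>q\<close> free. Since
  \<open>q\<close> does not vanish at the left end, this multiple can be fitted to any initial value
  \<open>y\<close>, which is how continuity across mesh points is arranged later.\<close>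

lemma orthogonal_extension:
  assumes ab: "a < b" and cg: "continuous_on {a..b} (g :: real \<Rightarrow> real)"
  shows "\<exists>p. degree p \<le> Suc k \<and> poly p a = y \<and> poly_orth k a b (\<lambda>s. poly p s - g s)"
proof -
  obtain C where C: "C \<ge> 0" "\<And>f M. continuous_on {0..1} f \<Longrightarrow> (\<And>x. x \<in> {0..1} \<Longrightarrow> \<bar>f x\<bar> \<le> M) \<Longrightarrow>
     \<exists>p::real poly. degree p \<le> k \<and> poly_orth k 0 1 (\<lambda>x. f x - poly p x) \<and> (\<forall>i. \<bar>coeff p i\<bar> \<le> C * M)"
    by (rule poly_projectableE[OF poly_projectable[of k]]) blast
  let ?g = "\<lambda>t. g (a + (b - a) * t)"
  have cg': "continuous_on {0..1} ?g" by (rule continuous_on_affine[OF ab cg])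
  obtain M where "\<And>x. x \<in> {0..1} \<Longrightarrow> \<bar>?g x\<bar> \<le> M"
    using continuous_bounded_interval[OF cg'] by metis
  from C(2)[OF cg' this] obtain r where r: "degree r \<le> k" "poly_orth k 0 1 (\<lambda>x. ?g x - poly r x)" by blast
  obtain q :: "real poly" where q: "degree q = Suc k" "lead_coeff q = 1" "poly_orth k 0 1 (poly q)"
    using monic_orthogonal_poly by blast
  note q01 = orthogonal_poly_endpoints[OF q]
  define c where "c = (y - poly r 0) / poly q 0"
  define u where "u = r + smult c q"
  have degu: "degree u \<le> Suc k" unfolding u_def using r(1) q(1) by (intro degree_add_le) auto
  have "poly_orth k 0 1 (\<lambda>x. c * poly q x - (?g x - poly r x))"
    by (rule poly_orth_diff[OF _ _ poly_orth_cmult[OF q(3)] r(2)])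
      (intro continuous_on_diff continuous_on_mult continuous_on_const cg' continuous_on_poly_real)+
  then have ou: "poly_orth k 0 1 (\<lambda>x. poly u x - ?g x)"
    by (rule poly_orth_cong) (simp add: u_def)
  define p where "p = pcompose u [:- a / (b - a), 1 / (b - a):]"
  have pu: "poly p (a + (b - a) * x) = poly u x" for x
  proof -
    have "- a / (b - a) + (a + (b - a) * x) / (b - a) = ((b - a) * x) / (b - a)"
      by (simp add: add_divide_distrib)
    also have "\<dots> = x" using ab by simp
    finally show ?thesis by (simp add: p_def poly_pcompose)
  qed
  show ?thesis
  proof (intro exI[of _ p] conjI)
    show "degree p \<le> Suc k" unfolding p_def using pcompose_affine(1) degu order_trans by blast
    show "poly p a = y" using pu[of 0] q01(1) by (simp add: u_def c_def)
    show "poly_orth k a b (\<lambda>s. poly p s - g s)"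
      by (subst poly_orth_affine[OF ab])
        (intro continuous_on_diff cg continuous_on_poly_real, use ou in \<open>simp add: pu\<close>)
  qed
qed

text \<open>Rescaling a monic polynomial to length \<open>b - a\<close> brings in the factor
  \<open>(b - a) ^ Suc k\<close>. The number \<open>q0\<close> is the same for all intervals, so
  that leading local errors of neighbouring cells can be compared.\<close>

lemma scaled_orthogonal_poly:
  "\<exists>Q\<ge>0. \<exists>q0. \<forall>a b. a < b \<longrightarrow>
     (\<exists>q::real poly. degree q = Suc k \<and> lead_coeff q = 1 \<and> poly_orth k a b (poly q) \<and>
        poly q a = (b - a) ^ Suc k * q0 \<and> poly q b = (- 1) ^ Suc k * ((b - a) ^ Suc k * q0) \<and>
        (\<forall>s\<in>{a..b}. \<bar>poly q s\<bar> \<le> (b - a) ^ Suc k * Q))"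
proof -
  obtain q :: "real poly" where q: "degree q = Suc k" "lead_coeff q = 1" "poly_orth k 0 1 (poly q)"
    using monic_orthogonal_poly by blast
  note q01 = orthogonal_poly_endpoints[OF q]
  obtain Q where Q: "Q \<ge> 0" "\<And>x. x \<in> {0..1} \<Longrightarrow> \<bar>poly q x\<bar> \<le> Q"
    using continuous_bounded_interval[OF continuous_on_poly_real] by metis
  have "\<exists>q'::real poly. degree q' = Suc k \<and> lead_coeff q' = 1 \<and> poly_orth k a b (poly q') \<and>
        poly q' a = (b - a) ^ Suc k * poly q 0 \<and> poly q' b = (- 1) ^ Suc k * ((b - a) ^ Suc k * poly q 0) \<and>
        (\<forall>s\<in>{a..b}. \<bar>poly q' s\<bar> \<le> (b - a) ^ Suc k * Q)" if ab: "a < b" for a b :: real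
  proof -
    let ?r = "smult ((b - a) ^ Suc k) (pcompose q [:- a / (b - a), 1 / (b - a):])"
    have pr: "poly ?r s = (b - a) ^ Suc k * poly q ((s - a) / (b - a))" for s
      by (simp add: poly_pcompose diff_divide_distrib)
    have dr: "degree ?r = Suc k" using ab q(1) by (simp add: degree_pcompose)
    have "lead_coeff (pcompose q [:- a / (b - a), 1 / (b - a):]) = (1 / (b - a)) ^ Suc k"
      using lead_coeff_comp[of "[:- a / (b - a), 1 / (b - a):]" q] ab q(1,2) by simp
    then have lc: "lead_coeff ?r = 1"
      unfolding lead_coeff_smult using ab by (simp only: power_mult_distrib[symmetric]) simp
    have "poly_orth k 0 1 (\<lambda>x. (b - a) ^ Suc k * poly q x)" by (rule poly_orth_cmult[OF q(3)])
    then have "poly_orth k 0 1 (\<lambda>x. poly ?r (a + (b - a) * x))"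
      by (rule poly_orth_cong) (subst pr, use ab in simp)
    then have o: "poly_orth k a b (poly ?r)"
      by (subst poly_orth_affine[OF ab continuous_on_poly_real])
    have "poly ?r a = (b - a) ^ Suc k * poly q 0" by (simp only: pr diff_self div_0)
    moreover have "poly ?r b = (- 1) ^ Suc k * ((b - a) ^ Suc k * poly q 0)"
    proof -
      have "(b - a) / (b - a) = 1" using ab by simp
      then show ?thesis unfolding pr by (simp only: q01(2) mult.left_commute)
    qed
    moreover have "\<bar>poly ?r s\<bar> \<le> (b - a) ^ Suc k * Q" if s: "s \<in> {a..b}" for s
      unfolding pr abs_mult using Q(2)[OF affine_unit_interval(1)[OF ab s]] ab
      by (intro mult_mono) auto
    ultimately show ?thesis using dr lc o by blast
  qed
  then show ?thesis using Q(1) by blast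
qed

section \<open>Functions of class \<open>C\<^sup>k\<close> and regularity of the solution\<close>

lemma Ck_on_imp_continuous_on: "Ck_on k S f \<Longrightarrow> continuous_on S f"
proof (cases k)
  case (Suc j)
  assume "Ck_on k S f"
  then have "Ck_on (Suc j) S f" using Suc by simp
  then obtain g where "\<forall>x\<in>S. (f has_derivative (\<lambda>v. g x \<bullet> v)) (at x within S)"
    unfolding Ck_on.simps by (elim exE conjE) (rule that)
  then show ?thesis by (intro has_derivative_continuous_on[of S f "\<lambda>x v. g x \<bullet> v"]) blast
qed simp

lemma Ck_on_Suc_imp: "Ck_on (Suc k) S f \<Longrightarrow> Ck_on k S f"
proof (induction k arbitrary: f)
  case 0
  then show ?case unfolding Ck_on.simps(1) by (rule Ck_on_imp_continuous_on)
next
  case (Suc k)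
  from Suc.prems obtain g where g: "\<And>x. x \<in> S \<Longrightarrow> (f has_derivative (\<lambda>v. g x \<bullet> v)) (at x within S)"
    "\<And>b. b \<in> Basis \<Longrightarrow> Ck_on (Suc k) S (\<lambda>x. g x \<bullet> b)"
    unfolding Ck_on.simps(2)[of "Suc k"] by (elim exE conjE) (rule that, blast+)
  have "Ck_on k S (\<lambda>x. g x \<bullet> b)" if "b \<in> Basis" for b by (rule Suc.IH[OF g(2)[OF that]])
  then show ?case unfolding Ck_on.simps(2)[of k] using g(1) by (intro exI[of _ g] conjI ballI)
qed

lemma Ck_on_mono: "Ck_on k S f \<Longrightarrow> j \<le> k \<Longrightarrow> Ck_on j S f"
proof (induction k)
  case (Suc k)
  show ?case
  proof (cases "j = Suc k")
    case False
    then show ?thesis using Suc Ck_on_Suc_imp[OF Suc.prems(1)] by (simp del: Ck_on.simps)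
  qed (use Suc.prems in simp)
qed simp

lemma Ck_on_cong:
  assumes "Ck_on k S f" "\<And>x. x \<in> S \<Longrightarrow> f x = g x"
  shows "Ck_on k S g"
proof (cases k)
  case 0
  then show ?thesis using assms continuous_on_cong[of S S f g] by simp
next
  case (Suc j)
  have "Ck_on (Suc j) S f" using assms(1) unfolding Suc .
  then obtain D where D: "\<And>x. x \<in> S \<Longrightarrow> (f has_derivative (\<lambda>v. D x \<bullet> v)) (at x within S)"
    "\<And>b. b \<in> Basis \<Longrightarrow> Ck_on j S (\<lambda>x. D x \<bullet> b)"
    unfolding Ck_on.simps by (elim exE conjE) (rule that, blast+)
  have "(g has_derivative (\<lambda>v. D x \<bullet> v)) (at x within S)" if "x \<in> S" for x
    by (rule has_derivative_transform[OF that _ D(1)[OF that]]) (use assms(2) in simp)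
  with D(2) show ?thesis unfolding Suc Ck_on.simps by (intro exI[of _ D] conjI ballI)
qed

lemma Ck_on_Suc_real:
  fixes f :: "real \<Rightarrow> real"
  shows "Ck_on (Suc k) S f \<longleftrightarrow> (\<exists>g. (\<forall>x\<in>S. (f has_real_derivative g x) (at x within S)) \<and> Ck_on k S g)"
proof -
  have "(\<lambda>v. g x \<bullet> v) = (*) (g x)" for g :: "real \<Rightarrow> real" and x by (auto simp: fun_eq_iff)
  then show ?thesis by (simp add: has_field_derivative_def)
qed

lemma Ck_on_Suc_realI:
  fixes f :: "real \<Rightarrow> real"
  assumes "\<And>x. x \<in> S \<Longrightarrow> (f has_real_derivative g x) (at x within S)" "Ck_on k S g"
  shows "Ck_on (Suc k) S f"
  unfolding Ck_on_Suc_real by (intro exI[of _ g] conjI ballI assms)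

lemma Ck_on_Suc_realE:
  fixes f :: "real \<Rightarrow> real"
  assumes "Ck_on (Suc k) S f"
  obtains g where "\<And>x. x \<in> S \<Longrightarrow> (f has_real_derivative g x) (at x within S)" "Ck_on k S g"
  using assms unfolding Ck_on_Suc_real by (elim exE conjE) (rule that, blast+)

section \<open>Algebra of differentiable functions on subsets of the line\<close>

lemma Ck_on_add:
  fixes f :: "real \<Rightarrow> real"
  assumes "Ck_on k S f" "Ck_on k S g" shows "Ck_on k S (\<lambda>x. f x + g x)"
  using assms
proof (induction k arbitrary: f g)
  case 0 then show ?case by (auto intro: continuous_on_add)
next
  case (Suc k)
  obtain f' where f': "\<And>x. x \<in> S \<Longrightarrow> (f has_real_derivative f' x) (at x within S)" "Ck_on k S f'"
    by (rule Ck_on_Suc_realE[OF Suc.prems(1)]) blast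
  obtain g' where g': "\<And>x. x \<in> S \<Longrightarrow> (g has_real_derivative g' x) (at x within S)" "Ck_on k S g'"
    by (rule Ck_on_Suc_realE[OF Suc.prems(2)]) blast
  show ?case
    by (rule Ck_on_Suc_realI[OF _ Suc.IH[OF f'(2) g'(2)]]) (intro DERIV_add f' g')
qed

lemma Ck_on_mult:
  fixes f :: "real \<Rightarrow> real"
  assumes "Ck_on k S f" "Ck_on k S g" shows "Ck_on k S (\<lambda>x. f x * g x)"
  using assms
proof (induction k arbitrary: f g)
  case 0 then show ?case by (auto intro: continuous_on_mult)
next
  case (Suc k)
  obtain f' where f': "\<And>x. x \<in> S \<Longrightarrow> (f has_real_derivative f' x) (at x within S)" "Ck_on k S f'"
    by (rule Ck_on_Suc_realE[OF Suc.prems(1)]) blast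
  obtain g' where g': "\<And>x. x \<in> S \<Longrightarrow> (g has_real_derivative g' x) (at x within S)" "Ck_on k S g'"
    by (rule Ck_on_Suc_realE[OF Suc.prems(2)]) blast
  show ?case
  proof (rule Ck_on_Suc_realI)
    show "Ck_on k S (\<lambda>x. f' x * g x + g' x * f x)"
      using f'(2) g'(2) Suc.prems[THEN Ck_on_Suc_imp] by (intro Ck_on_add Suc.IH)
  qed (intro DERIV_mult f' g')
qed

lemma Ck_on_const: "Ck_on k S (\<lambda>x::real. c)"
proof (induction k arbitrary: c)
  case (Suc k) show ?case by (rule Ck_on_Suc_realI[OF _ Suc[of 0]]) simp
qed simp

lemma Ck_on_diff:
  fixes f :: "real \<Rightarrow> real"
  assumes "Ck_on k S f" "Ck_on k S g" shows "Ck_on k S (\<lambda>x. f x - g x)"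
  using Ck_on_add[OF assms(1) Ck_on_mult[OF Ck_on_const[of k S "-1"] assms(2)]] by simp

lemma Ck_on_inverse:
  fixes f :: "real \<Rightarrow> real"
  assumes "Ck_on k S f" "\<And>x. x \<in> S \<Longrightarrow> f x \<noteq> 0" shows "Ck_on k S (\<lambda>x. inverse (f x))"
  using assms
proof (induction k arbitrary: f)
  case 0 then show ?case by (auto intro: continuous_on_inverse)
next
  case (Suc k)
  obtain f' where f': "\<And>x. x \<in> S \<Longrightarrow> (f has_real_derivative f' x) (at x within S)" "Ck_on k S f'"
    by (rule Ck_on_Suc_realE[OF Suc.prems(1)]) blast
  have i: "Ck_on k S (\<lambda>x. inverse (f x))"
    by (rule Suc.IH[OF Ck_on_Suc_imp[OF Suc.prems(1)] Suc.prems(2)])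
  show ?case
  proof (rule Ck_on_Suc_realI)
    show "Ck_on k S (\<lambda>x. (- 1) * (inverse (f x) * f' x * inverse (f x)))"
      by (intro Ck_on_mult Ck_on_const i f')
    fix x assume "x \<in> S"
    then show "((\<lambda>x. inverse (f x)) has_real_derivative (- 1) * (inverse (f x) * f' x * inverse (f x))) (at x within S)"
      using DERIV_inverse'[OF f'(1)[of x] Suc.prems(2)[of x]] by simp
  qed
qed

lemma real_derivative_unique_Icc:
  fixes f :: "real \<Rightarrow> real"
  assumes "a < b" "x \<in> {a..b}" "(f has_real_derivative u) (at x within {a..b})" "(f has_real_derivative v) (at x within {a..b})"
  shows "u = v"
  using vector_derivative_unique_within_closed_interval[of a b x f u v] assms
  by (simp add: has_real_derivative_iff_has_vector_derivative)

text \<open>\<open>Ck_on\<close> asserts only that some derivative is smooth. On a nondegenerate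
  interval derivatives are unique, one-sided ones included, so an explicitly computed derivative
  inherits the smoothness.\<close>

lemma Ck_on_Suc_derivative:
  fixes f :: "real \<Rightarrow> real"
  assumes "a < b" "Ck_on (Suc k) {a..b} f" "\<And>x. x \<in> {a..b} \<Longrightarrow> (f has_real_derivative g x) (at x within {a..b})"
  shows "Ck_on k {a..b} g"
proof -
  obtain f' where f': "\<And>x. x \<in> {a..b} \<Longrightarrow> (f has_real_derivative f' x) (at x within {a..b})" "Ck_on k {a..b} f'"
    by (rule Ck_on_Suc_realE[OF assms(2)]) blast
  show ?thesis
    by (rule Ck_on_cong[OF f'(2) real_derivative_unique_Icc[OF assms(1) _ f'(1) assms(3)]])
qed

section \<open>Kernels on the triangle and their partial derivatives\<close>

lemma mem_kernel_domain: "(t, s) \<in> kernel_domain T \<longleftrightarrow> 0 \<le> s \<and> s \<le> t \<and> t \<le> T"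
  by (simp add: kernel_domain_def)

definition kernel_gradient ::
  "real \<Rightarrow> (real \<Rightarrow> real \<Rightarrow> real) \<Rightarrow> (real \<Rightarrow> real \<Rightarrow> real) \<Rightarrow> (real \<Rightarrow> real \<Rightarrow> real) \<Rightarrow> bool" where
  "kernel_gradient T K Kt Ks \<longleftrightarrow> (\<forall>t s. 0 \<le> s \<and> s \<le> t \<and> t \<le> T \<longrightarrow>
     ((\<lambda>(t, s). K t s) has_derivative (\<lambda>(u, v). Kt t s * u + Ks t s * v)) (at (t, s) within kernel_domain T))"

lemma Ck_on_kernelE:
  assumes "Ck_on (Suc k) (kernel_domain T) (\<lambda>(t, s). K t s)"
  obtains Kt Ks where "kernel_gradient T K Kt Ks"
    "Ck_on k (kernel_domain T) (\<lambda>(t, s). Kt t s)" "Ck_on k (kernel_domain T) (\<lambda>(t, s). Ks t s)"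
proof -
  let ?D = "kernel_domain T"
  obtain g where g: "\<And>x. x \<in> ?D \<Longrightarrow> ((\<lambda>(t, s). K t s) has_derivative (\<lambda>v. g x \<bullet> v)) (at x within ?D)"
    "\<And>b. b \<in> Basis \<Longrightarrow> Ck_on k ?D (\<lambda>x. g x \<bullet> b)"
    using assms unfolding Ck_on.simps by (elim exE conjE) (rule that, blast+)
  show ?thesis
  proof (rule that[of "\<lambda>t s. fst (g (t, s))" "\<lambda>t s. snd (g (t, s))"])
    show "kernel_gradient T K (\<lambda>t s. fst (g (t, s))) (\<lambda>t s. snd (g (t, s)))"
      unfolding kernel_gradient_def
    proof (intro allI impI)
      fix t s assume "0 \<le> s \<and> s \<le> t \<and> t \<le> T"
      then have "((\<lambda>(t, s). K t s) has_derivative (\<lambda>v. g (t, s) \<bullet> v)) (at (t, s) within ?D)"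
        using g(1)[of "(t, s)"] by (simp add: mem_kernel_domain)
      moreover have "(\<lambda>v. g (t, s) \<bullet> v) = (\<lambda>(u, v). fst (g (t, s)) * u + snd (g (t, s)) * v)"
        by (auto simp: fun_eq_iff inner_prod_def)
      ultimately show "((\<lambda>(t, s). K t s) has_derivative (\<lambda>(u, v). fst (g (t, s)) * u + snd (g (t, s)) * v)) (at (t, s) within ?D)"
        by simp
    qed
    have "Ck_on k ?D (\<lambda>x. g x \<bullet> (1, 0))" by (rule g(2)) (simp add: Basis_prod_def)
    then show "Ck_on k ?D (\<lambda>(t, s). fst (g (t, s)))"
      by (rule Ck_on_cong) (auto simp: inner_prod_def)
    have "Ck_on k ?D (\<lambda>x. g x \<bullet> (0, 1))" by (rule g(2)) (simp add: Basis_prod_def)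
    then show "Ck_on k ?D (\<lambda>(t, s). snd (g (t, s)))"
      by (rule Ck_on_cong) (auto simp: inner_prod_def)
  qed
qed

lemma kernel_gradient_diagonal:
  assumes "kernel_gradient T K Kt Ks" "t \<in> {0..T}"
  shows "((\<lambda>t. K t t) has_real_derivative Kt t t + Ks t t) (at t within {0..T})"
proof -
  have "((\<lambda>(t, s). K t s) has_derivative (\<lambda>(u, v). Kt t t * u + Ks t t * v)) (at (t, t) within kernel_domain T)"
    using assms by (auto simp: kernel_gradient_def)
  then have d: "((\<lambda>(t, s). K t s) has_derivative (\<lambda>(u, v). Kt t t * u + Ks t t * v)) (at (t, t) within (\<lambda>r. (r, r)) ` {0..T})"
    by (rule has_derivative_subset) (auto simp: mem_kernel_domain)
  have "((\<lambda>r. (r, r)) has_derivative (\<lambda>u. (u, u))) (at t within {0..T})"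
    by (intro derivative_eq_intros) auto
  from diff_chain_within[OF this d]
  have "((\<lambda>t. K t t) has_derivative (\<lambda>u. Kt t t * u + Ks t t * u)) (at t within {0..T})" by (simp add: o_def)
  then show ?thesis unfolding has_field_derivative_def
    by (rule has_derivative_eq_rhs) (auto simp: fun_eq_iff algebra_simps)
qed

lemma kernel_gradient_fst:
  assumes "kernel_gradient T K Kt Ks" "0 \<le> s" "t \<in> {s..T}"
  shows "((\<lambda>t. K t s) has_real_derivative Kt t s) (at t within {s..T})"
proof -
  have "((\<lambda>(t, s). K t s) has_derivative (\<lambda>(u, v). Kt t s * u + Ks t s * v)) (at (t, s) within kernel_domain T)"
    using assms by (auto simp: kernel_gradient_def)
  then have d: "((\<lambda>(t, s). K t s) has_derivative (\<lambda>(u, v). Kt t s * u + Ks t s * v)) (at (t, s) within (\<lambda>r. (r, s)) ` {s..T})"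
    by (rule has_derivative_subset) (use assms in \<open>auto simp: mem_kernel_domain\<close>)
  have "((\<lambda>r. (r, s)) has_derivative (\<lambda>u. (u, 0))) (at t within {s..T})"
    by (intro derivative_eq_intros) auto
  from diff_chain_within[OF this d]
  have "((\<lambda>t. K t s) has_derivative (\<lambda>u. Kt t s * u)) (at t within {s..T})" by (simp add: o_def)
  then show ?thesis unfolding has_field_derivative_def
    by (rule has_derivative_eq_rhs) (auto simp: fun_eq_iff algebra_simps)
qed

lemma kernel_gradient_snd:
  assumes "kernel_gradient T K Kt Ks" "t \<le> T" "s \<in> {0..t}"
  shows "((\<lambda>s. K t s) has_real_derivative Ks t s) (at s within {0..t})"
proof -
  have "((\<lambda>(t, s). K t s) has_derivative (\<lambda>(u, v). Kt t s * u + Ks t s * v)) (at (t, s) within kernel_domain T)"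
    using assms by (auto simp: kernel_gradient_def)
  then have d: "((\<lambda>(t, s). K t s) has_derivative (\<lambda>(u, v). Kt t s * u + Ks t s * v)) (at (t, s) within (\<lambda>r. (t, r)) ` {0..t})"
    by (rule has_derivative_subset) (use assms in \<open>auto simp: mem_kernel_domain\<close>)
  have "((\<lambda>r. (t, r)) has_derivative (\<lambda>u. (0, u))) (at s within {0..t})"
    by (intro derivative_eq_intros) auto
  from diff_chain_within[OF this d]
  have "((\<lambda>s. K t s) has_derivative (\<lambda>u. Ks t s * u)) (at s within {0..t})" by (simp add: o_def)
  then show ?thesis unfolding has_field_derivative_def
    by (rule has_derivative_eq_rhs) (auto simp: fun_eq_iff algebra_simps)
qed

lemma Ck_on_kernel_diagonal:
  assumes "Ck_on k (kernel_domain T) (\<lambda>(t, s). K t s)"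
  shows "Ck_on k {0..T} (\<lambda>t. K t t)"
  using assms
proof (induction k arbitrary: K)
  case 0
  have "continuous_on {0..T} (\<lambda>t. (t, t))" by (intro continuous_on_Pair continuous_on_id)
  moreover have "(\<lambda>t. (t, t)) ` {0..T} \<subseteq> kernel_domain T" by (auto simp: mem_kernel_domain)
  ultimately show ?case
    using 0 continuous_on_compose2[of "kernel_domain T" "\<lambda>(t, s). K t s" "{0..T}" "\<lambda>t. (t, t)"] by simp
next
  case (Suc k)
  obtain Kt Ks where K: "kernel_gradient T K Kt Ks"
    "Ck_on k (kernel_domain T) (\<lambda>(t, s). Kt t s)" "Ck_on k (kernel_domain T) (\<lambda>(t, s). Ks t s)"
    by (rule Ck_on_kernelE[OF Suc.prems]) blast
  show ?case
    by (rule Ck_on_Suc_realI[OF kernel_gradient_diagonal[OF K(1)] Ck_on_add[OF Suc.IH[OF K(2)] Suc.IH[OF K(3)]]])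
qed

section \<open>Differentiation of Volterra integrals\<close>

lemma continuous_on_curry_compose:
  assumes "continuous_on D (\<lambda>(t, s). k t s)" "continuous_on S f" "continuous_on S g"
    "\<And>x. x \<in> S \<Longrightarrow> (f x, g x) \<in> D"
  shows "continuous_on S (\<lambda>x. k (f x) (g x))"
proof -
  have "(\<lambda>x. (f x, g x)) ` S \<subseteq> D" using assms(4) by blast
  from continuous_on_compose2[OF assms(1) continuous_on_Pair[OF assms(2,3)] this] show ?thesis by simp
qed

text \<open>Parameter and upper limit are treated as independent variables on the square, with one
  partial derivative each; the total derivative is then restricted to the diagonal.\<close>

lemma integral_variable_limit_derivative:
  fixes k g :: "real \<Rightarrow> real \<Rightarrow> real"
  assumes dk: "\<And>t s. t \<in> {0..T} \<Longrightarrow> s \<in> {0..T} \<Longrightarrow> ((\<lambda>t. k t s) has_real_derivative g t s) (at t within {0..T})"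
    and ck: "continuous_on ({0..T} \<times> {0..T}) (\<lambda>(t, s). k t s)"
    and cg: "continuous_on ({0..T} \<times> {0..T}) (\<lambda>(t, s). g t s)"
    and t: "t \<in> {0..T}"
  shows "((\<lambda>t. integral {0..t} (k t)) has_real_derivative k t t + integral {0..t} (g t)) (at t within {0..T})"
proof -
  let ?I = "{0..T}"
  have ckx: "continuous_on ?I (k x)" if "x \<in> ?I" for x
    by (rule continuous_on_curry_compose[OF ck continuous_on_const continuous_on_id]) (use that in auto)
  have "((\<lambda>x. integral (cbox 0 t) (k x)) has_field_derivative integral (cbox 0 t) (g t)) (at t within ?I)"
  proof (rule leibniz_rule_field_derivative[OF _ _ _ t])
    show "((\<lambda>x. k x s) has_real_derivative g x s) (at x within ?I)" if "x \<in> ?I" "s \<in> cbox 0 t" for x s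
      using dk that t by auto
    show "k x integrable_on cbox 0 t" if "x \<in> ?I" for x
      using ckx[OF that] t by (auto intro!: integrable_continuous_real elim: continuous_on_subset)
    show "continuous_on (?I \<times> cbox 0 t) (\<lambda>(x, t). g x t)"
      by (rule continuous_on_subset[OF cg]) (use t in auto)
  qed simp
  then have fx: "((\<lambda>x. integral {0..t} (k x)) has_derivative (*) (integral {0..t} (g t))) (at t within ?I)"
    by (simp add: has_field_derivative_def)
  have fy: "((\<lambda>y. integral {0..y} (k x)) has_derivative blinfun_apply (blinfun_mult_right (k x y))) (at y within ?I)"
    if "x \<in> ?I" "y \<in> ?I" for x y
    using integral_has_real_derivative[OF ckx[OF that(1)] that(2)] by (simp add: has_field_derivative_def)
  have "continuous_on (?I \<times> ?I) (\<lambda>z. blinfun_mult_right (case z of (x, y) \<Rightarrow> k x y))"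
    by (rule bounded_linear.continuous_on[OF bounded_linear_blinfun_mult_right ck])
  then have cont: "continuous (at (t, t) within ?I \<times> ?I) (\<lambda>(x, y). blinfun_mult_right (k x y))"
    using t unfolding continuous_on_eq_continuous_within case_prod_unfold by fastforce
  have "((\<lambda>(x, y). integral {0..y} (k x)) has_derivative
      (\<lambda>(tx, ty). (*) (integral {0..t} (g t)) tx + blinfun_apply (blinfun_mult_right (k t t)) ty)) (at (t, t) within ?I \<times> ?I)"
    by (rule has_derivative_partialsI[OF fx fy cont t]) auto
  then have d: "((\<lambda>(x, y). integral {0..y} (k x)) has_derivative
      (\<lambda>(tx, ty). integral {0..t} (g t) * tx + k t t * ty)) (at (t, t) within (\<lambda>r. (r, r)) ` ?I)"
    by (auto intro: has_derivative_subset)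
  have "((\<lambda>r. (r, r)) has_derivative (\<lambda>u. (u, u))) (at t within ?I)"
    by (intro derivative_eq_intros) auto
  from diff_chain_within[OF this d]
  have "((\<lambda>t. integral {0..t} (k t)) has_derivative (\<lambda>u. integral {0..t} (g t) * u + k t t * u)) (at t within ?I)"
    by (simp add: o_def)
  then show ?thesis unfolding has_field_derivative_def
    by (rule has_derivative_eq_rhs) (auto simp: fun_eq_iff algebra_simps)
qed

text \<open>Glues one-sided derivatives of a function given by cases. The hypotheses can be
  conditional because \<open>at x within S\<close> is trivial when \<open>x\<close> lies outside the
  closed set \<open>S\<close>.\<close>

lemma has_real_derivative_within_union:
  fixes f :: "real \<Rightarrow> real"
  assumes "closed A" "closed B" "x \<in> A \<Longrightarrow> (f has_real_derivative d) (at x within A)"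
    "x \<in> B \<Longrightarrow> (f has_real_derivative d) (at x within B)"
  shows "(f has_real_derivative d) (at x within A \<union> B)"
proof -
  have L: "(f has_real_derivative d) (at x within S)"
    if "closed S" "x \<in> S \<Longrightarrow> (f has_real_derivative d) (at x within S)" for S
  proof (cases "x \<in> S")
    case False
    then have "\<not> x islimpt S" using that(1) closed_limpt by blast
    then have "at x within S = bot" using trivial_limit_within by blast
    then show ?thesis by simp
  qed (use that in simp)
  show ?thesis
    using L[OF assms(1,3)] L[OF assms(2,4)] unfolding has_field_derivative_iff Lim_within_Un by simp
qed

text \<open>The map \<open>(t, s) -> (max t s, s)\<close> retracts the square onto the triangle;
  where \<open>t < s\<close> the kernel is frozen at its diagonal value.\<close>

lemma continuous_on_kernel_extension:
  assumes "continuous_on (kernel_domain T) (\<lambda>(t, s). K t s)"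
  shows "continuous_on ({0..T} \<times> {0..T}) (\<lambda>z. K (max (fst z) (snd z)) (snd z))"
  by (rule continuous_on_curry_compose[OF assms])
    (auto intro!: continuous_on_max continuous_on_fst continuous_on_snd continuous_on_id simp: mem_kernel_domain)

text \<open>The kernel lives on the triangle, while the rule for a variable limit is stated on the
  square. The extension must stay differentiable in \<open>t\<close> across the diagonal, so
  \<open>K\<close> itself cannot simply be frozen there.\<close>

lemma volterra_derivative:
  assumes K: "kernel_gradient T K Kt Ks" "continuous_on (kernel_domain T) (\<lambda>(t, s). K t s)"
      "continuous_on (kernel_domain T) (\<lambda>(t, s). Kt t s)"
    and cx: "continuous_on {0..T} x" and t: "t \<in> {0..T}"
  shows "((\<lambda>t. integral {0..t} (\<lambda>s. K t s * x s)) has_real_derivative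
    K t t * x t + integral {0..t} (\<lambda>s. Kt t s * x s)) (at t within {0..T})"
proof -
  let ?I = "{0..T}"
  define k where "k = (\<lambda>t s. (K (max t s) s + min (t - s) 0 * Kt (max t s) s) * x s)"
  define g where "g = (\<lambda>t s. Kt (max t s) s * x s)"
  have cx': "continuous_on (?I \<times> ?I) (\<lambda>z. x (snd z))"
    by (rule continuous_on_compose2[OF cx]) (auto intro: continuous_on_snd continuous_on_id)
  note e = continuous_on_kernel_extension[OF K(2)] continuous_on_kernel_extension[OF K(3)]
  have cg: "continuous_on (?I \<times> ?I) (\<lambda>(t, s). g t s)"
    using continuous_on_mult[OF e(2) cx'] by (simp add: g_def case_prod_unfold)
  have "continuous_on (?I \<times> ?I) (\<lambda>z. min (fst z - snd z) (0::real))"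
    by (intro continuous_on_min continuous_on_diff continuous_on_fst continuous_on_snd continuous_on_id continuous_on_const)
  from continuous_on_mult[OF continuous_on_add[OF e(1) continuous_on_mult[OF this e(2)]] cx']
  have ck: "continuous_on (?I \<times> ?I) (\<lambda>(t, s). k t s)"
    by (simp add: k_def case_prod_unfold)
  have dk: "((\<lambda>t. k t s) has_real_derivative g t s) (at t within ?I)" if "t \<in> ?I" "s \<in> ?I" for t s
  proof -
    let ?p = "\<lambda>t. K (max t s) s + min (t - s) 0 * Kt (max t s) s"
    have "(?p has_real_derivative Kt (max t s) s) (at t within {0..s} \<union> {s..T})"
    proof (rule has_real_derivative_within_union)
      assume ts: "t \<in> {0..s}"
      have "((\<lambda>t. K s s + (t - s) * Kt s s) has_real_derivative Kt (max t s) s) (at t within {0..s})"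
        using ts by (auto intro!: derivative_eq_intros)
      then show "(?p has_real_derivative Kt (max t s) s) (at t within {0..s})"
        unfolding has_field_derivative_def
        by (rule has_derivative_transform[rotated 2]) (use ts in auto)
    next
      assume ts: "t \<in> {s..T}"
      have "max t s = t" using ts by simp
      then have "((\<lambda>t. K t s) has_real_derivative Kt (max t s) s) (at t within {s..T})"
        using kernel_gradient_fst[OF K(1) _ ts] that by simp
      then show "(?p has_real_derivative Kt (max t s) s) (at t within {s..T})"
        unfolding has_field_derivative_def
        by (rule has_derivative_transform[rotated 2]) (use ts in auto)
    qed auto
    moreover have "{0..s} \<union> {s..T} = ?I" using that by auto
    ultimately have "(?p has_real_derivative Kt (max t s) s) (at t within ?I)" by simp
    from DERIV_cmult_right[OF this, of "x s"] show ?thesis by (simp add: k_def g_def)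
  qed
  have i: "integral {0..t} (k t) = integral {0..t} (\<lambda>s. K t s * x s)" for t
    by (intro integral_cong) (auto simp: k_def max_def)
  have "integral {0..t} (g t) = integral {0..t} (\<lambda>s. Kt t s * x s)"
    by (intro integral_cong) (auto simp: g_def max_def)
  then show ?thesis
    using integral_variable_limit_derivative[OF dk ck cg t] unfolding i by (simp add: k_def)
qed

text \<open>The substitution \<open>s = t * u\<close> makes the limits constant, so that continuity
  in a parameter applies to a merely continuous kernel.\<close>

lemma volterra_continuous:
  fixes K :: "real \<Rightarrow> real \<Rightarrow> real" and x :: "real \<Rightarrow> real"
  assumes K: "continuous_on (kernel_domain T) (\<lambda>(t, s). K t s)"
    and cx: "continuous_on {0..T} x"
  shows "continuous_on {0..T} (\<lambda>t. integral {0..t} (\<lambda>s. K t s * x s))"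
proof -
  let ?I = "{0..T}"
  define k where "k = (\<lambda>t s. K (max t s) s * x s)"
  have cx': "continuous_on (?I \<times> ?I) (\<lambda>z. x (snd z))"
    by (rule continuous_on_compose2[OF cx]) (auto intro: continuous_on_snd continuous_on_id)
  have ck: "continuous_on (?I \<times> ?I) (\<lambda>(t, s). k t s)"
    using continuous_on_mult[OF continuous_on_kernel_extension[OF K] cx'] by (simp add: k_def case_prod_unfold)
  have "continuous_on (?I \<times> cbox 0 1) (\<lambda>z. k (fst z) (fst z * snd z))"
  proof (rule continuous_on_curry_compose[OF ck])
    fix z :: "real \<times> real" assume z: "z \<in> ?I \<times> cbox 0 1"
    then have "fst z * snd z \<le> fst z * 1" by (intro mult_left_mono) auto
    then show "(fst z, fst z * snd z) \<in> ?I \<times> ?I" using z by auto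
  qed (intro continuous_on_mult continuous_on_fst continuous_on_snd continuous_on_id)+
  then have "continuous_on (?I \<times> cbox 0 1) (\<lambda>(t, u). k t (t * u))" by (simp add: case_prod_unfold)
  from integral_continuous_on_param[OF this]
  have c: "continuous_on ?I (\<lambda>t. t * integral {0..1} (\<lambda>u. k t (t * u)))"
    by (intro continuous_on_mult continuous_on_id) simp
  show ?thesis
  proof (rule continuous_on_cong[THEN iffD1, OF refl _ c])
    fix t assume t: "t \<in> ?I"
    have i: "integral {0..t} (k t) = integral {0..t} (\<lambda>s. K t s * x s)"
      by (intro integral_cong) (auto simp: k_def max_def)
    show "t * integral {0..1} (\<lambda>u. k t (t * u)) = integral {0..t} (\<lambda>s. K t s * x s)"
    proof (cases "t = 0")
      case False
      then have "0 < t" using t by auto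
      have "continuous_on ?I (k t)"
        by (rule continuous_on_curry_compose[OF ck continuous_on_const continuous_on_id]) (use t in auto)
      then have "continuous_on {0..t} (k t)" by (rule continuous_on_subset) (use t in auto)
      from integral_affine[OF \<open>0 < t\<close> this] show ?thesis unfolding i by simp
    qed simp
  qed
qed

text \<open>The integral is one order smoother than \<open>x\<close>, since differentiating it
  produces the boundary term \<open>K t t * x t\<close>. By truncated subtraction,
  \<open>k = 0\<close> asks for continuity of \<open>x\<close>.\<close>

lemma Ck_on_volterra:
  assumes "Ck_on k (kernel_domain T) (\<lambda>(t, s). K t s)" "Ck_on (k - 1) {0..T} x"
  shows "Ck_on k {0..T} (\<lambda>t. integral {0..t} (\<lambda>s. K t s * x s))"
  using assms
proof (induction k arbitrary: K)
  case 0
  then show ?case by (simp add: volterra_continuous)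
next
  case (Suc k)
  obtain Kt Ks where K: "kernel_gradient T K Kt Ks"
    "Ck_on k (kernel_domain T) (\<lambda>(t, s). Kt t s)" "Ck_on k (kernel_domain T) (\<lambda>(t, s). Ks t s)"
    by (rule Ck_on_kernelE[OF Suc.prems(1)]) blast
  have x: "Ck_on k {0..T} x" using Suc.prems(2) by simp
  show ?case
  proof (rule Ck_on_Suc_realI)
    show "Ck_on k {0..T} (\<lambda>t. K t t * x t + integral {0..t} (\<lambda>s. Kt t s * x s))"
      by (intro Ck_on_add Ck_on_mult x Ck_on_kernel_diagonal[OF Ck_on_Suc_imp[OF Suc.prems(1)]]
          Suc.IH[OF K(2)] Ck_on_mono[OF x]) simp
  qed (rule volterra_derivative[OF K(1) Ck_on_imp_continuous_on[OF Suc.prems(1)]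
        Ck_on_imp_continuous_on[OF K(2)] Ck_on_imp_continuous_on[OF x]])
qed

text \<open>A bootstrap: the integral is smoother than \<open>x\<close>, so solving the equation for
  \<open>x\<close> raises its order by one, until the order of the data is reached.\<close>

lemma Ck_on_volterra_second_kind:
  assumes cx: "continuous_on {0..T} x"
    and a: "Ck_on n {0..T} a" "\<And>t. t \<in> {0..T} \<Longrightarrow> a t \<noteq> 0"
    and K: "Ck_on n (kernel_domain T) (\<lambda>(t, s). K t s)"
    and F: "Ck_on n {0..T} F"
    and eq: "\<And>t. t \<in> {0..T} \<Longrightarrow> a t * x t + integral {0..t} (\<lambda>s. K t s * x s) = F t"
  shows "Ck_on n {0..T} x"
proof -
  have "Ck_on j {0..T} x" if "j \<le> n" for j
    using that
  proof (induction j)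
    case 0 then show ?case using cx by simp
  next
    case (Suc j)
    have "Ck_on (Suc j) {0..T} (\<lambda>t. inverse (a t) * (F t - integral {0..t} (\<lambda>s. K t s * x s)))"
      by (intro Ck_on_mult Ck_on_diff Ck_on_inverse Ck_on_volterra Ck_on_mono[OF a(1)] Ck_on_mono[OF F]
          Ck_on_mono[OF K] a(2) Suc.prems) (use Suc in simp_all)
    then show ?case
    proof (rule Ck_on_cong)
      fix t assume "t \<in> {0..T}"
      then show "inverse (a t) * (F t - integral {0..t} (\<lambda>s. K t s * x s)) = x t"
        using eq[of t] a(2)[of t] by (simp add: field_simps)
    qed
  qed
  then show ?thesis by simp
qed

text \<open>Differentiated once, the second equation is of the second kind for \<open>x1\<close>, as
  \<open>K21\<close> does not vanish on the diagonal. The first equation, differentiated once, is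
  then of the second kind for \<open>x2\<close>, but has the derivative of \<open>x1\<close> among
  its data; hence the lower order of \<open>x2\<close>.\<close>

lemma iae_solution_Ck:
  assumes T: "T > 0"
    and nz: "\<And>t. t \<in> {0..T} \<Longrightarrow> K21 t t \<noteq> 0" "\<And>t. t \<in> {0..T} \<Longrightarrow> K12 t t \<noteq> 0"
    and f1: "Ck_on (d + 1) {0..T} f1" and f2: "Ck_on (d + 2) {0..T} f2"
    and K11: "Ck_on (d + 1) (kernel_domain T) (\<lambda>(t, s). K11 t s)"
    and K12: "Ck_on (d + 2) (kernel_domain T) (\<lambda>(t, s). K12 t s)"
    and K21: "Ck_on (d + 2) (kernel_domain T) (\<lambda>(t, s). K21 t s)"
    and sol: "iae_solution T K11 K12 K21 f1 f2 x1 x2"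
  shows "Ck_on (d + 1) {0..T} x1" "Ck_on d {0..T} x2"
proof -
  have cx: "continuous_on {0..T} x1" "continuous_on {0..T} x2"
    and eq1: "\<And>t. t \<in> {0..T} \<Longrightarrow> x1 t + integral {0..t} (\<lambda>s. K11 t s * x1 s + K12 t s * x2 s) = f1 t"
    and eq2: "\<And>t. t \<in> {0..T} \<Longrightarrow> integral {0..t} (\<lambda>s. K21 t s * x1 s) = f2 t"
    using sol by (auto simp: iae_solution_def)
  obtain K21t K21s where K21g: "kernel_gradient T K21 K21t K21s"
    "Ck_on (d + 1) (kernel_domain T) (\<lambda>(t, s). K21t t s)"
    using K21 by (simp only: add_2_eq_Suc' Suc_eq_plus1[symmetric]) (rule Ck_on_kernelE, assumption, blast)
  obtain K12t K12s where K12g: "kernel_gradient T K12 K12t K12s"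
    "Ck_on (d + 1) (kernel_domain T) (\<lambda>(t, s). K12t t s)"
    using K12 by (simp only: add_2_eq_Suc' Suc_eq_plus1[symmetric]) (rule Ck_on_kernelE, assumption, blast)
  obtain K11t K11s where K11g: "kernel_gradient T K11 K11t K11s"
    "Ck_on d (kernel_domain T) (\<lambda>(t, s). K11t t s)"
    using K11 by (simp only: Suc_eq_plus1[symmetric]) (rule Ck_on_kernelE, assumption, blast)
  note cK = K11[THEN Ck_on_imp_continuous_on] K12[THEN Ck_on_imp_continuous_on] K21[THEN Ck_on_imp_continuous_on]
    K11g(2)[THEN Ck_on_imp_continuous_on] K12g(2)[THEN Ck_on_imp_continuous_on] K21g(2)[THEN Ck_on_imp_continuous_on]
  have d2: "(f2 has_real_derivative K21 t t * x1 t + integral {0..t} (\<lambda>s. K21t t s * x1 s)) (at t within {0..T})"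
    if t: "t \<in> {0..T}" for t
    using volterra_derivative[OF K21g(1) cK(3,6) cx(1) t] unfolding has_field_derivative_def
    by (rule has_derivative_transform[OF t, rotated]) (simp add: eq2)
  have f2': "Ck_on (Suc (d + 1)) {0..T} f2" using f2 by (simp only: add_2_eq_Suc' Suc_eq_plus1)
  have F2: "Ck_on (d + 1) {0..T} (\<lambda>t. K21 t t * x1 t + integral {0..t} (\<lambda>s. K21t t s * x1 s))"
    by (rule Ck_on_Suc_derivative[OF T f2' d2])
  show X1: "Ck_on (d + 1) {0..T} x1"
    by (rule Ck_on_volterra_second_kind[OF cx(1) Ck_on_mono[OF Ck_on_kernel_diagonal[OF K21]] nz(1) K21g(2) F2]) auto
  obtain x1' where x1': "\<And>t. t \<in> {0..T} \<Longrightarrow> (x1 has_real_derivative x1' t) (at t within {0..T})" "Ck_on d {0..T} x1'"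
    using X1 unfolding Suc_eq_plus1[symmetric] by (rule Ck_on_Suc_realE) blast
  \<comment> \<open>The derivative of the left side of the first equation, hence of
    \<open>f1\<close>; uniqueness of derivatives then gives its smoothness without knowing that of
    \<open>x2\<close>.\<close>
  define G where "G = (\<lambda>t. x1' t + ((K11 t t * x1 t + integral {0..t} (\<lambda>s. K11t t s * x1 s))
     + (K12 t t * x2 t + integral {0..t} (\<lambda>s. K12t t s * x2 s))))"
  have int: "(\<lambda>s. K t s * x s) integrable_on {0..t}"
    if "continuous_on (kernel_domain T) (\<lambda>(t, s). K t s)" "continuous_on {0..T} x" "t \<in> {0..T}" for K :: "real \<Rightarrow> real \<Rightarrow> real" and x :: "real \<Rightarrow> real" and t
  proof -
    have "continuous_on {0..t} (K t)"
      by (rule continuous_on_curry_compose[OF that(1) continuous_on_const continuous_on_id])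
        (use that(3) in \<open>auto simp: mem_kernel_domain\<close>)
    moreover have "continuous_on {0..t} x" by (rule continuous_on_subset[OF that(2)]) (use that(3) in auto)
    ultimately show ?thesis by (intro integrable_continuous_real continuous_on_mult)
  qed
  have d1: "(f1 has_real_derivative G t) (at t within {0..T})" if t: "t \<in> {0..T}" for t
  proof -
    have "((\<lambda>t. x1 t + (integral {0..t} (\<lambda>s. K11 t s * x1 s) + integral {0..t} (\<lambda>s. K12 t s * x2 s)))
        has_real_derivative G t) (at t within {0..T})"
      unfolding G_def
      by (intro DERIV_add x1'(1) t volterra_derivative[OF K11g(1) cK(1,4) cx(1)] volterra_derivative[OF K12g(1) cK(2,5) cx(2)])
    then show ?thesis unfolding has_field_derivative_def
    proof (rule has_derivative_transform[OF t, rotated])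
      fix t assume t: "t \<in> {0..T}"
      show "f1 t = x1 t + (integral {0..t} (\<lambda>s. K11 t s * x1 s) + integral {0..t} (\<lambda>s. K12 t s * x2 s))"
        using eq1[OF t] integral_add[OF int[OF cK(1) cx(1) t] int[OF cK(2) cx(2) t]] by simp
    qed
  qed
  have f1': "Ck_on (Suc d) {0..T} f1" using f1 by simp
  have GC: "Ck_on d {0..T} G" by (rule Ck_on_Suc_derivative[OF T f1' d1])
  have F: "Ck_on d {0..T} (\<lambda>t. G t - (x1' t + (K11 t t * x1 t + integral {0..t} (\<lambda>s. K11t t s * x1 s))))"
    by (intro Ck_on_diff Ck_on_add Ck_on_mult GC x1'(2) Ck_on_volterra K11g(2)
        Ck_on_mono[OF X1] Ck_on_mono[OF Ck_on_kernel_diagonal[OF K11]]) auto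
  show "Ck_on d {0..T} x2"
    by (rule Ck_on_volterra_second_kind[OF cx(2) Ck_on_mono[OF Ck_on_kernel_diagonal[OF K12]] nz(2) Ck_on_mono[OF K12g(2)] F])
      (auto simp: G_def)
qed

section \<open>Volterra operators after integration by parts\<close>

lemma kernel_domain_subset_cbox: "kernel_domain T \<subseteq> cbox (0, 0) (T, T)"
  by (auto simp: kernel_domain_def cbox_Pair_eq)

lemma closed_kernel_domain: "closed (kernel_domain T)"
proof -
  have "kernel_domain T = {x. 0 \<le> snd x} \<inter> {x. snd x \<le> fst x} \<inter> {x. fst x \<le> T}"
    by (auto simp: kernel_domain_def)
  also have "closed \<dots>"
    by (intro closed_Int closed_Collect_le continuous_on_const continuous_on_fst continuous_on_snd continuous_on_id)
  finally show ?thesis .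
qed

lemma compact_kernel_domain: "compact (kernel_domain T)"
  using closed_kernel_domain bounded_subset[OF bounded_cbox kernel_domain_subset_cbox]
  by (simp add: compact_eq_bounded_closed)

lemma convex_kernel_domain: "convex (kernel_domain T)"
proof (rule convexI)
  fix x y :: "real \<times> real" and u v :: real
  assume xy: "x \<in> kernel_domain T" "y \<in> kernel_domain T" and uv: "0 \<le> u" "0 \<le> v" "u + v = 1"
  obtain a b c d where [simp]: "x = (a, b)" "y = (c, d)" by (meson surj_pair)
  have le: "0 \<le> b" "b \<le> a" "a \<le> T" "0 \<le> d" "d \<le> c" "c \<le> T" using xy by (simp_all add: mem_kernel_domain)
  have "0 \<le> u * b" "0 \<le> v * d" "u * b \<le> u * a" "v * d \<le> v * c" "u * a \<le> u * T" "v * c \<le> v * T"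
    using le uv by (auto intro: mult_left_mono)
  moreover have "u * T + v * T = T" using uv(3) by (simp add: distrib_right[symmetric])
  ultimately show "u *\<^sub>R x + v *\<^sub>R y \<in> kernel_domain T" by (simp add: mem_kernel_domain)
qed

lemma continuous_on_kernel_bounded:
  fixes f :: "real \<Rightarrow> real \<Rightarrow> real"
  assumes "continuous_on (kernel_domain T) (\<lambda>(t, s). f t s)"
  obtains M where "M \<ge> 0" "\<And>t s. (t, s) \<in> kernel_domain T \<Longrightarrow> \<bar>f t s\<bar> \<le> M"
proof -
  have "bounded ((\<lambda>(t, s). f t s) ` kernel_domain T)"
    by (intro compact_imp_bounded compact_continuous_image assms compact_kernel_domain)
  then obtain M where M: "\<forall>y\<in>(\<lambda>(t, s). f t s) ` kernel_domain T. norm y \<le> M" unfolding bounded_iff by (elim exE)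
  have "\<bar>f t s\<bar> \<le> max M 0" if "(t, s) \<in> kernel_domain T" for t s
    using M[rule_format, OF imageI[OF that]] by simp
  then show ?thesis using that[of "max M 0"] by simp
qed

lemma Ck_on_kernel_lipschitz:
  fixes f :: "real \<Rightarrow> real \<Rightarrow> real"
  assumes "Ck_on (Suc 0) (kernel_domain T) (\<lambda>(t, s). f t s)"
  obtains B where "B \<ge> 0" "\<And>t s t' s'. (t, s) \<in> kernel_domain T \<Longrightarrow> (t', s') \<in> kernel_domain T \<Longrightarrow>
    \<bar>f t s - f t' s'\<bar> \<le> B * (\<bar>t - t'\<bar> + \<bar>s - s'\<bar>)"
proof -
  obtain ft fs where f: "kernel_gradient T f ft fs"
    "Ck_on 0 (kernel_domain T) (\<lambda>(t, s). ft t s)" "Ck_on 0 (kernel_domain T) (\<lambda>(t, s). fs t s)"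
    by (rule Ck_on_kernelE[OF assms]) blast
  obtain M1 where M1: "M1 \<ge> 0" "\<And>t s. (t, s) \<in> kernel_domain T \<Longrightarrow> \<bar>ft t s\<bar> \<le> M1"
    by (rule continuous_on_kernel_bounded[OF Ck_on_imp_continuous_on[OF f(2)]]) blast
  obtain M2 where M2: "M2 \<ge> 0" "\<And>t s. (t, s) \<in> kernel_domain T \<Longrightarrow> \<bar>fs t s\<bar> \<le> M2"
    by (rule continuous_on_kernel_bounded[OF Ck_on_imp_continuous_on[OF f(3)]]) blast
  have lip: "\<bar>f t s - f t' s'\<bar> \<le> (M1 + M2) * (\<bar>t - t'\<bar> + \<bar>s - s'\<bar>)"
    if D: "(t, s) \<in> kernel_domain T" "(t', s') \<in> kernel_domain T" for t s t' s'
  proof -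
    have "norm ((\<lambda>(t, s). f t s) (t, s) - (\<lambda>(t, s). f t s) (t', s')) \<le> (M1 + M2) * norm ((t, s) - (t', s'))"
    proof (rule differentiable_bound[OF convex_kernel_domain _ _ D])
      fix x assume x: "x \<in> kernel_domain T"
      obtain a b where [simp]: "x = (a, b)" by (meson surj_pair)
      show "((\<lambda>(t, s). f t s) has_derivative (\<lambda>(u, v). ft (fst x) (snd x) * u + fs (fst x) (snd x) * v)) (at x within kernel_domain T)"
        using f(1) x by (simp add: kernel_gradient_def mem_kernel_domain)
      show "onorm (\<lambda>(u, v). ft (fst x) (snd x) * u + fs (fst x) (snd x) * v) \<le> M1 + M2"
      proof (rule onorm_le)
        fix w :: "real \<times> real"
        obtain u v where w: "w = (u, v)" by (meson surj_pair)
        have "\<bar>ft a b * u\<bar> \<le> M1 * norm w" "\<bar>fs a b * v\<bar> \<le> M2 * norm w"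
          unfolding abs_mult w using M1 M2 x norm_fst_le[of u v] norm_snd_le[of v u] by (auto intro!: mult_mono)
        then show "norm ((\<lambda>(u, v). ft (fst x) (snd x) * u + fs (fst x) (snd x) * v) w) \<le> (M1 + M2) * norm w"
          by (simp add: w distrib_right)
      qed
    qed
    also have "\<dots> \<le> (M1 + M2) * (\<bar>t - t'\<bar> + \<bar>s - s'\<bar>)"
      using M1(1) M2(1) norm_Pair_le[of "t - t'" "s - s'"] by (intro mult_left_mono) auto
    finally show ?thesis by simp
  qed
  show ?thesis by (rule that[OF _ lip]) (use M1 M2 in auto)
qed

text \<open>What the estimates use of a kernel, with one constant for all bounds. Integration by
  parts puts the derivative on \<open>s\<close>; variation in \<open>t\<close> enters through
  Lipschitz bounds only.\<close>

definition regular_kernel :: "real \<Rightarrow> real \<Rightarrow> (real \<Rightarrow> real \<Rightarrow> real) \<Rightarrow> (real \<Rightarrow> real \<Rightarrow> real) \<Rightarrow> bool" where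
  "regular_kernel T B K Ks \<longleftrightarrow> B \<ge> 0 \<and>
     continuous_on (kernel_domain T) (\<lambda>(t, s). K t s) \<and> continuous_on (kernel_domain T) (\<lambda>(t, s). Ks t s) \<and>
     (\<forall>t s. t \<le> T \<longrightarrow> s \<in> {0..t} \<longrightarrow> ((\<lambda>s. K t s) has_real_derivative Ks t s) (at s within {0..t})) \<and>
     (\<forall>t s. (t, s) \<in> kernel_domain T \<longrightarrow> \<bar>K t s\<bar> \<le> B \<and> \<bar>Ks t s\<bar> \<le> B) \<and>
     (\<forall>t r. t \<in> {0..T} \<longrightarrow> r \<in> {0..T} \<longrightarrow> \<bar>K t t - K r r\<bar> \<le> B * \<bar>t - r\<bar>) \<and>
     (\<forall>t s t' s'. (t, s) \<in> kernel_domain T \<longrightarrow> (t', s') \<in> kernel_domain T \<longrightarrow>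
        \<bar>Ks t s - Ks t' s'\<bar> \<le> B * (\<bar>t - t'\<bar> + \<bar>s - s'\<bar>))"

lemma regular_kernelD:
  assumes "regular_kernel T B K Ks"
  shows "B \<ge> 0" "continuous_on (kernel_domain T) (\<lambda>(t, s). K t s)" "continuous_on (kernel_domain T) (\<lambda>(t, s). Ks t s)"
    "\<And>t s. t \<le> T \<Longrightarrow> s \<in> {0..t} \<Longrightarrow> ((\<lambda>s. K t s) has_real_derivative Ks t s) (at s within {0..t})"
    "\<And>t s. (t, s) \<in> kernel_domain T \<Longrightarrow> \<bar>K t s\<bar> \<le> B"
    "\<And>t s. (t, s) \<in> kernel_domain T \<Longrightarrow> \<bar>Ks t s\<bar> \<le> B"
    "\<And>t r. t \<in> {0..T} \<Longrightarrow> r \<in> {0..T} \<Longrightarrow> \<bar>K t t - K r r\<bar> \<le> B * \<bar>t - r\<bar>"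
    "\<And>t s t' s'. (t, s) \<in> kernel_domain T \<Longrightarrow> (t', s') \<in> kernel_domain T \<Longrightarrow>
        \<bar>Ks t s - Ks t' s'\<bar> \<le> B * (\<bar>t - t'\<bar> + \<bar>s - s'\<bar>)"
  using assms unfolding regular_kernel_def by simp_all

lemma Ck_on_regular_kernel:
  assumes "Ck_on n (kernel_domain T) (\<lambda>(t, s). K t s)" "n \<ge> 2"
  obtains B Ks where "regular_kernel T B K Ks"
proof -
  have C2: "Ck_on (Suc (Suc 0)) (kernel_domain T) (\<lambda>(t, s). K t s)"
    by (rule Ck_on_mono[OF assms(1)]) (use assms(2) in simp)
  obtain Kt Ks where K: "kernel_gradient T K Kt Ks"
    "Ck_on (Suc 0) (kernel_domain T) (\<lambda>(t, s). Kt t s)" "Ck_on (Suc 0) (kernel_domain T) (\<lambda>(t, s). Ks t s)"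
    by (rule Ck_on_kernelE[OF C2]) blast
  note c = Ck_on_imp_continuous_on[OF C2] Ck_on_imp_continuous_on[OF K(3)]
  obtain M1 where M1: "M1 \<ge> 0" "\<And>t s. (t, s) \<in> kernel_domain T \<Longrightarrow> \<bar>K t s\<bar> \<le> M1"
    by (rule continuous_on_kernel_bounded[OF c(1)]) blast
  obtain M2 where M2: "M2 \<ge> 0" "\<And>t s. (t, s) \<in> kernel_domain T \<Longrightarrow> \<bar>Ks t s\<bar> \<le> M2"
    by (rule continuous_on_kernel_bounded[OF c(2)]) blast
  obtain M3 where M3: "M3 \<ge> 0" "\<And>t s t' s'. (t, s) \<in> kernel_domain T \<Longrightarrow> (t', s') \<in> kernel_domain T \<Longrightarrow>
    \<bar>K t s - K t' s'\<bar> \<le> M3 * (\<bar>t - t'\<bar> + \<bar>s - s'\<bar>)"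
    by (rule Ck_on_kernel_lipschitz[OF Ck_on_Suc_imp[OF C2]]) blast
  obtain M4 where M4: "M4 \<ge> 0" "\<And>t s t' s'. (t, s) \<in> kernel_domain T \<Longrightarrow> (t', s') \<in> kernel_domain T \<Longrightarrow>
    \<bar>Ks t s - Ks t' s'\<bar> \<le> M4 * (\<bar>t - t'\<bar> + \<bar>s - s'\<bar>)"
    by (rule Ck_on_kernel_lipschitz[OF K(3)]) blast
  \<comment> \<open>Along the diagonal both arguments move at once, hence
    \<open>2 * M3\<close>.\<close>
  define B where "B = M1 + M2 + 2 * M3 + M4"
  have B: "B \<ge> 0" "M1 \<le> B" "M2 \<le> B" "2 * M3 \<le> B" "M4 \<le> B" using M1(1) M2(1) M3(1) M4(1) by (auto simp: B_def)
  have "regular_kernel T B K Ks" unfolding regular_kernel_def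
  proof (intro conjI allI impI B(1) c)
    fix t s :: real assume "t \<le> T" "s \<in> {0..t}"
    then show "((\<lambda>s. K t s) has_real_derivative Ks t s) (at s within {0..t})" by (rule kernel_gradient_snd[OF K(1)])
  next
    fix t s :: real assume D: "(t, s) \<in> kernel_domain T"
    show "\<bar>K t s\<bar> \<le> B" "\<bar>Ks t s\<bar> \<le> B" using M1(2)[OF D] M2(2)[OF D] B by linarith+
  next
    fix t r :: real assume "t \<in> {0..T}" "r \<in> {0..T}"
    then have "\<bar>K t t - K r r\<bar> \<le> M3 * (\<bar>t - r\<bar> + \<bar>t - r\<bar>)" by (intro M3(2)) (auto simp: mem_kernel_domain)
    also have "\<dots> = (2 * M3) * \<bar>t - r\<bar>" by simp
    also have "\<dots> \<le> B * \<bar>t - r\<bar>" using B by (intro mult_right_mono) auto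
    finally show "\<bar>K t t - K r r\<bar> \<le> B * \<bar>t - r\<bar>" .
  next
    fix t s t' s' :: real assume D: "(t, s) \<in> kernel_domain T" "(t', s') \<in> kernel_domain T"
    have "M4 * (\<bar>t - t'\<bar> + \<bar>s - s'\<bar>) \<le> B * (\<bar>t - t'\<bar> + \<bar>s - s'\<bar>)" using B by (intro mult_right_mono) auto
    with M4(2)[OF D] show "\<bar>Ks t s - Ks t' s'\<bar> \<le> B * (\<bar>t - t'\<bar> + \<bar>s - s'\<bar>)" by linarith
  qed
  then show ?thesis by (rule that)
qed

text \<open>The Volterra integral of a density, expressed by its primitive \<open>F\<close> with
  \<open>F 0 = 0\<close>. It makes sense for every continuous \<open>F\<close>, and the factor
  \<open>K t t\<close> turns the first-kind equation for the density into one of the second kind for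
  \<open>F\<close>.\<close>

definition volterra_parts ::
  "(real \<Rightarrow> real \<Rightarrow> real) \<Rightarrow> (real \<Rightarrow> real \<Rightarrow> real) \<Rightarrow> (real \<Rightarrow> real) \<Rightarrow> real \<Rightarrow> real" where
  "volterra_parts K Ks F t = K t t * F t - integral {0..t} (\<lambda>s. Ks t s * F s)"

lemma continuous_on_kernel_section:
  fixes K :: "real \<Rightarrow> real \<Rightarrow> real"
  assumes "continuous_on (kernel_domain T) (\<lambda>(t, s). K t s)" "t \<le> T"
  shows "continuous_on {0..t} (K t)"
  by (rule continuous_on_curry_compose[OF assms(1) continuous_on_const continuous_on_id])
    (use assms(2) in \<open>auto simp: mem_kernel_domain\<close>)

text \<open>The exceptional set \<open>E\<close> is meant for the mesh points, where the derivative
  of a piecewise polynomial primitive jumps.\<close>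

lemma has_integral_volterra_parts:
  fixes w F :: "real \<Rightarrow> real"
  assumes K: "regular_kernel T B K Ks" and t: "t \<in> {0..T}"
    and F: "continuous_on {0..T} F" "F 0 = 0" and E: "finite E"
    and dF: "\<And>s. s \<in> {0<..<T} - E \<Longrightarrow> (F has_real_derivative w s) (at s)"
  shows "((\<lambda>s. K t s * w s) has_integral volterra_parts K Ks F t) {0..t}"
proof -
  have cF: "continuous_on {0..t} F" by (rule continuous_on_subset[OF F(1)]) (use t in auto)
  have cK: "continuous_on {0..t} (K t)" "continuous_on {0..t} (Ks t)"
    using continuous_on_kernel_section regular_kernelD(2,3)[OF K] t by auto
  have "((\<lambda>s. w s * K t s) has_integral volterra_parts K Ks F t) {0..t}"
  proof (rule integration_by_parts_interior_strong[OF bounded_bilinear_mult E _ cF cK(1)])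
    fix s assume s: "s \<in> {0<..<t} - E"
    then show "(F has_vector_derivative w s) (at s)"
      using dF[of s] t by (simp add: has_real_derivative_iff_has_vector_derivative)
    have "((\<lambda>s. K t s) has_real_derivative Ks t s) (at s within {0..t})"
      using regular_kernelD(4)[OF K, of t s] s t by simp
    moreover have "at s within {0..t} = at s" by (rule at_within_interior) (use s in simp)
    ultimately show "(K t has_vector_derivative Ks t s) (at s)"
      by (simp add: has_real_derivative_iff_has_vector_derivative)
  next
    have "((\<lambda>s. F s * Ks t s) has_integral integral {0..t} (\<lambda>s. F s * Ks t s)) {0..t}"
      by (intro integrable_integral integrable_continuous_real continuous_on_mult cF cK)
    then show "((\<lambda>s. F s * Ks t s) has_integral F t * K t t - F 0 * K t 0 - volterra_parts K Ks F t) {0..t}"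
      by (simp add: volterra_parts_def F(2) mult.commute)
  qed (use t in simp)
  then show ?thesis by (simp add: mult.commute)
qed

lemma continuous_on_volterra_parts:
  assumes K: "regular_kernel T B K Ks" and F: "continuous_on {0..T} F"
  shows "continuous_on {0..T} (volterra_parts K Ks F)"
proof -
  have "continuous_on {0..T} (\<lambda>t. K t t)"
    by (rule continuous_on_curry_compose[OF regular_kernelD(2)[OF K] continuous_on_id continuous_on_id])
      (auto simp: mem_kernel_domain)
  then have "continuous_on {0..T} (\<lambda>t. K t t * F t - integral {0..t} (\<lambda>s. Ks t s * F s))"
    by (intro continuous_on_diff continuous_on_mult F volterra_continuous[OF regular_kernelD(3)[OF K]])
  then show ?thesis unfolding volterra_parts_def[abs_def] .
qed

lemma integrable_volterra_parts:
  assumes K: "regular_kernel T B K Ks" and F: "continuous_on {0..T} F" and t: "t \<in> {0..T}"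
  shows "continuous_on {0..t} (\<lambda>s. Ks t s * F s)"
  by (intro continuous_on_mult continuous_on_kernel_section[OF regular_kernelD(3)[OF K]] continuous_on_subset[OF F])
    (use t in auto)

lemma abs_volterra_parts_le:
  assumes K: "regular_kernel T B K Ks" and F: "continuous_on {0..T} F" and t: "t \<in> {0..T}"
    and M: "\<And>s. s \<in> {0..T} \<Longrightarrow> \<bar>F s\<bar> \<le> M"
  shows "\<bar>volterra_parts K Ks F t\<bar> \<le> B * (1 + T) * M"
proof -
  note B = regular_kernelD(1)[OF K]
  have M0: "M \<ge> 0" using M[OF t] by linarith
  have "\<bar>K t t * F t\<bar> \<le> B * M"
    unfolding abs_mult using regular_kernelD(5)[OF K, of t t] M[OF t] t B by (intro mult_mono) (auto simp: mem_kernel_domain)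
  moreover have "\<bar>integral {0..t} (\<lambda>s. Ks t s * F s)\<bar> \<le> (B * M) * (t - 0)"
  proof (rule abs_integral_le_bound[OF _ integrable_volterra_parts[OF K F t]])
    fix s assume "s \<in> {0..t}"
    then show "\<bar>Ks t s * F s\<bar> \<le> B * M"
      unfolding abs_mult using regular_kernelD(6)[OF K, of t s] M[of s] t B by (intro mult_mono) (auto simp: mem_kernel_domain)
  qed (use t in simp)
  moreover have "(B * M) * (t - 0) \<le> (B * M) * T" using B M0 t by (intro mult_left_mono) auto
  ultimately show ?thesis unfolding volterra_parts_def by (simp add: algebra_simps)
qed

section \<open>The mesh\<close>

lemma mesh_pt_0 [simp]: "mesh_pt T N 0 = 0"
  by (simp add: mesh_pt_def)

lemma mesh_pt_Suc: "mesh_pt T N (Suc n) = mesh_pt T N n + T / real N"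
  by (simp add: mesh_pt_def add_divide_distrib algebra_simps)

lemma mesh_pt_last: "N > 0 \<Longrightarrow> mesh_pt T N N = T"
  by (simp add: mesh_pt_def)

lemma mesh_pt_mono: "T > 0 \<Longrightarrow> m \<le> n \<Longrightarrow> mesh_pt T N m \<le> mesh_pt T N n"
  unfolding mesh_pt_def by (intro mult_right_mono) auto

lemma mesh_pt_nonneg: "T > 0 \<Longrightarrow> 0 \<le> mesh_pt T N n"
  by (simp add: mesh_pt_def)

lemma mesh_pt_le: "T > 0 \<Longrightarrow> n \<le> N \<Longrightarrow> N > 0 \<Longrightarrow> mesh_pt T N n \<le> T"
  using mesh_pt_mono[of T n N N] mesh_pt_last[of N T] by simp

lemma mesh_cell_nonempty: "T > 0 \<Longrightarrow> N > 0 \<Longrightarrow> mesh_pt T N n < mesh_pt T N (Suc n)"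
  by (simp add: mesh_pt_Suc)

lemma mesh_cell_subset: "T > 0 \<Longrightarrow> n < N \<Longrightarrow> {mesh_pt T N n..mesh_pt T N (Suc n)} \<subseteq> {0..T}"
  using mesh_pt_nonneg[of T N n] mesh_pt_le[of T "Suc n" N] by auto

lemma mesh_cell_exists:
  assumes "T > 0" "N > 0" "s \<in> {0..T}"
  obtains n where "n < N" "s \<in> {mesh_pt T N n..mesh_pt T N (Suc n)}"
proof -
  have "s \<in> {0..mesh_pt T N m} \<Longrightarrow> m > 0 \<Longrightarrow> \<exists>n<m. s \<in> {mesh_pt T N n..mesh_pt T N (Suc n)}" for m
  proof (induction m)
    case (Suc m)
    show ?case
    proof (cases "mesh_pt T N m \<le> s")
      case True then show ?thesis using Suc.prems by (intro exI[of _ m]) simp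
    next
      case False
      then have "m > 0" using Suc.prems by (cases m) auto
      then obtain n where "n < m" "s \<in> {mesh_pt T N n..mesh_pt T N (Suc n)}"
        using Suc.IH Suc.prems False by auto
      then show ?thesis by (intro exI[of _ n]) simp
    qed
  qed simp
  from this[of N] show ?thesis using assms that by (auto simp: mesh_pt_last)
qed

lemma abs_integral_mesh_le:
  fixes f :: "real \<Rightarrow> real"
  assumes "T > 0" "continuous_on {0..mesh_pt T N n} f"
    and "\<And>j. j < n \<Longrightarrow> \<bar>integral {mesh_pt T N j..mesh_pt T N (Suc j)} f\<bar> \<le> c j"
  shows "\<bar>integral {0..mesh_pt T N n} f\<bar> \<le> (\<Sum>j<n. c j)"
  using assms(2,3)
proof (induction n)
  case (Suc n)
  have le: "0 \<le> mesh_pt T N n" "mesh_pt T N n \<le> mesh_pt T N (Suc n)"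
    using mesh_pt_nonneg mesh_pt_mono assms(1) by auto
  have "continuous_on {0..mesh_pt T N n} f" by (rule continuous_on_subset[OF Suc.prems(1)]) (use le in auto)
  then have "\<bar>integral {0..mesh_pt T N n} f\<bar> \<le> (\<Sum>j<n. c j)" using Suc.IH Suc.prems(2) by simp
  moreover have "integral {0..mesh_pt T N n} f + integral {mesh_pt T N n..mesh_pt T N (Suc n)} f = integral {0..mesh_pt T N (Suc n)} f"
    using Henstock_Kurzweil_Integration.integral_combine[OF le integrable_continuous_real[OF Suc.prems(1)]] .
  ultimately show ?case using Suc.prems(2)[of n] by simp
qed simp

lemma abs_integral_mesh_bound:
  fixes f :: "real \<Rightarrow> real"
  assumes "T > 0" "continuous_on {0..mesh_pt T N n} f"
    and "\<And>j s. j < n \<Longrightarrow> s \<in> {mesh_pt T N j..mesh_pt T N (Suc j)} \<Longrightarrow> \<bar>f s\<bar> \<le> M j"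
  shows "\<bar>integral {0..mesh_pt T N n} f\<bar> \<le> (\<Sum>j<n. M j * (T / real N))"
proof (rule abs_integral_mesh_le[OF assms(1,2)])
  fix j assume j: "j < n"
  have le: "0 \<le> mesh_pt T N j" "mesh_pt T N j \<le> mesh_pt T N (Suc j)" "mesh_pt T N (Suc j) \<le> mesh_pt T N n"
    using mesh_pt_nonneg mesh_pt_mono assms(1) j by auto
  have "\<bar>integral {mesh_pt T N j..mesh_pt T N (Suc j)} f\<bar> \<le> M j * (mesh_pt T N (Suc j) - mesh_pt T N j)"
    by (rule abs_integral_le_bound[OF le(2) continuous_on_subset[OF assms(2)]]) (use le assms(3)[OF j] in auto)
  then show "\<bar>integral {mesh_pt T N j..mesh_pt T N (Suc j)} f\<bar> \<le> M j * (T / real N)" by (simp add: mesh_pt_Suc)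
qed

text \<open>Orthogonality to constants turns the memory term into a sum of integrals of the kernel
  increment over each cell, which gains one power of the step size.\<close>

lemma volterra_parts_orthogonal:
  assumes K: "regular_kernel T B K Ks" and T: "T > 0" and W: "continuous_on {0..T} W"
    and M: "\<And>s. s \<in> {0..T} \<Longrightarrow> \<bar>W s\<bar> \<le> M"
    and o: "\<And>j. j < N \<Longrightarrow> poly_orth k (mesh_pt T N j) (mesh_pt T N (Suc j)) W"
    and n: "n < N" and s: "s \<in> {mesh_pt T N n..mesh_pt T N (Suc n)}"
  shows "\<bar>volterra_parts K Ks W s - K (mesh_pt T N n) (mesh_pt T N n) * W s\<bar> \<le> (2 + T) * B * M * (T / real N)"
proof -
  let ?t = "mesh_pt T N"
  define h where "h = T / real N"
  have tS: "?t (Suc j) = ?t j + h" for j by (simp add: mesh_pt_Suc h_def)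
  note B = regular_kernelD(1)[OF K]
  have sI: "s \<in> {0..T}" and tI: "?t n \<in> {0..T}" and tn: "0 \<le> ?t n" "?t n \<le> s" "\<bar>s - ?t n\<bar> \<le> h"
    using mesh_cell_subset[OF T n] s mesh_pt_nonneg[OF T, of N n] by (auto simp: tS)
  have M0: "M \<ge> 0" using M[OF sI] by linarith
  have h: "h > 0" using T n by (simp add: h_def)
  have c: "continuous_on {0..s} (\<lambda>\<tau>. Ks s \<tau> * W \<tau>)" by (rule integrable_volterra_parts[OF K W sI])
  have diag: "\<bar>(K s s - K (?t n) (?t n)) * W s\<bar> \<le> (B * h) * M"
    unfolding abs_mult
  proof (rule mult_mono)
    have "\<bar>K s s - K (?t n) (?t n)\<bar> \<le> B * \<bar>s - ?t n\<bar>" by (rule regular_kernelD(7)[OF K sI tI])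
    also have "\<dots> \<le> B * h" using tn B by (intro mult_left_mono) auto
    finally show "\<bar>K s s - K (?t n) (?t n)\<bar> \<le> B * h" .
  qed (use M[OF sI] B h in auto)
  have last: "\<bar>integral {?t n..s} (\<lambda>\<tau>. Ks s \<tau> * W \<tau>)\<bar> \<le> (B * M) * h"
  proof -
    have "\<bar>integral {?t n..s} (\<lambda>\<tau>. Ks s \<tau> * W \<tau>)\<bar> \<le> (B * M) * (s - ?t n)"
    proof (rule abs_integral_le_bound[OF tn(2) continuous_on_subset[OF c]])
      fix \<tau> assume \<tau>: "\<tau> \<in> {?t n..s}"
      have "\<bar>Ks s \<tau>\<bar> \<le> B" by (rule regular_kernelD(6)[OF K]) (use \<tau> tn sI in \<open>auto simp: mem_kernel_domain\<close>)
      moreover have "\<bar>W \<tau>\<bar> \<le> M" by (rule M) (use \<tau> tn sI in auto)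
      ultimately show "\<bar>Ks s \<tau> * W \<tau>\<bar> \<le> B * M" unfolding abs_mult using B by (intro mult_mono) auto
    qed (use tn in auto)
    also have "\<dots> \<le> (B * M) * h" using tn B M0 by (intro mult_left_mono) auto
    finally show ?thesis .
  qed
  have first: "\<bar>integral {0..?t n} (\<lambda>\<tau>. Ks s \<tau> * W \<tau>)\<bar> \<le> (\<Sum>j<n. B * h * M * h)"
  proof (rule abs_integral_mesh_le[OF T continuous_on_subset[OF c]])
    fix j assume j: "j < n"
    let ?c = "{?t j..?t (Suc j)}"
    have tj: "0 \<le> ?t j" "?t j \<le> ?t (Suc j)" "?t (Suc j) \<le> s"
      using mesh_pt_nonneg[OF T, of N j] mesh_pt_mono[OF T, of "Suc j" n N] mesh_pt_mono[OF T, of j "Suc j" N] j tn by auto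
    have sub: "?c \<subseteq> {0..s}" using tj by auto
    have "integral ?c (\<lambda>\<tau>. W \<tau> * poly [:Ks s (?t j):] \<tau>) = 0"
      by (rule poly_orthD[OF o]) (use j n in auto)
    then have z: "integral ?c (\<lambda>\<tau>. Ks s (?t j) * W \<tau>) = 0" by (simp add: mult.commute)
    have cW: "continuous_on ?c W" by (rule continuous_on_subset[OF W]) (use tj sI in auto)
    have cW': "continuous_on ?c (\<lambda>\<tau>. Ks s (?t j) * W \<tau>)" by (intro continuous_on_mult continuous_on_const cW)
    note c' = continuous_on_subset[OF c sub]
    have "integral ?c (\<lambda>\<tau>. Ks s \<tau> * W \<tau>) = integral ?c (\<lambda>\<tau>. Ks s \<tau> * W \<tau> - Ks s (?t j) * W \<tau>)"
      using integral_diff[OF integrable_continuous_real[OF c'] integrable_continuous_real[OF cW']] z by simp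
    also have "\<bar>\<dots>\<bar> \<le> (B * h * M) * (?t (Suc j) - ?t j)"
    proof (rule abs_integral_le_bound[OF tj(2) continuous_on_diff[OF c' cW']])
      fix \<tau> assume \<tau>: "\<tau> \<in> ?c"
      have "\<bar>Ks s \<tau> - Ks s (?t j)\<bar> \<le> B * (\<bar>s - s\<bar> + \<bar>\<tau> - ?t j\<bar>)"
        by (rule regular_kernelD(8)[OF K]) (use \<tau> tj sI in \<open>auto simp: mem_kernel_domain\<close>)
      also have "\<dots> \<le> B * h" using \<tau> B by (intro mult_left_mono) (auto simp: tS)
      finally have "\<bar>Ks s \<tau> - Ks s (?t j)\<bar> \<le> B * h" .
      moreover have "\<bar>W \<tau>\<bar> \<le> M" by (rule M) (use \<tau> tj sI in auto)
      ultimately have "\<bar>(Ks s \<tau> - Ks s (?t j)) * W \<tau>\<bar> \<le> B * h * M"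
        unfolding abs_mult using B h by (intro mult_mono) auto
      then show "\<bar>Ks s \<tau> * W \<tau> - Ks s (?t j) * W \<tau>\<bar> \<le> B * h * M" by (simp add: left_diff_distrib)
    qed
    finally show "\<bar>integral ?c (\<lambda>\<tau>. Ks s \<tau> * W \<tau>)\<bar> \<le> B * h * M * h" by (simp add: tS)
  qed (use tn in auto)
  \<comment> \<open>Each completed cell contributes \<open>B * M * h ^ 2\<close>; since
    \<open>real n * h\<close> is at most \<open>T\<close>, one power of \<open>h\<close> survives
    the summation.\<close>
  have "(\<Sum>j<n. B * h * M * h) = (real n * h) * (B * M * h)" by simp
  also have "\<dots> \<le> T * (B * M * h)"
  proof (rule mult_right_mono)
    show "real n * h \<le> T" using mesh_pt_le[OF T, of n N] n by (simp add: mesh_pt_def h_def)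
  qed (use B M0 h in simp)
  finally have "\<bar>integral {0..?t n} (\<lambda>\<tau>. Ks s \<tau> * W \<tau>)\<bar> \<le> T * (B * M * h)" using first by linarith
  moreover have "integral {0..?t n} (\<lambda>\<tau>. Ks s \<tau> * W \<tau>) + integral {?t n..s} (\<lambda>\<tau>. Ks s \<tau> * W \<tau>) = integral {0..s} (\<lambda>\<tau>. Ks s \<tau> * W \<tau>)"
    by (rule Henstock_Kurzweil_Integration.integral_combine[OF tn(1,2) integrable_continuous_real[OF c]])
  moreover have "volterra_parts K Ks W s - K (?t n) (?t n) * W s
      = (K s s - K (?t n) (?t n)) * W s - integral {0..s} (\<lambda>\<tau>. Ks s \<tau> * W \<tau>)"
    by (simp add: volterra_parts_def left_diff_distrib)
  \<comment> \<open>The factor \<open>2 + T\<close> has three sources: the variation of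
    \<open>K\<close> along the diagonal, the unfinished cell, and the completed cells of total
    length at most \<open>T\<close>.\<close>
  ultimately have "\<bar>volterra_parts K Ks W s - K (?t n) (?t n) * W s\<bar> \<le> (B * h) * M + T * (B * M * h) + (B * M) * h"
    using diag last by linarith
  also have "\<dots> = (2 + T) * B * M * h" by (simp add: algebra_simps)
  finally show ?thesis unfolding h_def .
qed

text \<open>In the application \<open>a\<close> is of order \<open>h\<close>, so the exponential
  stays bounded, while the error \<open>b\<close> per cell is multiplied by the number of cells.
  This is one of the two factors \<open>1 / h\<close> that a residual costs.\<close>

lemma discrete_gronwall:
  fixes S :: "nat \<Rightarrow> real"
  assumes "a \<ge> 0" "b \<ge> 0" "S 0 \<le> 0" "\<And>n. n < N \<Longrightarrow> S (Suc n) \<le> (1 + a) * S n + b"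
  shows "n \<le> N \<Longrightarrow> S n \<le> real n * b * exp (a * real n)"
proof (induction n)
  case 0 then show ?case using assms(3) by simp
next
  case (Suc n)
  have "S (Suc n) \<le> (1 + a) * S n + b" using assms(4) Suc.prems by simp
  also have "\<dots> \<le> (1 + a) * (real n * b * exp (a * real n)) + b"
    using Suc assms(1) by (intro add_right_mono mult_left_mono) auto
  also have "\<dots> \<le> exp a * (real n * b * exp (a * real n)) + b"
    using exp_ge_add_one_self[of a] assms by (intro add_right_mono mult_right_mono) auto
  also have "\<dots> = real n * b * exp (a * real (Suc n)) + b * 1" by (simp add: exp_add[symmetric] algebra_simps)
  also have "\<dots> \<le> real n * b * exp (a * real (Suc n)) + b * exp (a * real (Suc n))"
    using assms by (intro add_left_mono mult_left_mono) auto
  also have "\<dots> = real (Suc n) * b * exp (a * real (Suc n))" by (simp add: algebra_simps)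
  finally show ?case .
qed

section \<open>Stability of the discrete first-kind equation\<close>

text \<open>Two estimates on one cell for \<open>Y = volterra_parts K Ks U\<close>. There \<open>Y\<close> is, up to a factor and
  a perturbation of size \<open>h (M n + Q)\<close>, the polynomial \<open>U - G / K(t\<^sub>n, t\<^sub>n)\<close> with \<open>G\<close> the
  memory term at \<open>t\<^sub>n\<close>. Working with \<open>Y\<close> instead of \<open>U\<close> is what avoids a growth factor without
  \<open>h\<close> in the recursion over the cells.\<close>

lemma volterra_cell_estimate:
  assumes K: "regular_kernel T B K Ks" and T: "T > 0" and U: "continuous_on {0..T} U"
    and n: "n < N" and hs: "h = T / real N" "h \<le> 1" and ka: "\<kappa> > 0" "\<bar>K (mesh_pt T N n) (mesh_pt T N n)\<bar> \<ge> \<kappa>"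
    and C1: "C1 \<ge> 0" "orthogonal_step_bound k C1"
    and M: "\<And>j s. j \<le> n \<Longrightarrow> s \<in> {mesh_pt T N j..mesh_pt T N (Suc j)} \<Longrightarrow> \<bar>U s\<bar> \<le> M j"
    and V: "degree V \<le> Suc k" "\<And>s. s \<in> {mesh_pt T N n..mesh_pt T N (Suc n)} \<Longrightarrow> U s = poly V s"
    and r: "continuous_on {mesh_pt T N n..mesh_pt T N (Suc n)} r"
      "\<And>s. s \<in> {mesh_pt T N n..mesh_pt T N (Suc n)} \<Longrightarrow> \<bar>r s\<bar> \<le> \<epsilon>"
      "poly_orth k (mesh_pt T N n) (mesh_pt T N (Suc n)) (\<lambda>s. volterra_parts K Ks U s - r s)"
    and Q: "Q = (\<Sum>j<n. M j * h)" and \<eta>: "\<eta> = (\<epsilon> + (2 * B * h * M n + B * h * Q)) / \<kappa>"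
    and Y: "Y = volterra_parts K Ks U"
  shows "\<And>s. s \<in> {mesh_pt T N n..mesh_pt T N (Suc n)} \<Longrightarrow>
        \<bar>U s\<bar> \<le> C1 * (\<bar>Y (mesh_pt T N n)\<bar> / \<kappa> + \<eta>) + B * Q / \<kappa>"
    and "\<bar>Y (mesh_pt T N (Suc n))\<bar> \<le> \<bar>Y (mesh_pt T N n)\<bar> + B * C1 * \<eta> + (2 * B * h * M n + B * h * Q)"
proof -
  let ?t = "mesh_pt T N"
  let ?c = "{?t n..?t (Suc n)}"
  have tS: "?t (Suc j) = ?t j + h" for j by (simp add: mesh_pt_Suc hs(1))
  have h: "h > 0" using T n by (simp add: hs(1))
  note B = regular_kernelD(1)[OF K]
  have cell: "?c \<subseteq> {0..T}" by (rule mesh_cell_subset[OF T n])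
  have lt: "?t n < ?t (Suc n)" using h by (simp add: tS)
  have tc: "?t n \<in> ?c" "?t (Suc n) \<in> ?c" using lt by auto
  have tI: "?t n \<in> {0..T}" using cell tc by blast
  have M0: "M j \<ge> 0" if "j \<le> n" for j
  proof -
    have "?t j \<in> {?t j..?t (Suc j)}" using h by (simp add: tS)
    then have "\<bar>U (?t j)\<bar> \<le> M j" by (rule M[OF that])
    then show ?thesis by linarith
  qed
  have Q0: "Q \<ge> 0" unfolding Q using M0 h by (intro sum_nonneg mult_nonneg_nonneg) auto
  \<comment> \<open>The kernel is frozen at the left end for the whole cell; its variation goes into
    the perturbation \<open>q\<close> below.\<close>
  define kn where "kn = K (?t n) (?t n)"
  have kn: "\<bar>kn\<bar> \<ge> \<kappa>" "kn \<noteq> 0" "\<bar>kn\<bar> \<le> B"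
    using ka regular_kernelD(5)[OF K, of "?t n" "?t n"] tI by (auto simp: kn_def mem_kernel_domain)
  define G where "G = (\<lambda>s. integral {0..s} (\<lambda>\<tau>. Ks s \<tau> * U \<tau>))"
  have int: "continuous_on {0..s} (\<lambda>\<tau>. Ks s \<tau> * U \<tau>)" if "s \<in> {0..T}" for s
    by (rule integrable_volterra_parts[OF K U that])
  have Usmall: "\<bar>U \<tau>\<bar> \<le> M n" if "\<tau> \<in> ?c" for \<tau> using M[OF order_refl that] .
  have Gn: "\<bar>G (?t n)\<bar> \<le> B * Q"
  proof -
    have "\<bar>G (?t n)\<bar> \<le> (\<Sum>j<n. (B * M j) * (T / real N))" unfolding G_def
    proof (rule abs_integral_mesh_bound[OF T int[OF tI]])
      fix j s assume j: "j < n" and s: "s \<in> {?t j..?t (Suc j)}"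
      have sb: "0 \<le> s" "s \<le> ?t n"
        using s mesh_pt_nonneg[OF T, of N j] mesh_pt_mono[OF T, of "Suc j" n N] j by auto
      have "\<bar>Ks (?t n) s\<bar> \<le> B" by (rule regular_kernelD(6)[OF K]) (use sb tI in \<open>auto simp: mem_kernel_domain\<close>)
      moreover have "\<bar>U s\<bar> \<le> M j" by (rule M[OF _ s]) (use j in simp)
      ultimately show "\<bar>Ks (?t n) s * U s\<bar> \<le> B * M j" unfolding abs_mult using B by (intro mult_mono) auto
    qed
    then show ?thesis by (simp add: Q hs(1) sum_distrib_left mult.assoc)
  qed
  \<comment> \<open>The memory changes for two reasons: the new part of the integral gives
    \<open>B * h * M n\<close>, and the change of \<open>Ks\<close> in its first argument gives
    \<open>B * h * Q\<close>.\<close>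
  have Gd: "\<bar>G s - G (?t n)\<bar> \<le> B * h * M n + B * h * Q" if s: "s \<in> ?c" for s
  proof -
    have sI: "s \<in> {0..T}" using s cell by blast
    have tn: "0 \<le> ?t n" "?t n \<le> s" "s - ?t n \<le> h" using s tI by (auto simp: tS)
    have c0: "continuous_on {0..?t n} (\<lambda>\<tau>. Ks s \<tau> * U \<tau>)"
      by (rule continuous_on_subset[OF int[OF sI]]) (use tn in auto)
    have "\<bar>integral {?t n..s} (\<lambda>\<tau>. Ks s \<tau> * U \<tau>)\<bar> \<le> (B * M n) * (s - ?t n)"
    proof (rule abs_integral_le_bound[OF tn(2) continuous_on_subset[OF int[OF sI]]])
      fix \<tau> assume \<tau>: "\<tau> \<in> {?t n..s}"
      have "\<bar>Ks s \<tau>\<bar> \<le> B" by (rule regular_kernelD(6)[OF K]) (use \<tau> tn sI in \<open>auto simp: mem_kernel_domain\<close>)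
      moreover have "\<bar>U \<tau>\<bar> \<le> M n" by (rule Usmall) (use \<tau> s in auto)
      ultimately show "\<bar>Ks s \<tau> * U \<tau>\<bar> \<le> B * M n" unfolding abs_mult using B by (intro mult_mono) auto
    qed (use tn in auto)
    also have "\<dots> \<le> (B * M n) * h" using tn B M0[of n] by (intro mult_left_mono) auto
    finally have 1: "\<bar>integral {?t n..s} (\<lambda>\<tau>. Ks s \<tau> * U \<tau>)\<bar> \<le> (B * M n) * h" .
    have "\<bar>integral {0..?t n} (\<lambda>\<tau>. Ks s \<tau> * U \<tau> - Ks (?t n) \<tau> * U \<tau>)\<bar> \<le> (\<Sum>j<n. ((B * h) * M j) * (T / real N))"
    proof (rule abs_integral_mesh_bound[OF T continuous_on_diff[OF c0 int[OF tI]]])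
      fix j \<tau> assume j: "j < n" and \<tau>: "\<tau> \<in> {?t j..?t (Suc j)}"
      have sb: "0 \<le> \<tau>" "\<tau> \<le> ?t n"
        using \<tau> mesh_pt_nonneg[OF T, of N j] mesh_pt_mono[OF T, of "Suc j" n N] j by auto
      have "\<bar>Ks s \<tau> - Ks (?t n) \<tau>\<bar> \<le> B * (\<bar>s - ?t n\<bar> + \<bar>\<tau> - \<tau>\<bar>)"
        by (rule regular_kernelD(8)[OF K]) (use sb tn sI tI in \<open>auto simp: mem_kernel_domain\<close>)
      also have "\<dots> \<le> B * h" using tn B by (intro mult_left_mono) auto
      finally have "\<bar>Ks s \<tau> - Ks (?t n) \<tau>\<bar> \<le> B * h" .
      moreover have "\<bar>U \<tau>\<bar> \<le> M j" by (rule M[OF _ \<tau>]) (use j in simp)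
      ultimately have "\<bar>(Ks s \<tau> - Ks (?t n) \<tau>) * U \<tau>\<bar> \<le> (B * h) * M j"
        unfolding abs_mult using B h by (intro mult_mono) auto
      then show "\<bar>Ks s \<tau> * U \<tau> - Ks (?t n) \<tau> * U \<tau>\<bar> \<le> (B * h) * M j" by (simp add: left_diff_distrib)
    qed
    also have "\<dots> = B * h * Q" by (simp add: Q hs(1) sum_distrib_left mult.assoc)
    finally have 2: "\<bar>integral {0..?t n} (\<lambda>\<tau>. Ks s \<tau> * U \<tau> - Ks (?t n) \<tau> * U \<tau>)\<bar> \<le> B * h * Q" .
    have "integral {0..?t n} (\<lambda>\<tau>. Ks s \<tau> * U \<tau> - Ks (?t n) \<tau> * U \<tau>)
        = integral {0..?t n} (\<lambda>\<tau>. Ks s \<tau> * U \<tau>) - G (?t n)" unfolding G_def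
      by (rule integral_diff[OF integrable_continuous_real[OF c0] integrable_continuous_real[OF int[OF tI]]])
    moreover have "integral {0..?t n} (\<lambda>\<tau>. Ks s \<tau> * U \<tau>) + integral {?t n..s} (\<lambda>\<tau>. Ks s \<tau> * U \<tau>) = G s"
      unfolding G_def
      by (rule Henstock_Kurzweil_Integration.integral_combine[OF tn(1,2) integrable_continuous_real[OF int[OF sI]]])
    ultimately show ?thesis using 1 2 by (simp add: mult_ac)
  qed
  have Yeq: "Y s = K s s * U s - G s" for s by (simp add: Y volterra_parts_def G_def)
  \<comment> \<open>What \<open>Y\<close> has beyond its polynomial part \<open>kn * p\<close>. It
    vanishes at the left mesh point, so there |Y| equals |kn| times |p| without error.\<close>
  define q where "q = (\<lambda>s. (K s s - kn) * U s - (G s - G (?t n)))"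
  define \<delta> where "\<delta> = 2 * B * h * M n + B * h * Q"
  have qb: "\<bar>q s\<bar> \<le> \<delta>" if s: "s \<in> ?c" for s
  proof -
    have "\<bar>K s s - kn\<bar> \<le> B * \<bar>s - ?t n\<bar>" unfolding kn_def
      by (rule regular_kernelD(7)[OF K]) (use s cell tI in auto)
    also have "\<dots> \<le> B * h" using s B by (intro mult_left_mono) (auto simp: tS)
    finally have "\<bar>(K s s - kn) * U s\<bar> \<le> (B * h) * M n"
      unfolding abs_mult using Usmall[OF s] B h by (intro mult_mono) auto
    then show ?thesis using Gd[OF s] unfolding q_def \<delta>_def by linarith
  qed
  define p where "p = V - [:G (?t n) / kn:]"
  have pU: "poly p s = U s - G (?t n) / kn" if "s \<in> ?c" for s using V(2)[OF that] by (simp add: p_def)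
  have Ysplit: "Y s = kn * poly p s + q s" if "s \<in> ?c" for s
  proof -
    have "U s = poly p s + G (?t n) / kn" using pU[OF that] by simp
    then have "kn * U s = kn * poly p s + G (?t n)" using kn(2) by (simp add: distrib_left)
    then show ?thesis by (simp add: Yeq q_def left_diff_distrib)
  qed
  have q0: "q (?t n) = 0" by (simp add: q_def kn_def)
  have cY: "continuous_on ?c Y" unfolding Y by (rule continuous_on_subset[OF continuous_on_volterra_parts[OF K U] cell])
  have cq: "continuous_on ?c q"
  proof -
    have "continuous_on ?c (\<lambda>s. Y s - kn * poly p s)"
      by (intro continuous_on_diff cY continuous_on_mult continuous_on_const continuous_on_poly_real)
    then show ?thesis
      by (rule continuous_on_cong[THEN iffD1, OF refl, rotated]) (simp add: Ysplit)
  qed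
  \<comment> \<open>Here \<open>Y - r = kn * (p - g)\<close>, so the orthogonality of the residual
    is that of \<open>p - g\<close>.\<close>
  define g where "g = (\<lambda>s. inverse kn * (r s - q s))"
  have cg: "continuous_on ?c g" unfolding g_def
    by (intro continuous_on_mult continuous_on_const continuous_on_diff r cq)
  have gb: "\<bar>g s\<bar> \<le> \<eta>" if s: "s \<in> ?c" for s
  proof -
    have "\<bar>g s\<bar> = \<bar>r s - q s\<bar> / \<bar>kn\<bar>" by (simp add: g_def abs_mult divide_inverse mult.commute)
    also have "\<dots> \<le> (\<epsilon> + \<delta>) / \<kappa>"
      using r(2)[OF s] qb[OF s] kn ka(1) by (intro frac_le) auto
    finally show ?thesis by (simp add: \<eta> \<delta>_def)
  qed
  have og: "poly_orth k (?t n) (?t (Suc n)) (\<lambda>s. poly p s - g s)"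
    by (rule poly_orth_cong[OF poly_orth_cmult[OF r(3), of "inverse kn"]])
      (use kn(2) Ysplit in \<open>simp add: g_def Y[symmetric] algebra_simps\<close>)
  have degp: "degree p \<le> Suc k" unfolding p_def by (intro degree_diff_le V) simp
  have p1: "\<bar>poly p s\<bar> \<le> C1 * (\<bar>poly p (?t n)\<bar> + \<eta>)" if "s \<in> ?c" for s
    by (rule orthogonal_step_boundD(1)[OF C1(2) lt degp cg gb og that])
  note p2 = orthogonal_step_boundD(2)[OF C1(2) lt degp cg gb og]
  have Yn: "\<bar>Y (?t n)\<bar> = \<bar>kn\<bar> * \<bar>poly p (?t n)\<bar>" using Ysplit[OF tc(1)] by (simp add: q0 abs_mult)
  have pn: "\<bar>poly p (?t n)\<bar> \<le> \<bar>Y (?t n)\<bar> / \<kappa>"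
  proof -
    have "\<kappa> * \<bar>poly p (?t n)\<bar> \<le> \<bar>Y (?t n)\<bar>" unfolding Yn using kn by (intro mult_right_mono) auto
    then show ?thesis using ka(1) by (simp add: pos_le_divide_eq mult.commute)
  qed
  show "\<bar>U s\<bar> \<le> C1 * (\<bar>Y (?t n)\<bar> / \<kappa> + \<eta>) + B * Q / \<kappa>" if s: "s \<in> ?c" for s
  proof -
    have "\<bar>G (?t n) / kn\<bar> \<le> B * Q / \<kappa>"
      unfolding abs_divide using Gn kn ka B Q0 by (intro frac_le) auto
    moreover have "\<bar>poly p s\<bar> \<le> C1 * (\<bar>Y (?t n)\<bar> / \<kappa> + \<eta>)"
      by (rule order_trans[OF p1[OF s]]) (intro mult_left_mono add_right_mono pn C1(1))
    ultimately show ?thesis using pU[OF s] by linarith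
  qed
  have e0: "0 \<le> \<eta>" using gb[OF tc(1)] by linarith
  \<comment> \<open>Multiplying the recursion for \<open>p\<close> by |kn| restores |Y| at the left
    end with factor exactly 1.\<close>
  have "\<bar>Y (?t (Suc n))\<bar> \<le> \<bar>kn\<bar> * \<bar>poly p (?t (Suc n))\<bar> + \<bar>q (?t (Suc n))\<bar>"
    unfolding Ysplit[OF tc(2)] abs_mult[symmetric] by (rule abs_triangle_ineq)
  also have "\<dots> \<le> \<bar>kn\<bar> * (\<bar>poly p (?t n)\<bar> + C1 * \<eta>) + \<delta>"
    using p2 qb[OF tc(2)] by (intro add_mono mult_left_mono) auto
  also have "\<dots> = \<bar>Y (?t n)\<bar> + \<bar>kn\<bar> * (C1 * \<eta>) + \<delta>" by (simp add: Yn algebra_simps)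
  also have "\<dots> \<le> \<bar>Y (?t n)\<bar> + B * (C1 * \<eta>) + \<delta>"
    using kn(3) C1(1) e0 by (intro add_right_mono add_left_mono mult_right_mono) auto
  finally show "\<bar>Y (?t (Suc n))\<bar> \<le> \<bar>Y (?t n)\<bar> + B * C1 * \<eta> + (2 * B * h * M n + B * h * Q)"
    by (simp add: \<delta>_def mult.assoc)
qed

text \<open>The residuals are indexed by the cell because that of the first equation contains a
  piecewise polynomial, which jumps at mesh points. The factor \<open>real N\<close> stands for
  \<open>1 / h\<close>.\<close>

definition volterra_stable ::
  "real \<Rightarrow> nat \<Rightarrow> (real \<Rightarrow> real \<Rightarrow> real) \<Rightarrow> (real \<Rightarrow> real \<Rightarrow> real) \<Rightarrow> real \<Rightarrow> real \<Rightarrow> bool" where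
  "volterra_stable T k K Ks C h0 \<longleftrightarrow> (\<forall>N U r V \<epsilon>. N > 0 \<longrightarrow> T / real N < h0 \<longrightarrow> continuous_on {0..T} U \<longrightarrow> U 0 = 0 \<longrightarrow>
     (\<forall>n<N. degree (V n) \<le> Suc k \<and> (\<forall>s\<in>{mesh_pt T N n..mesh_pt T N (Suc n)}. U s = poly (V n) s)) \<longrightarrow>
     (\<forall>n<N. continuous_on {mesh_pt T N n..mesh_pt T N (Suc n)} (r n) \<and>
        (\<forall>s\<in>{mesh_pt T N n..mesh_pt T N (Suc n)}. \<bar>r n s\<bar> \<le> \<epsilon>) \<and>
        poly_orth k (mesh_pt T N n) (mesh_pt T N (Suc n)) (\<lambda>s. volterra_parts K Ks U s - r n s)) \<longrightarrow>
     (\<forall>s\<in>{0..T}. \<bar>U s\<bar> \<le> C * \<epsilon> * real N))"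

lemma volterra_stableD:
  assumes "volterra_stable T k K Ks C h0" "N > 0" "T / real N < h0" "continuous_on {0..T} U" "U 0 = 0"
    and "\<And>n. n < N \<Longrightarrow> degree (V n) \<le> Suc k"
    and "\<And>n s. n < N \<Longrightarrow> s \<in> {mesh_pt T N n..mesh_pt T N (Suc n)} \<Longrightarrow> U s = poly (V n) s"
    and "\<And>n. n < N \<Longrightarrow> continuous_on {mesh_pt T N n..mesh_pt T N (Suc n)} (r n)"
    and "\<And>n s. n < N \<Longrightarrow> s \<in> {mesh_pt T N n..mesh_pt T N (Suc n)} \<Longrightarrow> \<bar>r n s\<bar> \<le> \<epsilon>"
    and "\<And>n. n < N \<Longrightarrow> poly_orth k (mesh_pt T N n) (mesh_pt T N (Suc n)) (\<lambda>s. volterra_parts K Ks U s - r n s)"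
    and "s \<in> {0..T}"
  shows "\<bar>U s\<bar> \<le> C * \<epsilon> * real N"
proof -
  have V: "\<forall>n<N. degree (V n) \<le> Suc k \<and> (\<forall>s\<in>{mesh_pt T N n..mesh_pt T N (Suc n)}. U s = poly (V n) s)"
    using assms(6,7) by (intro allI impI conjI ballI)
  have r: "\<forall>n<N. continuous_on {mesh_pt T N n..mesh_pt T N (Suc n)} (r n) \<and>
        (\<forall>s\<in>{mesh_pt T N n..mesh_pt T N (Suc n)}. \<bar>r n s\<bar> \<le> \<epsilon>) \<and>
        poly_orth k (mesh_pt T N n) (mesh_pt T N (Suc n)) (\<lambda>s. volterra_parts K Ks U s - r n s)"
    using assms(8-10) by (intro allI impI conjI ballI)
  show ?thesis
    by (rule bspec[OF assms(1)[unfolded volterra_stable_def, THEN spec[of _ N], THEN spec[of _ U], THEN spec[of _ r], THEN spec[of _ V],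
      THEN spec[of _ \<epsilon>], THEN mp, THEN mp, THEN mp, THEN mp, THEN mp, THEN mp, OF assms(2-5) V r] assms(11)])
qed

text \<open>The recursion runs on \<open>S n\<close>, which joins the modulus of \<open>Y\<close> at
  the mesh point to the accumulated memory. The maximum of |U| on the current cell occurs on both
  sides of the cell estimate and is absorbed for small \<open>h\<close>; the rest is discrete
  Gronwall.\<close>

lemma volterra_stability:
  assumes K: "regular_kernel T B K Ks" and T: "T > 0"
    and ka: "\<kappa> > 0" "\<And>t. t \<in> {0..T} \<Longrightarrow> \<bar>K t t\<bar> \<ge> \<kappa>"
  shows "\<exists>C\<ge>0. \<exists>h0>0. volterra_stable T k K Ks C h0"
proof -
  note B = regular_kernelD(1)[OF K]
  obtain C1 where C1: "C1 \<ge> 0" "orthogonal_step_bound k C1"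
    using orthogonal_step by blast
  define D where "D = (C1 + C1 * B + B + 2 * B * C1) / \<kappa>"
  define E where "E = B * C1 * (1 + 2 * B + B) / \<kappa> + 3 * B"
  \<comment> \<open>Arises by inserting the bound \<open>2 * D * (S n + \<epsilon>)\<close> for
    \<open>M n\<close> into the recursion for \<open>S\<close>.\<close>
  define F where "F = E + 2 * D * (E + 1)"
  \<comment> \<open>Guarantees both \<open>h <= 1\<close> and \<open>D * h <= 1 / 2\<close>; the
    second absorbs half of \<open>M n\<close> into the left side.\<close>
  define h0 where "h0 = 1 / (2 * D + 1)"
  define C where "C = 2 * D * (F * exp (F * T) + 1)"
  have D: "D \<ge> 0" "C1 / \<kappa> \<le> D" "C1 * B / \<kappa> + B / \<kappa> \<le> D" "2 * B * C1 / \<kappa> \<le> D"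
    using C1(1) B ka(1) by (auto simp: D_def add_divide_distrib[symmetric] intro!: divide_right_mono)
  have E: "E \<ge> 0" using C1(1) B ka(1) by (simp add: E_def)
  have F: "F \<ge> 0" using D E by (simp add: F_def)
  have C: "C \<ge> 0" using D F by (simp add: C_def)
  have h0: "h0 > 0" using D by (simp add: h0_def)
  have "\<forall>s\<in>{0..T}. \<bar>U s\<bar> \<le> C * \<epsilon> * real N"
    if N: "N > 0" and hN: "T / real N < h0" and U: "continuous_on {0..T} U" "U 0 = 0"
      and V: "\<forall>n<N. degree (V n) \<le> Suc k \<and> (\<forall>s\<in>{mesh_pt T N n..mesh_pt T N (Suc n)}. U s = poly (V n) s)"
      and r: "\<forall>n<N. continuous_on {mesh_pt T N n..mesh_pt T N (Suc n)} (r n) \<and>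
        (\<forall>s\<in>{mesh_pt T N n..mesh_pt T N (Suc n)}. \<bar>r n s\<bar> \<le> \<epsilon>) \<and>
        poly_orth k (mesh_pt T N n) (mesh_pt T N (Suc n)) (\<lambda>s. volterra_parts K Ks U s - r n s)"
    for N :: nat and U :: "real \<Rightarrow> real" and r :: "nat \<Rightarrow> real \<Rightarrow> real" and V :: "nat \<Rightarrow> real poly" and \<epsilon> :: real
  proof -
    let ?t = "mesh_pt T N"
    define h where "h = T / real N"
    have h: "h > 0" using T N by (simp add: h_def)
    have hD: "h * (2 * D + 1) < 1" using hN D by (simp add: h_def[symmetric] h0_def pos_less_divide_eq)
    have "h * 1 \<le> h * (2 * D + 1)" using D h by (intro mult_left_mono) auto
    then have h1: "h \<le> 1" using hD by simp
    have hD2: "D * h \<le> 1 / 2" using hD h by (simp add: algebra_simps)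
    have e0: "\<epsilon> \<ge> 0"
    proof -
      have "0 \<in> {?t 0..?t (Suc 0)}" using mesh_pt_nonneg[OF T] by simp
      then have "\<bar>r 0 0\<bar> \<le> \<epsilon>" using r N by blast
      then show ?thesis by linarith
    qed
    \<comment> \<open>The maximum is attained, so \<open>M n\<close> is itself a value of |U| and
      the cell estimate can be evaluated at that point.\<close>
    have "\<exists>x. x \<in> {?t n..?t (Suc n)} \<and> (\<forall>s\<in>{?t n..?t (Suc n)}. \<bar>U s\<bar> \<le> \<bar>U x\<bar>)" if "n < N" for n
    proof -
      have "continuous_on {?t n..?t (Suc n)} (\<lambda>s. \<bar>U s\<bar>)"
        by (intro continuous_on_rabs continuous_on_subset[OF U(1) mesh_cell_subset[OF T that]])
      moreover have "{?t n..?t (Suc n)} \<noteq> {}" using mesh_cell_nonempty[OF T N, of n] by auto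
      ultimately show ?thesis using continuous_attains_sup[OF compact_Icc, of "?t n" "?t (Suc n)" "\<lambda>s. \<bar>U s\<bar>"] by blast
    qed
    then obtain X where X: "\<And>n. n < N \<Longrightarrow> X n \<in> {?t n..?t (Suc n)}"
      "\<And>n s. n < N \<Longrightarrow> s \<in> {?t n..?t (Suc n)} \<Longrightarrow> \<bar>U s\<bar> \<le> \<bar>U (X n)\<bar>" by metis
    define M where "M = (\<lambda>n. \<bar>U (X n)\<bar>)"
    define Y where "Y = volterra_parts K Ks U"
    define Q where "Q = (\<lambda>n. \<Sum>j<n. M j * h)"
    define S where "S = (\<lambda>n. \<bar>Y (?t n)\<bar> + Q n)"
    have M0: "M n \<ge> 0" for n by (simp add: M_def)
    have Q0: "Q n \<ge> 0" for n unfolding Q_def using M0 h by (intro sum_nonneg mult_nonneg_nonneg) auto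
    have S0: "S n \<ge> 0" for n using Q0[of n] by (simp add: S_def)
    have step: "M n \<le> 2 * D * (S n + \<epsilon>) \<and> S (Suc n) \<le> (1 + F * h) * S n + F * \<epsilon>" if n: "n < N" for n
    proof -
      define \<eta> where "\<eta> = (\<epsilon> + (2 * B * h * M n + B * h * Q n)) / \<kappa>"
      have tI: "?t n \<in> {0..T}" using mesh_pt_nonneg[OF T] mesh_pt_le[OF T _ N] n by simp
      have Mb: "\<bar>U s\<bar> \<le> M j" if "j \<le> n" "s \<in> {?t j..?t (Suc j)}" for j s
        using X(2)[of j s] that n by (simp add: M_def)
      have Vn: "degree (V n) \<le> Suc k" "\<And>s. s \<in> {?t n..?t (Suc n)} \<Longrightarrow> U s = poly (V n) s" using V n by auto
      have rn: "continuous_on {?t n..?t (Suc n)} (r n)" "\<And>s. s \<in> {?t n..?t (Suc n)} \<Longrightarrow> \<bar>r n s\<bar> \<le> \<epsilon>"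
        "poly_orth k (?t n) (?t (Suc n)) (\<lambda>s. volterra_parts K Ks U s - r n s)" using r n by auto
      note cell = volterra_cell_estimate[OF K T U(1) n h_def h1 ka(1) ka(2)[OF tI] C1 Mb Vn rn Q_def[THEN fun_cong, of n] \<eta>_def Y_def]
      have "\<bar>U (X n)\<bar> \<le> C1 * (\<bar>Y (?t n)\<bar> / \<kappa> + \<eta>) + B * Q n / \<kappa>"
        by (rule cell(1)) (assumption | rule X(1)[OF n])+
      then have Mn: "M n \<le> C1 * (\<bar>Y (?t n)\<bar> / \<kappa> + \<eta>) + B * Q n / \<kappa>" by (simp only: M_def)
      have hQ: "h * Q n \<le> Q n" using h1 Q0[of n] h by (intro mult_left_le_one_le) auto
      have "C1 * (\<bar>Y (?t n)\<bar> / \<kappa> + \<eta>) + B * Q n / \<kappa>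
          = (C1 / \<kappa>) * \<bar>Y (?t n)\<bar> + (C1 / \<kappa>) * \<epsilon> + (2 * B * C1 / \<kappa>) * (h * M n) + (C1 * B / \<kappa>) * (h * Q n) + (B / \<kappa>) * Q n"
        using ka(1) by (simp add: \<eta>_def field_simps)
      also have "\<dots> \<le> (C1 / \<kappa>) * \<bar>Y (?t n)\<bar> + (C1 / \<kappa>) * \<epsilon> + (2 * B * C1 / \<kappa>) * (h * M n) + (C1 * B / \<kappa>) * Q n + (B / \<kappa>) * Q n"
        using hQ C1(1) B ka(1) by (intro add_mono mult_left_mono order_refl) auto
      also have "\<dots> = (C1 / \<kappa>) * \<bar>Y (?t n)\<bar> + (C1 / \<kappa>) * \<epsilon> + (2 * B * C1 / \<kappa>) * (h * M n) + (C1 * B / \<kappa> + B / \<kappa>) * Q n"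
        by (simp add: algebra_simps)
      also have "\<dots> \<le> D * \<bar>Y (?t n)\<bar> + D * \<epsilon> + D * (h * M n) + D * Q n"
        using D e0 h M0[of n] Q0[of n] by (intro add_mono mult_right_mono) auto
      also have "\<dots> = D * (S n + \<epsilon>) + (D * h) * M n" by (simp add: S_def algebra_simps)
      also have "\<dots> \<le> D * (S n + \<epsilon>) + 1 / 2 * M n" using hD2 M0[of n] by (intro add_left_mono mult_right_mono) auto
      finally have M1: "M n \<le> 2 * D * (S n + \<epsilon>)" using Mn by linarith
      have "\<bar>Y (?t (Suc n))\<bar> \<le> \<bar>Y (?t n)\<bar> + B * C1 * \<eta> + (2 * B * h * M n + B * h * Q n)" by (rule cell(2))
      also have "B * C1 * \<eta> = (B * C1 / \<kappa>) * \<epsilon> + (B * C1 * (2 * B) / \<kappa>) * (h * M n) + (B * C1 * B / \<kappa>) * (h * Q n)"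
        using ka(1) by (simp add: \<eta>_def field_simps)
      also have "\<bar>Y (?t n)\<bar> + ((B * C1 / \<kappa>) * \<epsilon> + (B * C1 * (2 * B) / \<kappa>) * (h * M n) + (B * C1 * B / \<kappa>) * (h * Q n))
          + (2 * B * h * M n + B * h * Q n)
        = \<bar>Y (?t n)\<bar> + (B * C1 / \<kappa>) * \<epsilon> + (B * C1 * (2 * B) / \<kappa> + 2 * B) * (h * M n) + (B * C1 * B / \<kappa> + B) * (h * Q n)"
        by (simp add: algebra_simps)
      also have "\<dots> \<le> \<bar>Y (?t n)\<bar> + E * \<epsilon> + E * (h * M n) + E * (h * Q n)"
      proof -
        have "E = B * C1 / \<kappa> + B * C1 * (2 * B) / \<kappa> + B * C1 * B / \<kappa> + 3 * B"
          by (simp add: E_def add_divide_distrib algebra_simps)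
        moreover have "0 \<le> B * C1 / \<kappa>" "0 \<le> B * C1 * (2 * B) / \<kappa>" "0 \<le> B * C1 * B / \<kappa>"
          using B C1(1) ka(1) by auto
        moreover have "a \<le> E \<and> b + 2 * B \<le> E \<and> c + B \<le> E"
          if "E = a + b + c + 3 * B" "0 \<le> a" "0 \<le> b" "0 \<le> c" for a b c using that B by linarith
        ultimately have "B * C1 / \<kappa> \<le> E" "B * C1 * (2 * B) / \<kappa> + 2 * B \<le> E" "B * C1 * B / \<kappa> + B \<le> E"
          by blast+
        then show ?thesis using e0 h M0[of n] Q0[of n] by (intro add_mono mult_right_mono order_refl) auto
      qed
      finally have Y1: "\<bar>Y (?t (Suc n))\<bar> \<le> \<bar>Y (?t n)\<bar> + E * \<epsilon> + E * (h * M n) + E * (h * Q n)" .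
      have "S (Suc n) = \<bar>Y (?t (Suc n))\<bar> + Q n + h * M n" by (simp add: S_def Q_def)
      also have "\<dots> \<le> S n + E * \<epsilon> + (E + 1) * (h * M n) + E * (h * Q n)"
        using Y1 by (simp add: S_def algebra_simps)
      also have "\<dots> \<le> S n + E * \<epsilon> + (E + 1) * (h * (2 * D * (S n + \<epsilon>))) + E * (h * S n)"
        using M1 E h Q0[of n] by (intro add_mono mult_left_mono order_refl) (auto simp: S_def)
      also have "\<dots> = (1 + F * h) * S n + E * \<epsilon> + (2 * D * (E + 1)) * (h * \<epsilon>)"
        by (simp add: F_def algebra_simps)
      also have "\<dots> \<le> (1 + F * h) * S n + E * \<epsilon> + (2 * D * (E + 1)) * \<epsilon>"
        using D E e0 h h1 by (intro add_left_mono mult_left_mono mult_left_le_one_le) auto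
      also have "\<dots> = (1 + F * h) * S n + F * \<epsilon>" by (simp add: F_def algebra_simps)
      finally show ?thesis using M1 by blast
    qed
    have S00: "S 0 \<le> 0" by (simp add: S_def Y_def Q_def volterra_parts_def U(2))
    have Sn: "S n \<le> real N * (F * \<epsilon>) * exp (F * T)" if n: "n \<le> N" for n
    proof -
      have "S n \<le> real n * (F * \<epsilon>) * exp (F * h * real n)"
        by (rule discrete_gronwall[of "F * h" "F * \<epsilon>" S N, OF _ _ S00 _ n]) (use F h e0 step in auto)
      also have "\<dots> \<le> real N * (F * \<epsilon>) * exp (F * T)"
      proof (rule mult_mono)
        have "h * real n \<le> T" using mesh_pt_le[OF T n N] by (simp add: mesh_pt_def h_def mult.commute)
        then show "exp (F * h * real n) \<le> exp (F * T)" using F by (simp add: mult.assoc mult_left_mono)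
        show "real n * (F * \<epsilon>) \<le> real N * (F * \<epsilon>)" using n F e0 by (intro mult_right_mono) auto
      qed (use F e0 in auto)
      finally show ?thesis .
    qed
    show ?thesis
    proof
      fix s assume s: "s \<in> {0..T}"
      obtain n where n: "n < N" "s \<in> {?t n..?t (Suc n)}" using mesh_cell_exists[OF T N s] .
      have "\<bar>U s\<bar> \<le> M n" using X(2)[OF n] by (simp add: M_def)
      also have "\<dots> \<le> 2 * D * (S n + \<epsilon>)" using step[OF n(1)] by blast
      also have "\<dots> \<le> 2 * D * (real N * (F * \<epsilon>) * exp (F * T) + real N * \<epsilon>)"
      proof (intro mult_left_mono add_mono Sn)
        have "1 * \<epsilon> \<le> real N * \<epsilon>" using N e0 by (intro mult_right_mono) auto
        then show "\<epsilon> \<le> real N * \<epsilon>" by simp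
      qed (use D n in auto)
      also have "\<dots> = C * \<epsilon> * real N" by (simp add: C_def algebra_simps)
      finally show "\<bar>U s\<bar> \<le> C * \<epsilon> * real N" .
    qed
  qed
  then have "volterra_stable T k K Ks C h0" unfolding volterra_stable_def by (intro allI impI)
  then show ?thesis using C h0 by blast 
qed

section \<open>Orthogonal interpolation of a primitive\<close>

lemma Ck_on_derivative_sequence:
  fixes f :: "real \<Rightarrow> real"
  assumes "Ck_on n S f"
  obtains D where "D 0 = f" "\<And>i t. i < n \<Longrightarrow> t \<in> S \<Longrightarrow> (D i has_real_derivative D (Suc i) t) (at t within S)"
    "\<And>i. i \<le> n \<Longrightarrow> continuous_on S (D i)"
proof -
  have "\<exists>D. D 0 = f \<and> (\<forall>i<n. \<forall>t\<in>S. (D i has_real_derivative D (Suc i) t) (at t within S)) \<and>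
      (\<forall>i\<le>n. continuous_on S (D i))"
    using assms
  proof (induction n arbitrary: f)
    case 0
    then show ?case by (intro exI[of _ "\<lambda>_. f"]) simp
  next
    case (Suc n)
    obtain g where g: "\<And>x. x \<in> S \<Longrightarrow> (f has_real_derivative g x) (at x within S)" "Ck_on n S g"
      by (rule Ck_on_Suc_realE[OF Suc.prems]) blast
    obtain D where D: "D 0 = g" "\<forall>i<n. \<forall>t\<in>S. (D i has_real_derivative D (Suc i) t) (at t within S)"
      "\<forall>i\<le>n. continuous_on S (D i)" using Suc.IH[OF g(2)] by (elim exE conjE) (rule that)
    let ?D = "case_nat f D"
    have "(?D i has_real_derivative ?D (Suc i) t) (at t within S)" if "i < Suc n" "t \<in> S" for i t
      using that g(1) D by (cases i) auto
    moreover have "continuous_on S (?D i)" if "i \<le> Suc n" for i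
      using that D Ck_on_imp_continuous_on[OF Suc.prems] by (cases i) auto
    ultimately show ?case by (intro exI[of _ ?D]) simp
  qed
  then obtain D where D: "D 0 = f" "\<forall>i<n. \<forall>t\<in>S. (D i has_real_derivative D (Suc i) t) (at t within S)"
    "\<forall>i\<le>n. continuous_on S (D i)" by (elim exE conjE) (rule that)
  show ?thesis by (rule that[of D]) (use D in simp_all)
qed

section \<open>Taylor expansion with one-sided derivatives\<close>

lemma real_mean_value_bound:
  fixes f :: "real \<Rightarrow> real"
  assumes "\<And>x. x \<in> {a..b} \<Longrightarrow> (f has_real_derivative f' x) (at x within {a..b})"
    "\<And>x. x \<in> {a..b} \<Longrightarrow> \<bar>f' x\<bar> \<le> B" "a \<le> b"
  shows "\<bar>f b - f a\<bar> \<le> B * (b - a)"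
proof -
  have "norm (f b - f a) \<le> B * norm (b - a)"
    by (rule field_differentiable_bound[OF convex_real_interval(5) assms(1)]) (use assms in auto)
  then show ?thesis using assms(3) by simp
qed

text \<open>\<open>D\<close> is a sequence of successive derivatives and \<open>n\<close> the number
  of terms, so that \<open>n - 1\<close> is the highest power. Differentiation becomes a shift of
  the sequence.\<close>

definition taylor_poly :: "(nat \<Rightarrow> real \<Rightarrow> real) \<Rightarrow> real \<Rightarrow> nat \<Rightarrow> real poly" where
  "taylor_poly D a n = (\<Sum>i<n. smult (D i a / fact i) ([:- a, 1:] ^ i))"

lemma taylor_poly_Suc: "taylor_poly D a (Suc n) = taylor_poly D a n + smult (D n a / fact n) ([:- a, 1:] ^ n)"
  by (simp add: taylor_poly_def)

lemma pderiv_shifted_power: "pderiv ([:- a, 1:] ^ Suc n) = smult (real (Suc n)) ([:- a, 1:] ^ n)"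
  unfolding pderiv_power_Suc by (simp add: pderiv_pCons del: of_nat_Suc)

lemma pderiv_taylor_poly: "pderiv (taylor_poly D a (Suc n)) = taylor_poly (\<lambda>i. D (Suc i)) a n"
proof (induction n)
  case 0
  show ?case by (simp add: taylor_poly_def)
next
  case (Suc n)
  have d: "pderiv (smult (D (Suc n) a / fact (Suc n)) ([:- a, 1:] ^ Suc n)) = smult (D (Suc n) a / fact n) ([:- a, 1:] ^ n)"
    unfolding pderiv_smult pderiv_shifted_power smult_smult by (simp add: field_simps del: of_nat_Suc)
  show ?case by (simp only: taylor_poly_Suc[of D a "Suc n"] pderiv_add Suc d taylor_poly_Suc[of "\<lambda>i. D (Suc i)"])
qed

lemma degree_taylor_poly: "degree (taylor_poly D a (Suc n)) \<le> n"
  unfolding taylor_poly_def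
proof (rule degree_sum_le)
  fix i assume "i \<in> {..<Suc n}"
  then have "degree ([:- a, 1:] ^ i) \<le> n" using degree_power_le[of "[:- a, 1:]" i] by simp
  then show "degree (smult (D i a / fact i) ([:- a, 1:] ^ i)) \<le> n" using degree_smult_le order_trans by blast
qed simp

lemma taylor_poly_center: "poly (taylor_poly D a (Suc n)) a = D 0 a"
  by (induction n) (simp_all add: taylor_poly_Suc, simp add: taylor_poly_def)

text \<open>The derivative of the remainder is the remainder of the shifted sequence, and the mean
  value inequality adds one power. The factorial of the classical bound is given up.\<close>

lemma taylor_remainder_bound:
  assumes "\<And>i t. i < p \<Longrightarrow> t \<in> {0..T} \<Longrightarrow> (D i has_real_derivative D (Suc i) t) (at t within {0..T})"
    "\<And>t. t \<in> {0..T} \<Longrightarrow> \<bar>D p t\<bar> \<le> \<beta>" "0 \<le> a" "a \<le> s" "s \<le> T"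
  shows "\<bar>D 0 s - poly (taylor_poly D a p) s\<bar> \<le> \<beta> * (s - a) ^ p"
  using assms
proof (induction p arbitrary: D s)
  case 0
  then show ?case by (simp add: taylor_poly_def)
next
  case (Suc p)
  have \<beta>: "\<beta> \<ge> 0" using Suc.prems(2)[of s] Suc.prems(3-5) by force
  let ?f = "\<lambda>s. D 0 s - poly (taylor_poly D a (Suc p)) s"
  have "\<bar>?f s - ?f a\<bar> \<le> (\<beta> * (s - a) ^ p) * (s - a)"
  proof (rule real_mean_value_bound)
    fix x assume x: "x \<in> {a..s}"
    have "(D 0 has_real_derivative D (Suc 0) x) (at x within {a..s})"
      by (rule DERIV_subset[OF Suc.prems(1)]) (use x Suc.prems(3-5) in auto)
    then show "(?f has_real_derivative D (Suc 0) x - poly (taylor_poly (\<lambda>i. D (Suc i)) a p) x) (at x within {a..s})"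
      unfolding pderiv_taylor_poly[symmetric]
      by (intro DERIV_diff) (auto intro: DERIV_subset[OF poly_DERIV])
    have "\<bar>D (Suc 0) x - poly (taylor_poly (\<lambda>i. D (Suc i)) a p) x\<bar> \<le> \<beta> * (x - a) ^ p"
      by (rule Suc.IH[of "\<lambda>i. D (Suc i)"]) (use Suc.prems x in auto)
    also have "\<dots> \<le> \<beta> * (s - a) ^ p" using x \<beta> by (intro mult_left_mono power_mono) auto
    finally show "\<bar>D (Suc 0) x - poly (taylor_poly (\<lambda>i. D (Suc i)) a p) x\<bar> \<le> \<beta> * (s - a) ^ p" .
  qed (use Suc.prems in simp)
  then show ?case by (simp add: taylor_poly_center mult_ac)
qed

text \<open>The DG problem with kernel \<open>1\<close>, written for the primitive: continuity at
  mesh points takes the place of the integral over earlier cells. The pieces are constrained only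
  for indices below \<open>N\<close>.\<close>

definition orthogonal_interpolant :: "real \<Rightarrow> nat \<Rightarrow> nat \<Rightarrow> (real \<Rightarrow> real) \<Rightarrow> (nat \<Rightarrow> real poly) \<Rightarrow> bool" where
  "orthogonal_interpolant T N k X V \<longleftrightarrow>
     (\<forall>n<N. degree (V n) \<le> Suc k \<and> poly_orth k (mesh_pt T N n) (mesh_pt T N (Suc n)) (\<lambda>s. poly (V n) s - X s)) \<and>
     poly (V 0) 0 = 0 \<and>
     (\<forall>n. Suc n < N \<longrightarrow> poly (V (Suc n)) (mesh_pt T N (Suc n)) = poly (V n) (mesh_pt T N (Suc n)))"

lemma orthogonal_interpolant_exists:
  assumes T: "T > 0" and N: "N > 0" and X: "continuous_on {0..T} X"
  obtains V where "orthogonal_interpolant T N k X V"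
proof -
  let ?P = "\<lambda>n p. (n < N \<longrightarrow> degree p \<le> Suc k \<and>
    poly_orth k (mesh_pt T N n) (mesh_pt T N (Suc n)) (\<lambda>s. poly p s - X s)) \<and> (n = 0 \<longrightarrow> poly p 0 = 0)"
  let ?Q = "\<lambda>n p p'. Suc n < N \<longrightarrow> poly p' (mesh_pt T N (Suc n)) = poly p (mesh_pt T N (Suc n))"
  have ex: "\<exists>p. degree p \<le> Suc k \<and> poly p (mesh_pt T N n) = y \<and>
      poly_orth k (mesh_pt T N n) (mesh_pt T N (Suc n)) (\<lambda>s. poly p s - X s)" if "n < N" for n y
    by (rule orthogonal_extension[OF mesh_cell_nonempty[OF T N] continuous_on_subset[OF X mesh_cell_subset[OF T that]]])
  have "\<exists>V. \<forall>n. ?P n (V n) \<and> ?Q n (V n) (V (Suc n))"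
  proof (rule dependent_nat_choice)
    show "\<exists>p. ?P 0 p" using ex[OF N, of 0] by auto
    show "\<exists>p'. ?P (Suc n) p' \<and> ?Q n p p'" if "?P n p" for p n
      using ex[of "Suc n" "poly p (mesh_pt T N (Suc n))"] by (cases "Suc n < N") auto
  qed
  then obtain V where V: "\<forall>n. ?P n (V n) \<and> ?Q n (V n) (V (Suc n))" by (elim exE)
  show ?thesis by (rule that[of V]) (use V N in \<open>auto simp: orthogonal_interpolant_def\<close>)
qed

text \<open>On each cell \<open>X\<close> is a polynomial of admissible degree plus a leading error
  plus a remainder. The factor \<open>h ^ (k + 2)\<close> measures \<gamma> by its contribution to
  \<open>X\<close>. One estimate thus serves both parities, with \<open>\<rho> = k + 1\<close> and a
  leading term, or \<open>\<rho> = k\<close> and none.\<close>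

definition local_expansion :: "real \<Rightarrow> nat \<Rightarrow> nat \<Rightarrow> nat \<Rightarrow> real \<Rightarrow> real \<Rightarrow>
    (real \<Rightarrow> real) \<Rightarrow> (real \<Rightarrow> real) \<Rightarrow> (nat \<Rightarrow> real poly) \<Rightarrow> (nat \<Rightarrow> real) \<Rightarrow> bool" where
  "local_expansion T N k \<rho> \<beta> h X x Tp \<gamma> \<longleftrightarrow>
    (\<forall>n<N. degree (Tp n) \<le> Suc k \<and> \<bar>\<gamma> n\<bar> * h ^ (k + 2) \<le> \<beta> * h ^ (\<rho> + 1) \<and>
      (\<forall>s\<in>{mesh_pt T N n..mesh_pt T N (Suc n)}.
         \<bar>X s - poly (Tp n) s - \<gamma> n * (s - mesh_pt T N n) ^ (k + 2)\<bar> \<le> \<beta> * h ^ (\<rho> + 2) \<and>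
         \<bar>x s - poly (pderiv (Tp n)) s - \<gamma> n * (real (k + 2) * (s - mesh_pt T N n) ^ (k + 1))\<bar> \<le> \<beta> * h ^ (\<rho> + 1))) \<and>
    (\<forall>n. Suc n < N \<longrightarrow> \<bar>\<gamma> (Suc n) - \<gamma> n\<bar> * h ^ (k + 2) \<le> \<beta> * h ^ (\<rho> + 2)) \<and>
    (even k \<or> (\<forall>n. \<gamma> n = 0))"

text \<open>Here \<open>\<gamma> n\<close> is the leading coefficient of the local error and \<open>q n\<close> the orthogonal polynomial of
  degree \<open>k + 2\<close>. For odd \<open>k + 2\<close> the endpoint values of \<open>q n\<close> have opposite signs, so the recursion
  for \<open>p n = V n - T n - \<gamma> n (Z n - q n)\<close> has no cancellation unless \<open>\<gamma> = 0\<close>.\<close>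

lemma orthogonal_interpolant_estimate:
  assumes T: "T > 0" and \<beta>: "\<beta> \<ge> 0"
  shows "\<exists>C\<ge>0. \<forall>N X x V Tp \<gamma> h. N > 0 \<longrightarrow> h = T / real N \<longrightarrow> X 0 = 0 \<longrightarrow>
    continuous_on {0..T} X \<longrightarrow> orthogonal_interpolant T N k X V \<longrightarrow> local_expansion T N k \<rho> \<beta> h X x Tp \<gamma> \<longrightarrow>
    (\<forall>n<N. \<forall>s\<in>{mesh_pt T N n..mesh_pt T N (Suc n)}.
       \<bar>poly (V n) s - X s\<bar> \<le> C * h ^ (\<rho> + 1) \<and> \<bar>poly (pderiv (V n)) s - x s\<bar> \<le> C * h ^ \<rho>)"
proof -
  obtain C1 where C1: "C1 \<ge> 0" "orthogonal_step_bound k C1"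
    using orthogonal_step by blast
  obtain C2 where C2: "C2 \<ge> 0" "\<forall>a b (p::real poly) M. a < b \<longrightarrow> degree p \<le> k + 2 \<longrightarrow> (\<forall>s\<in>{a..b}. \<bar>poly p s\<bar> \<le> M) \<longrightarrow>
     (\<forall>s\<in>{a..b}. \<bar>poly (pderiv p) s\<bar> \<le> C2 * M / (b - a))"
    using poly_markov_inequality[of "k + 2"] by (elim exE conjE) (rule that)
  obtain Qb q0 where Qb: "Qb \<ge> 0" and q0: "\<forall>a b. a < b \<longrightarrow>
     (\<exists>q::real poly. degree q = Suc (Suc k) \<and> lead_coeff q = 1 \<and> poly_orth (Suc k) a b (poly q) \<and>
        poly q a = (b - a) ^ Suc (Suc k) * q0 \<and> poly q b = (- 1) ^ Suc (Suc k) * ((b - a) ^ Suc (Suc k) * q0) \<and>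
        (\<forall>s\<in>{a..b}. \<bar>poly q s\<bar> \<le> (b - a) ^ Suc (Suc k) * Qb))"
    using scaled_orthogonal_poly[of "Suc k"] by (elim exE conjE) (rule that)
  \<comment> \<open>The error per cell in units of \<open>h ^ (\<rho> + 2)\<close>: the response to
    the remainder, the jump of the leading coefficient, and the remainders on the two sides of a
    mesh point.\<close>
  define c where "c = C1 * \<beta> + \<beta> * \<bar>q0\<bar> + 2 * \<beta>"
  define z0 where "z0 = \<beta> * \<bar>q0\<bar> + \<beta> * T + c * T"
  define P where "P = C1 * (z0 + \<beta> * T)"
  define C where "C = (P + \<beta> * Qb + \<beta> * T) + (C2 * P + C2 * (\<beta> * Qb) + \<beta> * T)"
  have c: "c \<ge> 0" using C1(1) \<beta> by (simp add: c_def)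
  have z0: "z0 \<ge> 0" using c \<beta> T by (simp add: z0_def)
  have P: "P \<ge> 0" using C1(1) \<beta> z0 T by (simp add: P_def)
  have C: "C \<ge> 0" "P + \<beta> * Qb + \<beta> * T \<le> C" "C2 * P + C2 * (\<beta> * Qb) + \<beta> * T \<le> C"
    using P \<beta> Qb T C2(1) by (simp_all add: C_def)
  have main: "\<bar>poly (V n) s - X s\<bar> \<le> C * h ^ (\<rho> + 1) \<and> \<bar>poly (pderiv (V n)) s - x s\<bar> \<le> C * h ^ \<rho>"
    if N: "N > 0" and hdef: "h = T / real N" and X0: "X 0 = 0"
      and cX0: "continuous_on {0..T} X" and V': "orthogonal_interpolant T N k X V"
      and ex: "local_expansion T N k \<rho> \<beta> h X x Tp \<gamma>"
      and n: "n < N" and s: "s \<in> {mesh_pt T N n..mesh_pt T N (Suc n)}"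
    for N n :: nat and X x :: "real \<Rightarrow> real" and V Tp :: "nat \<Rightarrow> real poly" and \<gamma> :: "nat \<Rightarrow> real" and h s :: real
  proof -
    have cX: "\<forall>n<N. continuous_on {mesh_pt T N n..mesh_pt T N (Suc n)} X"
      using continuous_on_subset[OF cX0 mesh_cell_subset[OF T]] by blast
    note V = V'[unfolded orthogonal_interpolant_def, THEN conjunct1]
      and V0 = V'[unfolded orthogonal_interpolant_def, THEN conjunct2, THEN conjunct1]
      and VS = V'[unfolded orthogonal_interpolant_def, THEN conjunct2, THEN conjunct2]
    note Tp = ex[unfolded local_expansion_def, THEN conjunct1]
      and \<gamma> = ex[unfolded local_expansion_def, THEN conjunct2, THEN conjunct1]
      and ev = ex[unfolded local_expansion_def, THEN conjunct2, THEN conjunct2]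
    let ?t = "mesh_pt T N"
    have tS: "?t (Suc n) = ?t n + h" for n by (simp add: mesh_pt_Suc hdef)
    have h: "h > 0" using T N by (simp add: hdef)
    have hT: "h \<le> T" using N T by (simp add: hdef field_simps)
    have lt: "?t n < ?t (Suc n)" for n using h by (simp add: tS)
    have "\<exists>q::real poly. degree q = Suc (Suc k) \<and> lead_coeff q = 1 \<and> poly_orth (Suc k) (?t n) (?t (Suc n)) (poly q) \<and>
        poly q (?t n) = h ^ Suc (Suc k) * q0 \<and> poly q (?t (Suc n)) = (- 1) ^ Suc (Suc k) * (h ^ Suc (Suc k) * q0) \<and>
        (\<forall>s\<in>{?t n..?t (Suc n)}. \<bar>poly q s\<bar> \<le> h ^ Suc (Suc k) * Qb)" for n
      using q0[rule_format, OF lt[of n]] by (simp only: tS add_diff_cancel_left')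
    then obtain q :: "nat \<Rightarrow> real poly" where q: "\<And>n. degree (q n) = Suc (Suc k)" "\<And>n. lead_coeff (q n) = 1"
      "\<And>n. poly_orth (Suc k) (?t n) (?t (Suc n)) (poly (q n))"
      "\<And>n. poly (q n) (?t n) = h ^ Suc (Suc k) * q0"
      "\<And>n. poly (q n) (?t (Suc n)) = (- 1) ^ Suc (Suc k) * (h ^ Suc (Suc k) * q0)"
      "\<And>n s. s \<in> {?t n..?t (Suc n)} \<Longrightarrow> \<bar>poly (q n) s\<bar> \<le> h ^ Suc (Suc k) * Qb"
      by metis
    define Z where "Z = (\<lambda>n. [:- ?t n, 1:] ^ (k + 2))"
    have degZ: "degree (Z n) = Suc (Suc k)" for n by (simp add: Z_def degree_power_eq del: power_Suc)
    have lcZ: "coeff (Z n) (Suc (Suc k)) = 1" for n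
      using degZ[of n] lead_coeff_power[of "[:- ?t n, 1:]" "k + 2"] by (simp add: Z_def)
    have pZ: "poly (Z n) s = (s - ?t n) ^ (k + 2)" for n s unfolding Z_def poly_power by simp
    have dZ: "poly (pderiv (Z n)) s = real (k + 2) * (s - ?t n) ^ (k + 1)" for n s
      using pderiv_shifted_power[of "?t n" "k + 1"] by (simp add: Z_def poly_power del: power_Suc)
    have degd: "degree (Z n - q n) \<le> Suc k" for n
      using degree_diff_monic_le[of "Z n" "Suc k" "q n"] degZ[of n] lcZ[of n] q(1,2)[of n] by simp
    \<comment> \<open>Both \<open>Z n\<close> and \<open>q n\<close> are monic, so their difference
      has admissible degree. Putting it in place of \<open>Z n\<close> leaves over a multiple of
      \<open>q n\<close>, which no test function sees; \<open>p n\<close> has to follow the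
      remainder \<open>R n\<close> alone.\<close>
    define p where "p = (\<lambda>n. V n - Tp n - smult (\<gamma> n) (Z n - q n))"
    have degp: "degree (p n) \<le> Suc k" if "n < N" for n
      unfolding p_def by (intro degree_diff_le order_trans[OF degree_smult_le degd]) (use V Tp that in auto)
    define R where "R = (\<lambda>n s. X s - poly (Tp n) s - \<gamma> n * (s - ?t n) ^ (k + 2))"
    have Rb: "\<bar>R n s\<bar> \<le> \<beta> * h ^ (\<rho> + 2)" if "n < N" "s \<in> {?t n..?t (Suc n)}" for n s
      using Tp that unfolding R_def by blast
    have cR: "continuous_on {?t n..?t (Suc n)} (R n)" if "n < N" for n
      unfolding R_def using cX that
      by (intro continuous_on_diff continuous_on_mult continuous_on_power continuous_on_id continuous_on_const continuous_on_poly_real) auto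
    have split: "poly (V n) s - X s = poly (p n) s - \<gamma> n * poly (q n) s - R n s" for n s
      unfolding p_def R_def poly_diff poly_smult pZ right_diff_distrib by linarith
    have orth: "poly_orth k (?t n) (?t (Suc n)) (\<lambda>s. poly (p n) s - R n s)" if n: "n < N" for n
    proof -
      have "poly_orth k (?t n) (?t (Suc n)) (\<lambda>s. (poly (V n) s - X s) + \<gamma> n * poly (q n) s)"
        by (rule poly_orth_add[OF _ _ _ poly_orth_cmult[OF poly_orth_mono[OF q(3)]]])
          (use V cX n in \<open>auto intro!: continuous_on_diff continuous_on_mult continuous_on_const continuous_on_poly_real\<close>)
      then show ?thesis by (rule poly_orth_cong) (simp add: split)
    qed
    have stp: "\<And>s. s \<in> {?t n..?t (Suc n)} \<Longrightarrow> \<bar>poly (p n) s\<bar> \<le> C1 * (\<bar>poly (p n) (?t n)\<bar> + \<beta> * h ^ (\<rho> + 2))"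
        "\<bar>poly (p n) (?t (Suc n))\<bar> \<le> \<bar>poly (p n) (?t n)\<bar> + C1 * (\<beta> * h ^ (\<rho> + 2))" if n: "n < N" for n
      using orthogonal_step_boundD[OF C1(2) lt degp[OF n] cR[OF n] Rb[OF n] orth[OF n]] by simp_all
    have zb: "\<bar>poly (p n) (?t n)\<bar> \<le> (\<beta> * \<bar>q0\<bar> + \<beta> * h) * h ^ (\<rho> + 1) + real n * (c * h ^ (\<rho> + 2))" if "n < N" for n
      using that
    proof (induction n)
      case 0
      have "poly (p 0) 0 = \<gamma> 0 * (h ^ (k + 2) * q0) + R 0 0"
        using split[of 0 0] q(4)[of 0] by (simp add: X0 V0)
      then have "\<bar>poly (p 0) 0\<bar> \<le> (\<bar>\<gamma> 0\<bar> * h ^ (k + 2)) * \<bar>q0\<bar> + \<bar>R 0 0\<bar>"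
        using h abs_triangle_ineq[of "\<gamma> 0 * (h ^ (k + 2) * q0)" "R 0 0"] by (simp add: abs_mult mult.assoc)
      also have "\<dots> \<le> (\<beta> * h ^ (\<rho> + 1)) * \<bar>q0\<bar> + \<beta> * h ^ (\<rho> + 2)"
        using Tp 0 Rb[of 0 0] h by (intro add_mono mult_right_mono) (auto simp: tS)
      also have "\<dots> = (\<beta> * \<bar>q0\<bar> + \<beta> * h) * h ^ (\<rho> + 1)" by (simp add: algebra_simps)
      finally show ?case by simp
    next
      case (Suc n)
      let ?s = "?t (Suc n)"
      have nN: "n < N" using Suc.prems by simp
      \<comment> \<open>Parity enters here. For even \<open>k\<close> the values of
        \<open>q n\<close> at the two ends agree, so only the difference of neighbouring \<gamma> is
        left; for odd \<open>k\<close> all \<gamma> are zero.\<close>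
      have jump: "poly (p (Suc n)) ?s - poly (p n) ?s = (\<gamma> (Suc n) - \<gamma> n) * (h ^ (k + 2) * q0) + R (Suc n) ?s - R n ?s"
      proof -
        have "\<gamma> n * poly (q n) ?s = \<gamma> n * (h ^ (k + 2) * q0)" using ev q(5)[of n] by auto
        then have "poly (V n) ?s - X ?s = poly (p n) ?s - \<gamma> n * (h ^ (k + 2) * q0) - R n ?s"
          using split[of n ?s] by (simp only:)
        moreover have "poly (q (Suc n)) ?s = h ^ (k + 2) * q0" using q(4)[of "Suc n"] by simp
        then have "poly (V (Suc n)) ?s - X ?s = poly (p (Suc n)) ?s - \<gamma> (Suc n) * (h ^ (k + 2) * q0) - R (Suc n) ?s"
          using split[of "Suc n" ?s] by (simp only:)
        moreover have "poly (V (Suc n)) ?s = poly (V n) ?s" using VS Suc.prems by blast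
        ultimately show ?thesis unfolding left_diff_distrib by linarith
      qed
      have g: "\<bar>(\<gamma> (Suc n) - \<gamma> n) * (h ^ (k + 2) * q0)\<bar> \<le> (\<beta> * h ^ (\<rho> + 2)) * \<bar>q0\<bar>"
      proof -
        have "\<bar>(\<gamma> (Suc n) - \<gamma> n) * (h ^ (k + 2) * q0)\<bar> = (\<bar>\<gamma> (Suc n) - \<gamma> n\<bar> * h ^ (k + 2)) * \<bar>q0\<bar>"
          using h by (simp add: abs_mult mult.assoc)
        also have "\<dots> \<le> (\<beta> * h ^ (\<rho> + 2)) * \<bar>q0\<bar>" using \<gamma> Suc.prems by (intro mult_right_mono) auto
        finally show ?thesis .
      qed
      have "\<bar>R (Suc n) ?s\<bar> \<le> \<beta> * h ^ (\<rho> + 2)" "\<bar>R n ?s\<bar> \<le> \<beta> * h ^ (\<rho> + 2)"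
        using Rb[OF Suc.prems, of ?s] Rb[OF nN, of ?s] lt[of n] lt[of "Suc n"] by auto
      moreover have "\<bar>poly (p n) ?s\<bar> \<le> \<bar>poly (p n) (?t n)\<bar> + C1 * (\<beta> * h ^ (\<rho> + 2))" by (rule stp(2)[OF nN])
      ultimately have "\<bar>poly (p (Suc n)) ?s\<bar> \<le> \<bar>poly (p n) (?t n)\<bar> + C1 * (\<beta> * h ^ (\<rho> + 2))
          + (\<beta> * h ^ (\<rho> + 2)) * \<bar>q0\<bar> + \<beta> * h ^ (\<rho> + 2) + \<beta> * h ^ (\<rho> + 2)"
        using jump g by linarith
      also have "\<dots> = \<bar>poly (p n) (?t n)\<bar> + c * h ^ (\<rho> + 2)" by (simp add: c_def algebra_simps)
      finally show ?case using Suc.IH[OF nN] by (simp add: algebra_simps)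
    qed
    have hpow: "h ^ (\<rho> + 2) \<le> T * h ^ (\<rho> + 1)" "h ^ (\<rho> + 1) \<le> T * h ^ \<rho>"
      using hT h by (auto intro!: mult_right_mono)
    \<comment> \<open>Summation over the cells turns \<open>h ^ (\<rho> + 2)\<close> into
      \<open>h ^ (\<rho> + 1)\<close>; the initial value, caused by the leading error on the first
      cell, is of that order from the start.\<close>
    have z: "\<bar>poly (p n) (?t n)\<bar> \<le> z0 * h ^ (\<rho> + 1)"
    proof -
      have "real n * h \<le> T" using mesh_pt_le[OF T _ N, of n] n by (simp add: mesh_pt_def hdef)
      then have "(real n * h) * (c * h ^ (\<rho> + 1)) \<le> T * (c * h ^ (\<rho> + 1))" using c h by (intro mult_right_mono) auto
      then have "real n * (c * h ^ (\<rho> + 2)) \<le> (c * T) * h ^ (\<rho> + 1)" by (simp add: algebra_simps)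
      moreover have "(\<beta> * \<bar>q0\<bar> + \<beta> * h) * h ^ (\<rho> + 1) \<le> (\<beta> * \<bar>q0\<bar> + \<beta> * T) * h ^ (\<rho> + 1)"
        using \<beta> hT h by (intro mult_right_mono add_left_mono mult_left_mono) auto
      moreover have "z0 * h ^ (\<rho> + 1) = (\<beta> * \<bar>q0\<bar> + \<beta> * T) * h ^ (\<rho> + 1) + (c * T) * h ^ (\<rho> + 1)"
        by (simp add: z0_def algebra_simps)
      ultimately show ?thesis using zb[OF n] by linarith
    qed
    have pb: "\<bar>poly (p n) s\<bar> \<le> P * h ^ (\<rho> + 1)" if s: "s \<in> {?t n..?t (Suc n)}" for s
    proof -
      have "\<bar>poly (p n) s\<bar> \<le> C1 * (\<bar>poly (p n) (?t n)\<bar> + \<beta> * h ^ (\<rho> + 2))" by (rule stp(1)[OF n s])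
      also have "\<dots> \<le> C1 * (z0 * h ^ (\<rho> + 1) + \<beta> * (T * h ^ (\<rho> + 1)))"
        using C1(1) z \<beta> hpow by (intro mult_left_mono add_mono) auto
      also have "\<dots> = P * h ^ (\<rho> + 1)" by (simp add: P_def algebra_simps)
      finally show ?thesis .
    qed
    have qb: "\<bar>\<gamma> n * poly (q n) s\<bar> \<le> (\<beta> * Qb) * h ^ (\<rho> + 1)" if s: "s \<in> {?t n..?t (Suc n)}" for s
    proof -
      have "\<bar>\<gamma> n * poly (q n) s\<bar> \<le> \<bar>\<gamma> n\<bar> * (h ^ (k + 2) * Qb)"
        unfolding abs_mult using q(6)[OF s] by (intro mult_left_mono) auto
      also have "\<dots> = (\<bar>\<gamma> n\<bar> * h ^ (k + 2)) * Qb" by simp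
      also have "\<dots> \<le> (\<beta> * h ^ (\<rho> + 1)) * Qb" using Tp n Qb by (intro mult_right_mono) auto
      finally show ?thesis by (simp add: mult_ac)
    qed
    have "\<bar>poly (V n) s - X s\<bar> \<le> P * h ^ (\<rho> + 1) + (\<beta> * Qb) * h ^ (\<rho> + 1) + \<beta> * h ^ (\<rho> + 2)"
      unfolding split using pb[OF s] qb[OF s] Rb[OF n s] by linarith
    also have "\<dots> \<le> P * h ^ (\<rho> + 1) + (\<beta> * Qb) * h ^ (\<rho> + 1) + \<beta> * (T * h ^ (\<rho> + 1))"
      using \<beta> hpow by (intro add_left_mono mult_left_mono) auto
    also have "\<dots> = (P + \<beta> * Qb + \<beta> * T) * h ^ (\<rho> + 1)" by (simp add: algebra_simps)
    also have "\<dots> \<le> C * h ^ (\<rho> + 1)" using C h by (intro mult_right_mono) auto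
    finally have 1: "\<bar>poly (V n) s - X s\<bar> \<le> C * h ^ (\<rho> + 1)" .
    \<comment> \<open>The derivative costs one power of \<open>h\<close>, by the inverse inequality
      on the cell.\<close>
    have mk: "\<bar>poly (pderiv r) s\<bar> \<le> C2 * b * h ^ \<rho>"
      if "degree r \<le> k + 2" "\<And>s. s \<in> {?t n..?t (Suc n)} \<Longrightarrow> \<bar>poly r s\<bar> \<le> b * h ^ (\<rho> + 1)" for r b
    proof -
      have "\<forall>s\<in>{?t n..?t (Suc n)}. \<bar>poly (pderiv r) s\<bar> \<le> C2 * (b * h ^ (\<rho> + 1)) / (?t (Suc n) - ?t n)"
        by (rule C2(2)[THEN spec, THEN spec, THEN spec, THEN spec, THEN mp, THEN mp, THEN mp, OF lt that(1)])
          (use that(2) in blast)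
      then have "\<bar>poly (pderiv r) s\<bar> \<le> C2 * (b * h ^ (\<rho> + 1)) / h" using s by (simp add: tS)
      also have "\<dots> = C2 * b * h ^ \<rho>" using h by simp
      finally show ?thesis .
    qed
    have d1: "\<bar>poly (pderiv (p n)) s\<bar> \<le> C2 * P * h ^ \<rho>" by (rule mk[OF _ pb]) (use degp[OF n] in simp)
    have d2: "\<bar>poly (pderiv (smult (\<gamma> n) (q n))) s\<bar> \<le> C2 * (\<beta> * Qb) * h ^ \<rho>"
      by (rule mk) (use qb q(1)[of n] in \<open>auto intro: order_trans[OF degree_smult_le]\<close>)
    have d3: "\<bar>x s - poly (pderiv (Tp n)) s - \<gamma> n * (real (k + 2) * (s - ?t n) ^ (k + 1))\<bar> \<le> \<beta> * h ^ (\<rho> + 1)"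
      using Tp n s by blast
    have "poly (pderiv (V n)) s - x s = poly (pderiv (p n)) s - poly (pderiv (smult (\<gamma> n) (q n))) s
        - (x s - poly (pderiv (Tp n)) s - \<gamma> n * (real (k + 2) * (s - ?t n) ^ (k + 1)))"
      unfolding p_def pderiv_diff pderiv_smult poly_diff poly_smult dZ by (simp add: algebra_simps)
    then have "\<bar>poly (pderiv (V n)) s - x s\<bar> \<le> C2 * P * h ^ \<rho> + C2 * (\<beta> * Qb) * h ^ \<rho> + \<beta> * h ^ (\<rho> + 1)"
      using d1 d2 d3 by linarith
    also have "\<dots> \<le> C2 * P * h ^ \<rho> + C2 * (\<beta> * Qb) * h ^ \<rho> + \<beta> * (T * h ^ \<rho>)"
      using \<beta> hpow by (intro add_left_mono mult_left_mono) auto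
    also have "\<dots> = (C2 * P + C2 * (\<beta> * Qb) + \<beta> * T) * h ^ \<rho>" by (simp add: algebra_simps)
    also have "\<dots> \<le> C * h ^ \<rho>" using C h by (intro mult_right_mono) auto
    finally show ?thesis using 1 by blast
  qed
  show ?thesis
  proof (rule exI[of _ C], rule conjI[OF C(1)], intro allI impI ballI)
  qed (rule main; assumption)
qed

text \<open>Taylor expansion of the primitive at the left end of each cell. For even
  \<open>k\<close> the first term beyond degree \<open>k + 1\<close> is kept as the leading error,
  since its coefficient varies only by \<open>O(h)\<close> between cells; for odd \<open>k\<close>
  it is left in the remainder.\<close>

lemma orthogonal_interpolant_bounds:
  assumes T: "T > 0" and x: "Ck_on (k + 2) {0..T} x"
  shows "\<exists>C\<ge>0. \<forall>N>0. \<exists>V. orthogonal_interpolant T N k (\<lambda>s. integral {0..s} x) V \<and>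
     (\<forall>n<N. \<forall>s\<in>{mesh_pt T N n..mesh_pt T N (Suc n)}.
        \<bar>poly (V n) s - integral {0..s} x\<bar> \<le> C * (T / real N) ^ ((if even k then k + 1 else k) + 1) \<and>
        \<bar>poly (pderiv (V n)) s - x s\<bar> \<le> C * (T / real N) ^ (if even k then k + 1 else k))"
proof -
  let ?\<rho> = "if even k then k + 1 else k"
  obtain D where D: "D 0 = x" "\<And>i t. i < k + 2 \<Longrightarrow> t \<in> {0..T} \<Longrightarrow> (D i has_real_derivative D (Suc i) t) (at t within {0..T})"
    "\<And>i. i \<le> k + 2 \<Longrightarrow> continuous_on {0..T} (D i)"
    by (rule Ck_on_derivative_sequence[OF x]) blast
  define X where "X = (\<lambda>s. integral {0..s} x)"
  \<comment> \<open>Derivatives of the primitive \<open>X\<close>, with indices shifted by one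
    against those of \<open>x\<close>.\<close>
  define DX where "DX = case_nat X D"
  have DX: "DX 0 = X" "(\<lambda>i. DX (Suc i)) = D" by (simp_all add: DX_def)
  have cx: "continuous_on {0..T} x" by (rule Ck_on_imp_continuous_on[OF x])
  have dX: "(DX i has_real_derivative DX (Suc i) t) (at t within {0..T})" if "i < k + 3" "t \<in> {0..T}" for i t
    using that D(1,2) integral_has_real_derivative[OF cx that(2)] by (cases i) (auto simp: DX_def X_def[symmetric])
  have cX: "continuous_on {0..T} X" using dX[of 0] DX(1) by (intro DERIV_continuous_on) auto
  obtain b1 where b1: "b1 \<ge> 0" "\<And>t. t \<in> {0..T} \<Longrightarrow> \<bar>D (k + 1) t\<bar> \<le> b1"
    by (rule continuous_bounded_interval[OF D(3)[of "k + 1"]]) auto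
  obtain b2 where b2: "b2 \<ge> 0" "\<And>t. t \<in> {0..T} \<Longrightarrow> \<bar>D (k + 2) t\<bar> \<le> b2"
    by (rule continuous_bounded_interval[OF D(3)[of "k + 2"]]) auto
  define \<beta> where "\<beta> = b1 + b2"
  have \<beta>: "\<beta> \<ge> 0" "b1 \<le> \<beta>" "b2 \<le> \<beta>" using b1(1) b2(1) by (simp_all add: \<beta>_def)
  obtain C where C: "C \<ge> 0" and est: "\<forall>N X x V Tp \<gamma> h. N > 0 \<longrightarrow> h = T / real N \<longrightarrow> X 0 = 0 \<longrightarrow>
    continuous_on {0..T} X \<longrightarrow> orthogonal_interpolant T N k X V \<longrightarrow> local_expansion T N k ?\<rho> \<beta> h X x Tp \<gamma> \<longrightarrow>
    (\<forall>n<N. \<forall>s\<in>{mesh_pt T N n..mesh_pt T N (Suc n)}.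
       \<bar>poly (V n) s - X s\<bar> \<le> C * h ^ (?\<rho> + 1) \<and> \<bar>poly (pderiv (V n)) s - x s\<bar> \<le> C * h ^ ?\<rho>)"
    using orthogonal_interpolant_estimate[OF T \<beta>(1), of k ?\<rho>] by (elim exE conjE) (rule that)
  have main: "\<exists>V. orthogonal_interpolant T N k X V \<and>
     (\<forall>n<N. \<forall>s\<in>{mesh_pt T N n..mesh_pt T N (Suc n)}.
        \<bar>poly (V n) s - X s\<bar> \<le> C * (T / real N) ^ (?\<rho> + 1) \<and>
        \<bar>poly (pderiv (V n)) s - x s\<bar> \<le> C * (T / real N) ^ ?\<rho>)" if N: "N > 0" for N
  proof -
    let ?t = "mesh_pt T N"
    define h where "h = T / real N"
    have h: "h > 0" using T N by (simp add: h_def)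
    have tS: "?t (Suc n) = ?t n + h" for n by (simp add: mesh_pt_Suc h_def)
    obtain V where V: "orthogonal_interpolant T N k X V"
      by (rule orthogonal_interpolant_exists[OF T N cX, of k])
    define Tp where "Tp = (\<lambda>n. taylor_poly DX (?t n) (Suc (k + 1)))"
    \<comment> \<open>The Taylor coefficient of order \<open>k + 2\<close> of the primitive, which
      is why the derivative of order \<open>k + 1\<close> of \<open>x\<close> occurs.\<close>
    define \<gamma> where "\<gamma> = (\<lambda>n. if even k then D (k + 1) (?t n) / fact (k + 2) else 0)"
    have dTp: "pderiv (Tp n) = taylor_poly D (?t n) (k + 1)" for n
      unfolding Tp_def pderiv_taylor_poly DX(2) ..
    have tI: "?t n \<in> {0..T}" if "n < N" for n
      using mesh_pt_nonneg[OF T] mesh_pt_le[OF T _ N] that by simp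
    have f1: "(1::real) \<le> fact (k + 2)" by (rule fact_ge_1)
    have div: "\<bar>y / fact (k + 2)\<bar> \<le> \<bar>y\<bar>" for y :: real
    proof -
      have "\<bar>y\<bar> / fact (k + 2) \<le> \<bar>y\<bar> / 1" using f1 by (intro divide_left_mono) auto
      then show ?thesis by simp
    qed
    have remb: "\<bar>y\<bar> \<le> \<beta> * h ^ p" if "\<bar>y\<bar> \<le> b * (s - ?t n) ^ p" "b \<le> \<beta>" "0 \<le> b" "s \<in> {?t n..?t (Suc n)}" for y b s n p
    proof -
      have "b * (s - ?t n) ^ p \<le> \<beta> * h ^ p"
        using that \<beta> by (intro mult_mono power_mono) (auto simp: tS)
      then show ?thesis using that(1) by linarith
    qed
    have rem: "\<bar>X s - poly (Tp n) s - \<gamma> n * (s - ?t n) ^ (k + 2)\<bar> \<le> \<beta> * h ^ (?\<rho> + 2) \<and>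
         \<bar>x s - poly (pderiv (Tp n)) s - \<gamma> n * (real (k + 2) * (s - ?t n) ^ (k + 1))\<bar> \<le> \<beta> * h ^ (?\<rho> + 1)"
      if n: "n < N" and s: "s \<in> {?t n..?t (Suc n)}" for n s
    proof -
      have st: "0 \<le> ?t n" "?t n \<le> s" "s \<le> T" using mesh_cell_subset[OF T n] s tI[OF n] by auto
      show ?thesis
      proof (cases "even k")
        case False
        have a: "\<bar>DX 0 s - poly (taylor_poly DX (?t n) (k + 2)) s\<bar> \<le> b1 * (s - ?t n) ^ (k + 2)"
          proof (rule taylor_remainder_bound[where D=DX and p="k + 2" and T=T, OF _ _ st])
          show "(DX i has_real_derivative DX (Suc i) t) (at t within {0..T})" if "i < k + 2" "t \<in> {0..T}" for i t
            by (rule dX) (use that in auto)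
          show "\<bar>DX (k + 2) t\<bar> \<le> b1" if "t \<in> {0..T}" for t using b1(2)[OF that] by (simp add: DX_def)
        qed
        have b: "\<bar>D 0 s - poly (taylor_poly D (?t n) (k + 1)) s\<bar> \<le> b1 * (s - ?t n) ^ (k + 1)"
          proof (rule taylor_remainder_bound[where D=D and p="k + 1" and T=T, OF _ _ st])
          show "(D i has_real_derivative D (Suc i) t) (at t within {0..T})" if "i < k + 1" "t \<in> {0..T}" for i t
            by (rule D(2)) (use that in auto)
          show "\<bar>D (k + 1) t\<bar> \<le> b1" if "t \<in> {0..T}" for t using b1(2)[OF that] by (simp add: DX_def)
        qed
        show ?thesis
          using remb[OF a \<beta>(2) b1(1) s] remb[OF b \<beta>(2) b1(1) s] False D(1) DX(1) unfolding dTp by (simp add: Tp_def \<gamma>_def)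
      next
        case True
        have "\<bar>DX 0 s - poly (taylor_poly DX (?t n) (Suc (k + 2))) s\<bar> \<le> b2 * (s - ?t n) ^ (Suc (k + 2))"
          proof (rule taylor_remainder_bound[where D=DX and p="Suc (k + 2)" and T=T, OF _ _ st])
          show "(DX i has_real_derivative DX (Suc i) t) (at t within {0..T})" if "i < Suc (k + 2)" "t \<in> {0..T}" for i t
            by (rule dX) (use that in auto)
          show "\<bar>DX (Suc (k + 2)) t\<bar> \<le> b2" if "t \<in> {0..T}" for t using b2(2)[OF that] by (simp add: DX_def)
        qed
        from remb[OF this \<beta>(3) b2(1) s]
        have 1: "\<bar>X s - poly (Tp n) s - D (k + 1) (?t n) / fact (k + 2) * (s - ?t n) ^ (k + 2)\<bar> \<le> \<beta> * h ^ (Suc (k + 2))"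
          unfolding taylor_poly_Suc[of DX _ "k + 2"] by (simp add: DX Tp_def DX_def poly_power diff_diff_add del: power_Suc fact_Suc)
        have "\<bar>D 0 s - poly (taylor_poly D (?t n) (Suc (k + 1))) s\<bar> \<le> b2 * (s - ?t n) ^ (Suc (k + 1))"
          proof (rule taylor_remainder_bound[where D=D and p="Suc (k + 1)" and T=T, OF _ _ st])
          show "(D i has_real_derivative D (Suc i) t) (at t within {0..T})" if "i < Suc (k + 1)" "t \<in> {0..T}" for i t
            by (rule D(2)) (use that in auto)
          show "\<bar>D (Suc (k + 1)) t\<bar> \<le> b2" if "t \<in> {0..T}" for t using b2(2)[OF that] by (simp add: DX_def)
        qed
        from remb[OF this \<beta>(3) b2(1) s]
        have 2: "\<bar>x s - poly (pderiv (Tp n)) s - D (k + 1) (?t n) / fact (k + 1) * (s - ?t n) ^ (k + 1)\<bar> \<le> \<beta> * h ^ (Suc (k + 1))"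
          unfolding dTp taylor_poly_Suc[of D _ "k + 1"] by (simp add: D(1) poly_power diff_diff_add del: power_Suc fact_Suc)
        have "(fact (k + 2) :: real) = real (k + 2) * fact (k + 1)" by simp
        then have "D (k + 1) (?t n) / fact (k + 2) * (real (k + 2) * (s - ?t n) ^ (k + 1)) = D (k + 1) (?t n) / fact (k + 1) * (s - ?t n) ^ (k + 1)"
          by (simp only: divide_divide_eq_left[symmetric]) simp
        then show ?thesis using 1 2 True by (simp add: \<gamma>_def del: power_Suc fact_Suc of_nat_add)
      qed
    qed
    have degT: "degree (Tp n) \<le> Suc k" for n
      using degree_taylor_poly[of DX "?t n" "k + 1"] by (simp add: Tp_def)
    have gb: "\<bar>\<gamma> n\<bar> * h ^ (k + 2) \<le> \<beta> * h ^ (?\<rho> + 1)" if n: "n < N" for n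
    proof (cases "even k")
      case True
      have "\<bar>\<gamma> n\<bar> \<le> \<beta>" using div[of "D (k + 1) (?t n)"] b1(2)[OF tI[OF n]] \<beta> True by (simp add: \<gamma>_def)
      then have "\<bar>\<gamma> n\<bar> * h ^ (k + 2) \<le> \<beta> * h ^ (k + 2)" using h by (intro mult_right_mono) auto
      then show ?thesis using True by simp
    qed (use \<beta> h in \<open>simp add: \<gamma>_def\<close>)
    have gd: "\<bar>\<gamma> (Suc n) - \<gamma> n\<bar> * h ^ (k + 2) \<le> \<beta> * h ^ (?\<rho> + 2)" if n: "Suc n < N" for n
    proof (cases "even k")
      case True
      have "\<bar>D (k + 1) (?t (Suc n)) - D (k + 1) (?t n)\<bar> \<le> b2 * (?t (Suc n) - ?t n)"
      proof (rule real_mean_value_bound)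
        fix y assume y: "y \<in> {?t n..?t (Suc n)}"
        have sub: "{?t n..?t (Suc n)} \<subseteq> {0..T}" using mesh_cell_subset[OF T, of n N] n by simp
        show "(D (k + 1) has_real_derivative D (k + 2) y) (at y within {?t n..?t (Suc n)})"
          using DERIV_subset[OF D(2) sub, of "k + 1" y] y sub by auto
        show "\<bar>D (k + 2) y\<bar> \<le> b2" using b2(2) y sub by auto
      qed (use h in \<open>simp add: tS\<close>)
      then have "\<bar>\<gamma> (Suc n) - \<gamma> n\<bar> \<le> b2 * h"
        using div[of "D (k + 1) (?t (Suc n)) - D (k + 1) (?t n)"] True by (simp add: \<gamma>_def diff_divide_distrib tS)
      also have "\<dots> \<le> \<beta> * h" using \<beta> h by (intro mult_right_mono) auto
      finally have "\<bar>\<gamma> (Suc n) - \<gamma> n\<bar> * h ^ (k + 2) \<le> (\<beta> * h) * h ^ (k + 2)" using h by (intro mult_right_mono) auto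
      then show ?thesis using True by (simp add: mult.assoc)
    qed (use \<beta> h in \<open>simp add: \<gamma>_def\<close>)
    have g0: "even k \<or> (\<forall>n. \<gamma> n = 0)" by (simp add: \<gamma>_def)
    have X0: "X 0 = 0" by (simp add: X_def)
    have hT: "\<forall>n<N. degree (Tp n) \<le> Suc k \<and> \<bar>\<gamma> n\<bar> * h ^ (k + 2) \<le> \<beta> * h ^ (?\<rho> + 1) \<and>
      (\<forall>s\<in>{?t n..?t (Suc n)}.
         \<bar>X s - poly (Tp n) s - \<gamma> n * (s - ?t n) ^ (k + 2)\<bar> \<le> \<beta> * h ^ (?\<rho> + 2) \<and>
         \<bar>x s - poly (pderiv (Tp n)) s - \<gamma> n * (real (k + 2) * (s - ?t n) ^ (k + 1))\<bar> \<le> \<beta> * h ^ (?\<rho> + 1))"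
      using degT gb rem by blast
    have hg: "\<forall>n. Suc n < N \<longrightarrow> \<bar>\<gamma> (Suc n) - \<gamma> n\<bar> * h ^ (k + 2) \<le> \<beta> * h ^ (?\<rho> + 2)"
      using gd by (intro allI impI)
    have "\<forall>n<N. \<forall>s\<in>{?t n..?t (Suc n)}.
       \<bar>poly (V n) s - X s\<bar> \<le> C * h ^ (?\<rho> + 1) \<and> \<bar>poly (pderiv (V n)) s - x s\<bar> \<le> C * h ^ ?\<rho>"
      by (rule est[THEN spec[of _ N], THEN spec[of _ X], THEN spec[of _ x], THEN spec[of _ V], THEN spec[of _ Tp],
        THEN spec[of _ \<gamma>], THEN spec[of _ h], THEN mp, THEN mp, THEN mp, THEN mp, THEN mp, THEN mp,
        OF N h_def X0 cX V]) (unfold local_expansion_def, rule conjI[OF hT conjI[OF hg g0]])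
    then show ?thesis using V unfolding h_def by blast
  qed
  then show ?thesis unfolding X_def using C by (intro exI[of _ C] conjI allI impI)
qed

section \<open>Piecewise polynomials\<close>

text \<open>The cells are half open on the left, so \<open>0\<close> belongs to the first one.\<close>

definition cell_index :: "real \<Rightarrow> nat \<Rightarrow> real \<Rightarrow> nat" where
  "cell_index T N s = (LEAST n. s \<le> mesh_pt T N (Suc n))"

definition piecewise_poly :: "real \<Rightarrow> nat \<Rightarrow> (nat \<Rightarrow> real poly) \<Rightarrow> real \<Rightarrow> real" where
  "piecewise_poly T N P s = poly (P (cell_index T N s)) s"

lemma cell_index_eq:
  assumes "T > 0" "mesh_pt T N n < s" "s \<le> mesh_pt T N (Suc n)"
  shows "cell_index T N s = n"
  unfolding cell_index_def
proof (rule Least_equality)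
  fix m assume "s \<le> mesh_pt T N (Suc m)"
  then have "\<not> Suc m \<le> n" using mesh_pt_mono[OF assms(1), of "Suc m" n N] assms(2) by linarith
  then show "n \<le> m" by simp
qed (rule assms)

lemma cell_index_0: "T > 0 \<Longrightarrow> cell_index T N 0 = 0"
  unfolding cell_index_def by (rule Least_equality) (use mesh_pt_nonneg in auto)

lemma piecewise_poly_cell:
  assumes "T > 0" "mesh_pt T N n < s" "s \<le> mesh_pt T N (Suc n)"
  shows "piecewise_poly T N P s = poly (P n) s"
  using cell_index_eq[OF assms] by (simp add: piecewise_poly_def)

lemma piecewise_poly_0: "T > 0 \<Longrightarrow> piecewise_poly T N P 0 = poly (P 0) 0"
  by (simp add: piecewise_poly_def cell_index_0)

text \<open>By the half-open convention the left end of a cell other than the first is evaluated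
  with the preceding polynomial. Agreement at the mesh points extends the formula to the closed
  cell.\<close>

lemma piecewise_poly_glued:
  assumes T: "T > 0" and A: "\<And>n. Suc n < N \<Longrightarrow> poly (A (Suc n)) (mesh_pt T N (Suc n)) = poly (A n) (mesh_pt T N (Suc n))"
    and n: "n < N" and s: "s \<in> {mesh_pt T N n..mesh_pt T N (Suc n)}"
  shows "piecewise_poly T N A s = poly (A n) s"
proof (cases "s = mesh_pt T N n")
  case False
  then show ?thesis using s by (intro piecewise_poly_cell[OF T]) auto
next
  case True
  show ?thesis
  proof (cases n)
    case 0
    then show ?thesis using True piecewise_poly_0[OF T] by simp
  next
    case (Suc m)
    have "mesh_pt T N m < s" using mesh_cell_nonempty[OF T, of N m] n True Suc by simp
    then have "piecewise_poly T N A s = poly (A m) s" using True Suc by (intro piecewise_poly_cell[OF T]) auto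
    then show ?thesis using A[of m] n True Suc by simp
  qed
qed

lemma continuous_on_piecewise_poly_glued:
  assumes T: "T > 0" and N: "N > 0"
    and A: "\<And>n. Suc n < N \<Longrightarrow> poly (A (Suc n)) (mesh_pt T N (Suc n)) = poly (A n) (mesh_pt T N (Suc n))"
  shows "continuous_on {0..T} (piecewise_poly T N A)"
proof -
  have "continuous_on {0..mesh_pt T N n} (piecewise_poly T N A)" if "n \<le> N" for n
    using that
  proof (induction n)
    case 0 then show ?case by simp
  next
    case (Suc n)
    have "continuous_on {mesh_pt T N n..mesh_pt T N (Suc n)} (piecewise_poly T N A)"
    proof (rule continuous_on_cong[THEN iffD1, OF refl _ continuous_on_poly_real[of _ "A n"]])
      fix x assume "x \<in> {mesh_pt T N n..mesh_pt T N (Suc n)}"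
      then show "poly (A n) x = piecewise_poly T N A x"
        using piecewise_poly_glued[OF T A, of n x] Suc.prems by simp
    qed
    then have "continuous_on ({0..mesh_pt T N n} \<union> {mesh_pt T N n..mesh_pt T N (Suc n)}) (piecewise_poly T N A)"
      using Suc by (intro continuous_on_closed_Un) auto
    moreover have "{0..mesh_pt T N n} \<union> {mesh_pt T N n..mesh_pt T N (Suc n)} = {0..mesh_pt T N (Suc n)}"
      using mesh_pt_nonneg[OF T, of N n] mesh_pt_mono[OF T, of n "Suc n" N] by auto
    ultimately show ?case by simp
  qed
  from this[of N] show ?thesis using N by (simp add: mesh_pt_last)
qed

lemma open_cell_exists:
  assumes "T > 0" "N > 0" "s \<in> {0<..<T} - mesh_pt T N ` {..N}"
  obtains n where "n < N" "s \<in> {mesh_pt T N n<..<mesh_pt T N (Suc n)}"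
proof -
  obtain n where n: "n < N" "s \<in> {mesh_pt T N n..mesh_pt T N (Suc n)}"
    using mesh_cell_exists[OF assms(1,2), of s] assms(3) by auto
  have "s \<noteq> mesh_pt T N n" "s \<noteq> mesh_pt T N (Suc n)" using assms(3) n(1) by auto
  then show ?thesis using that n by auto
qed

lemma piecewise_poly_glued_derivative:
  assumes T: "T > 0" and N: "N > 0" and s: "s \<in> {0<..<T} - mesh_pt T N ` {..N}"
  shows "(piecewise_poly T N A has_real_derivative piecewise_poly T N (\<lambda>n. pderiv (A n)) s) (at s)"
proof -
  obtain n where n: "n < N" "s \<in> {mesh_pt T N n<..<mesh_pt T N (Suc n)}" using open_cell_exists[OF T N s] .
  have "(poly (A n) has_real_derivative poly (pderiv (A n)) s) (at s)" by (rule poly_DERIV)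
  then have "(piecewise_poly T N A has_real_derivative poly (pderiv (A n)) s) (at s)"
  proof (rule DERIV_cong_ev[THEN iffD1, OF refl _ refl, rotated])
    have "eventually (\<lambda>x. x \<in> {mesh_pt T N n<..<mesh_pt T N (Suc n)}) (nhds s)"
      using n(2) by (intro eventually_nhds_in_open) auto
    then show "eventually (\<lambda>x. poly (A n) x = piecewise_poly T N A x) (nhds s)"
      by (rule eventually_mono) (use piecewise_poly_cell[OF T] in auto)
  qed
  then show ?thesis using piecewise_poly_cell[OF T, of N n s "\<lambda>n. pderiv (A n)"] n(2) by simp
qed

lemma pderiv_sum: "pderiv (sum f S) = (\<Sum>x\<in>S. pderiv (f x))"
  by (induction S rule: infinite_finite_induct) (auto simp: pderiv_add)

lemma poly_antiderivative_exists:
  fixes p :: "real poly"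
  obtains q where "pderiv q = p" "degree q \<le> Suc (degree p)" "poly q a = y"
proof -
  define q where "q = (\<Sum>i\<le>degree p. monom (coeff p i / real (Suc i)) (Suc i))"
  have "pderiv q = (\<Sum>i\<le>degree p. monom (coeff p i) i)"
    unfolding q_def pderiv_sum pderiv_monom by (intro sum.cong) (auto simp del: of_nat_Suc)
  then have d: "pderiv q = p" by (simp add: poly_as_sum_of_monoms)
  have deg: "degree q \<le> Suc (degree p)"
    unfolding q_def by (intro degree_sum_le) (auto intro: order_trans[OF degree_monom_le])
  show ?thesis
  proof (rule that[of "q + [:y - poly q a:]"])
    show "pderiv (q + [:y - poly q a:]) = p" by (simp add: pderiv_add d pderiv_pCons)
    show "degree (q + [:y - poly q a:]) \<le> Suc (degree p)" using deg by (intro degree_add_le) auto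
  qed simp
qed

text \<open>Constants of integration are chosen cell by cell to make the pieces match. The
  fundamental theorem of calculus then holds across the mesh points, which form a finite exceptional
  set.\<close>

lemma piecewise_poly_primitive:
  assumes T: "T > 0" and N: "N > 0" and P: "\<And>n. degree (P n) \<le> k"
  obtains A where "\<And>n. degree (A n) \<le> Suc k" "\<And>n. pderiv (A n) = P n"
    "continuous_on {0..T} (piecewise_poly T N A)" "piecewise_poly T N A 0 = 0"
    "\<And>n s. n < N \<Longrightarrow> s \<in> {mesh_pt T N n..mesh_pt T N (Suc n)} \<Longrightarrow> piecewise_poly T N A s = poly (A n) s"
    "\<And>t. t \<in> {0..T} \<Longrightarrow> (piecewise_poly T N P has_integral piecewise_poly T N A t) {0..t}"
proof -
  have "\<exists>A. \<forall>n. (degree (A n) \<le> Suc k \<and> pderiv (A n) = P n \<and> (n = 0 \<longrightarrow> poly (A n) 0 = 0)) \<and>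
      poly (A (Suc n)) (mesh_pt T N (Suc n)) = poly (A n) (mesh_pt T N (Suc n))"
  proof (rule dependent_nat_choice)
    obtain q where "pderiv q = P 0" "degree q \<le> Suc (degree (P 0))" "poly q 0 = 0" by (rule poly_antiderivative_exists)
    then show "\<exists>q. degree q \<le> Suc k \<and> pderiv q = P 0 \<and> (0 = (0::nat) \<longrightarrow> poly q 0 = 0)"
      using P[of 0] by (intro exI[of _ q]) auto
    fix p n
    obtain q where "pderiv q = P (Suc n)" "degree q \<le> Suc (degree (P (Suc n)))" "poly q (mesh_pt T N (Suc n)) = poly p (mesh_pt T N (Suc n))"
      by (rule poly_antiderivative_exists)
    then show "\<exists>q. (degree q \<le> Suc k \<and> pderiv q = P (Suc n) \<and> (Suc n = 0 \<longrightarrow> poly q 0 = 0)) \<and>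
        poly q (mesh_pt T N (Suc n)) = poly p (mesh_pt T N (Suc n))"
      using P[of "Suc n"] by (intro exI[of _ q]) auto
  qed
  then obtain A where A: "\<And>n. degree (A n) \<le> Suc k" "\<And>n. pderiv (A n) = P n" "poly (A 0) 0 = 0"
    "\<And>n. poly (A (Suc n)) (mesh_pt T N (Suc n)) = poly (A n) (mesh_pt T N (Suc n))" by metis
  have c: "continuous_on {0..T} (piecewise_poly T N A)" by (rule continuous_on_piecewise_poly_glued[OF T N A(4)])
  have z: "piecewise_poly T N A 0 = 0" using piecewise_poly_0[OF T] A(3) by simp
  have "(piecewise_poly T N P has_integral piecewise_poly T N A t) {0..t}" if t: "t \<in> {0..T}" for t
  proof -
    have "(piecewise_poly T N P has_integral piecewise_poly T N A t - piecewise_poly T N A 0) {0..t}"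
    proof (rule fundamental_theorem_of_calculus_interior_strong)
      show "finite (mesh_pt T N ` {..N})" by simp
      show "continuous_on {0..t} (piecewise_poly T N A)" by (rule continuous_on_subset[OF c]) (use t in auto)
      fix s assume "s \<in> {0<..<t} - mesh_pt T N ` {..N}"
      then show "(piecewise_poly T N A has_vector_derivative piecewise_poly T N P s) (at s)"
        using piecewise_poly_glued_derivative[OF T N, of s A] t
        by (simp add: A(2) has_real_derivative_iff_has_vector_derivative)
    qed (use t in simp)
    then show ?thesis by (simp add: z)
  qed
  with A c z show ?thesis using that piecewise_poly_glued[OF T A(4)] by blast
qed

section \<open>The discrete problem\<close>

text \<open>Gaussian elimination, by induction on the set of unknowns. Arbitrary finite index sets
  spare a numbering of the coefficients of all cells.\<close>

lemma square_linear_system: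
  fixes A :: "'r \<Rightarrow> 'c \<Rightarrow> real"
  assumes "finite C" "finite R" "card R = card C"
    and "\<And>a. (\<And>r. r \<in> R \<Longrightarrow> (\<Sum>j\<in>C. A r j * a j) = 0) \<Longrightarrow> \<forall>j\<in>C. a j = 0"
  shows "\<exists>a. \<forall>r\<in>R. (\<Sum>j\<in>C. A r j * a j) = b r"
  using assms
proof (induction C arbitrary: R A b rule: finite_induct)
  case empty
  then show ?case by simp
next
  case (insert c C)
  let ?e = "\<lambda>j. if j = c then 1 else 0 :: real"
  \<comment> \<open>Otherwise the unit vector at \<open>c\<close> would be a nonzero solution of the
    homogeneous system.\<close>
  have "\<exists>p\<in>R. A p c \<noteq> 0"
  proof (rule ccontr)
    assume "\<not> ?thesis"
    then have z: "A r c = 0" if "r \<in> R" for r using that by blast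
    have "(\<Sum>j\<in>insert c C. A r j * ?e j) = 0" if "r \<in> R" for r
      using z[OF that] insert.hyps by (auto intro: sum.neutral)
    then have "\<forall>j\<in>insert c C. ?e j = 0" by (rule insert.prems(3))
    then show False by simp
  qed
  then obtain p where p: "p \<in> R" "A p c \<noteq> 0" by blast
  \<comment> \<open>The Schur complement of the pivot \<open>A p c\<close>.\<close>
  define A' where "A' = (\<lambda>r j. A r j - A r c * A p j / A p c)"
  have sum': "(\<Sum>j\<in>C. A' r j * a j) = (\<Sum>j\<in>C. A r j * a j) - A r c * (\<Sum>j\<in>C. A p j * a j) / A p c" for r a
    by (simp add: A'_def left_diff_distrib sum_subtractf sum_distrib_left sum_divide_distrib mult.assoc)
  have full: "(\<Sum>j\<in>insert c C. A r j * (a(c := y)) j) = A r c * y + (\<Sum>j\<in>C. A r j * a j)" for r a y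
  proof -
    have "(\<Sum>j\<in>C. A r j * (a(c := y)) j) = (\<Sum>j\<in>C. A r j * a j)"
      by (rule sum.cong) (use insert.hyps in auto)
    then show ?thesis using insert.hyps by simp
  qed
  have solve: "\<forall>r\<in>R. (\<Sum>j\<in>insert c C. A r j * (a(c := (b p - (\<Sum>j\<in>C. A p j * a j)) / A p c)) j) = b r"
    if a: "\<And>r. r \<in> R - {p} \<Longrightarrow> (\<Sum>j\<in>C. A' r j * a j) = b r - A r c * b p / A p c" for a b
  proof
    fix r assume r: "r \<in> R"
    show "(\<Sum>j\<in>insert c C. A r j * (a(c := (b p - (\<Sum>j\<in>C. A p j * a j)) / A p c)) j) = b r"
    proof (cases "r = p")
      case True
      then show ?thesis unfolding full using p(2) by simp
    next
      case False
      then have "(\<Sum>j\<in>C. A r j * a j) - A r c * (\<Sum>j\<in>C. A p j * a j) / A p c = b r - A r c * b p / A p c"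
        using a[of r] r unfolding sum' by simp
      then show ?thesis unfolding full by (simp add: right_diff_distrib diff_divide_distrib)
    qed
  qed
  have "\<exists>a. \<forall>r\<in>R - {p}. (\<Sum>j\<in>C. A' r j * a j) = b r - A r c * b p / A p c"
  proof (rule insert.IH)
    show "finite (R - {p})" using insert.prems(1) by simp
    show "card (R - {p}) = card C" using insert.prems(1,2) insert.hyps p(1) by simp
    fix a assume a: "\<And>r. r \<in> R - {p} \<Longrightarrow> (\<Sum>j\<in>C. A' r j * a j) = 0"
    have "\<forall>r\<in>R. (\<Sum>j\<in>insert c C. A r j * (a(c := (0 - (\<Sum>j\<in>C. A p j * a j)) / A p c)) j) = 0"
      by (rule solve) (use a in simp)
    then have "\<forall>j\<in>insert c C. (a(c := (0 - (\<Sum>j\<in>C. A p j * a j)) / A p c)) j = 0"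
      by (intro insert.prems(3)) blast
    then show "\<forall>j\<in>C. a j = 0" using insert.hyps(2) by (metis fun_upd_apply insertCI)
  qed
  then obtain a where "\<forall>r\<in>R - {p}. (\<Sum>j\<in>C. A' r j * a j) = b r - A r c * b p / A p c" by blast
  then have "\<forall>r\<in>R. (\<Sum>j\<in>insert c C. A r j * (a(c := (b p - (\<Sum>j\<in>C. A p j * a j)) / A p c)) j) = b r"
    by (intro solve) blast
  then show ?case by blast
qed

section \<open>The DG space and the reduction to orthogonality on cells\<close>

lemma half_open_cell_exists:
  assumes T: "T > 0" and N: "N > 0" and s: "0 < s" "s \<le> T"
  obtains n where "n < N" "s \<in> {mesh_pt T N n<..mesh_pt T N (Suc n)}"
proof -
  obtain n where n: "n < N" "s \<in> {mesh_pt T N n..mesh_pt T N (Suc n)}"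
    using mesh_cell_exists[OF T N, of s] s by auto
  show ?thesis
  proof (cases "s = mesh_pt T N n")
    case False then show ?thesis using that[of n] n by auto
  next
    case True
    then obtain m where m: "n = Suc m" using s by (cases n) auto
    show ?thesis using that[of m] True m n(1) mesh_cell_nonempty[OF T N, of m] by simp
  qed
qed

lemma piecewise_poly_tendsto_0:
  assumes T: "T > 0" and N: "N > 0" and u: "\<And>s. s \<in> {0<..mesh_pt T N (Suc 0)} \<Longrightarrow> u s = poly p s"
  shows "(u \<longlongrightarrow> poly p 0) (at_right 0)"
proof -
  have "(poly p \<longlongrightarrow> poly p 0) (at_right 0)"
  proof -
    have "isCont (poly p) 0" by simp
    then show ?thesis unfolding isCont_def filterlim_at_split by blast
  qed
  then show ?thesis
  proof (rule Lim_transform_eventually)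
    have "eventually (\<lambda>s. s \<in> {0<..<mesh_pt T N (Suc 0)}) (at_right 0)"
      using mesh_cell_nonempty[OF T N, of 0] by (intro eventually_at_right_real) simp
    then show "eventually (\<lambda>s. poly p s = u s) (at_right 0)" by (rule eventually_mono) (use u in auto)
  qed
qed

text \<open>At \<open>0\<close> the right-hand limit forces the value of the first polynomial, in
  agreement with the convention of \<open>cell_index\<close>.\<close>

lemma dg_space_piecewise:
  assumes T: "T > 0" and N: "N > 0" and u: "u \<in> dg_space T N (Suc k)"
  obtains P where "\<And>n. degree (P n) \<le> k" "\<And>s. s \<in> {0..T} \<Longrightarrow> u s = piecewise_poly T N P s"
proof -
  have "\<forall>n. \<exists>p :: real poly. degree p \<le> k \<and> (n < N \<longrightarrow> (\<forall>t\<in>{mesh_pt T N n<..mesh_pt T N (Suc n)}. u t = poly p t))"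
  proof
    fix n
    show "\<exists>p :: real poly. degree p \<le> k \<and> (n < N \<longrightarrow> (\<forall>t\<in>{mesh_pt T N n<..mesh_pt T N (Suc n)}. u t = poly p t))"
    proof (cases "n < N")
      case True then show ?thesis using u by (simp add: dg_space_def)
    next
      case False then show ?thesis by (intro exI[of _ 0]) simp
    qed
  qed
  then obtain P where P: "\<And>n. degree (P n) \<le> k"
    "\<And>n t. n < N \<Longrightarrow> t \<in> {mesh_pt T N n<..mesh_pt T N (Suc n)} \<Longrightarrow> u t = poly (P n) t" by metis
  have "u s = piecewise_poly T N P s" if s: "s \<in> {0..T}" for s
  proof (cases "s = 0")
    case True
    have "(u \<longlongrightarrow> poly (P 0) 0) (at_right 0)"
      by (rule piecewise_poly_tendsto_0[OF T N]) (use P(2)[OF N] in simp)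
    moreover have "(u \<longlongrightarrow> u 0) (at_right 0)" using u by (simp add: dg_space_def)
    ultimately have "u 0 = poly (P 0) 0" using tendsto_unique trivial_limit_at_right_real by blast
    then show ?thesis using True piecewise_poly_0[OF T] by simp
  next
    case False
    then have "0 < s" "s \<le> T" using s by auto
    then obtain n where n: "n < N" "s \<in> {mesh_pt T N n<..mesh_pt T N (Suc n)}" by (rule half_open_cell_exists[OF T N])
    then show ?thesis using P(2)[OF n] piecewise_poly_cell[OF T, of N n s P] by simp
  qed
  with P(1) show ?thesis by (rule that)
qed

lemma piecewise_poly_in_dg_space:
  assumes T: "T > 0" and N: "N > 0" and P: "\<And>n. degree (P n) \<le> k"
  shows "restrict (piecewise_poly T N P) {0..T} \<in> dg_space T N (Suc k)"
proof -
  let ?u = "restrict (piecewise_poly T N P) {0..T}"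
  have u: "?u s = poly (P n) s" if "n < N" "s \<in> {mesh_pt T N n<..mesh_pt T N (Suc n)}" for n s
    using that mesh_cell_subset[OF T that(1)] piecewise_poly_cell[OF T, of N n s P] by auto
  have "(?u \<longlongrightarrow> poly (P 0) 0) (at_right 0)"
    by (rule piecewise_poly_tendsto_0[OF T N]) (use u[OF N] in simp)
  moreover have "?u 0 = poly (P 0) 0" using T piecewise_poly_0[OF T, of N P] by simp
  ultimately show ?thesis unfolding dg_space_def using u P by auto
qed

text \<open>Once the memory integrals are continuous functions \<open>j11\<close>,
  \<open>j12\<close>, \<open>j21\<close>, a test function enters each equation only through its
  polynomial on one cell.\<close>

lemma dg_solution_iff:
  assumes T: "T > 0" and N: "N > 0"
    and u: "u1 \<in> dg_space T N (Suc k)" "u2 \<in> dg_space T N (Suc k)"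
    and P1: "\<And>s. s \<in> {0..T} \<Longrightarrow> u1 s = piecewise_poly T N P1 s"
    and j: "\<And>t. t \<in> {0..T} \<Longrightarrow> ((\<lambda>s. K11 t s * u1 s) has_integral j11 t) {0..t}"
      "\<And>t. t \<in> {0..T} \<Longrightarrow> ((\<lambda>s. K12 t s * u2 s) has_integral j12 t) {0..t}"
      "\<And>t. t \<in> {0..T} \<Longrightarrow> ((\<lambda>s. K21 t s * u1 s) has_integral j21 t) {0..t}"
    and cj: "continuous_on {0..T} j11" "continuous_on {0..T} j12" "continuous_on {0..T} j21"
    and cf: "continuous_on {0..T} f1" "continuous_on {0..T} f2"
  shows "dg_solution T N (Suc k) K11 K12 K21 f1 f2 u1 u2 \<longleftrightarrow>
    (\<forall>n<N. poly_orth k (mesh_pt T N n) (mesh_pt T N (Suc n)) (\<lambda>s. poly (P1 n) s + (j11 s + j12 s) - f1 s) \<and>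
       poly_orth k (mesh_pt T N n) (mesh_pt T N (Suc n)) (\<lambda>s. j21 s - f2 s))"
proof -
  let ?c = "\<lambda>n. {mesh_pt T N n..mesh_pt T N (Suc n)}"
  let ?l1 = "\<lambda>s. u1 s + integral {0..s} (\<lambda>\<tau>. K11 s \<tau> * u1 \<tau> + K12 s \<tau> * u2 \<tau>)"
  let ?l2 = "\<lambda>s. integral {0..s} (\<lambda>\<tau>. K21 s \<tau> * u1 \<tau>)"
  have eqs: "integral (?c n) (\<lambda>s. ?l1 s * \<phi> s) = integral (?c n) (\<lambda>s. f1 s * \<phi> s) \<longleftrightarrow>
        integral (?c n) (\<lambda>s. (poly (P1 n) s + (j11 s + j12 s) - f1 s) * poly q s) = 0"
    "integral (?c n) (\<lambda>s. ?l2 s * \<phi> s) = integral (?c n) (\<lambda>s. f2 s * \<phi> s) \<longleftrightarrow>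
        integral (?c n) (\<lambda>s. (j21 s - f2 s) * poly q s) = 0"
    if n: "n < N" and \<phi>: "\<And>s. s \<in> {mesh_pt T N n<..mesh_pt T N (Suc n)} \<Longrightarrow> \<phi> s = poly q s" for n \<phi> q
  proof -
    note sub = mesh_cell_subset[OF T n]
    \<comment> \<open>At the left mesh point a discrete function has the value of the preceding
      cell; a single point does not affect the integral.\<close>
    have spike: "integral (?c n) (\<lambda>s. g s * \<phi> s) = integral (?c n) (\<lambda>s. g' s * poly q s)"
      if "\<And>s. s \<in> {mesh_pt T N n<..mesh_pt T N (Suc n)} \<Longrightarrow> g s = g' s" for g g' :: "real \<Rightarrow> real"
      by (rule integral_spike[of "{mesh_pt T N n}"]) (use that \<phi> in \<open>auto simp: less_le\<close>)
    have cc: "continuous_on (?c n) g" if "continuous_on {0..T} g" for g :: "real \<Rightarrow> real"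
      by (rule continuous_on_subset[OF that sub])
    have "integral (?c n) (\<lambda>s. ?l1 s * \<phi> s) = integral (?c n) (\<lambda>s. (poly (P1 n) s + (j11 s + j12 s)) * poly q s)"
    proof (rule spike)
      fix s assume s: "s \<in> {mesh_pt T N n<..mesh_pt T N (Suc n)}"
      then have sI: "s \<in> {0..T}" using sub by auto
      have "u1 s = poly (P1 n) s" using P1[OF sI] piecewise_poly_cell[OF T, of N n s P1] s by simp
      moreover have "integral {0..s} (\<lambda>\<tau>. K11 s \<tau> * u1 \<tau> + K12 s \<tau> * u2 \<tau>) = j11 s + j12 s"
        by (rule integral_unique[OF has_integral_add[OF j(1)[OF sI] j(2)[OF sI]]])
      ultimately show "?l1 s = poly (P1 n) s + (j11 s + j12 s)" by simp
    qed
    moreover have "integral (?c n) (\<lambda>s. f1 s * \<phi> s) = integral (?c n) (\<lambda>s. f1 s * poly q s)" by (rule spike) simp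
    moreover have "integral (?c n) (\<lambda>s. (poly (P1 n) s + (j11 s + j12 s)) * poly q s - f1 s * poly q s)
       = integral (?c n) (\<lambda>s. (poly (P1 n) s + (j11 s + j12 s)) * poly q s) - integral (?c n) (\<lambda>s. f1 s * poly q s)"
      by (intro integral_diff integrable_continuous_real continuous_on_mult continuous_on_add continuous_on_poly_real cc cj cf)
    ultimately show "integral (?c n) (\<lambda>s. ?l1 s * \<phi> s) = integral (?c n) (\<lambda>s. f1 s * \<phi> s) \<longleftrightarrow>
        integral (?c n) (\<lambda>s. (poly (P1 n) s + (j11 s + j12 s) - f1 s) * poly q s) = 0"
      by (simp add: left_diff_distrib)
    have "integral (?c n) (\<lambda>s. ?l2 s * \<phi> s) = integral (?c n) (\<lambda>s. j21 s * poly q s)"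
    proof (rule spike)
      fix s assume s: "s \<in> {mesh_pt T N n<..mesh_pt T N (Suc n)}"
      then have sI: "s \<in> {0..T}" using sub by auto
      show "?l2 s = j21 s" by (rule integral_unique[OF j(3)[OF sI]])
    qed
    moreover have "integral (?c n) (\<lambda>s. f2 s * \<phi> s) = integral (?c n) (\<lambda>s. f2 s * poly q s)" by (rule spike) simp
    moreover have "integral (?c n) (\<lambda>s. j21 s * poly q s - f2 s * poly q s)
       = integral (?c n) (\<lambda>s. j21 s * poly q s) - integral (?c n) (\<lambda>s. f2 s * poly q s)"
      by (intro integral_diff integrable_continuous_real continuous_on_mult continuous_on_poly_real cc cj cf)
    ultimately show "integral (?c n) (\<lambda>s. ?l2 s * \<phi> s) = integral (?c n) (\<lambda>s. f2 s * \<phi> s) \<longleftrightarrow>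
        integral (?c n) (\<lambda>s. (j21 s - f2 s) * poly q s) = 0"
      by (simp add: left_diff_distrib)
  qed
  show ?thesis
  proof
    assume sol: "dg_solution T N (Suc k) K11 K12 K21 f1 f2 u1 u2"
    show "\<forall>n<N. poly_orth k (mesh_pt T N n) (mesh_pt T N (Suc n)) (\<lambda>s. poly (P1 n) s + (j11 s + j12 s) - f1 s) \<and>
       poly_orth k (mesh_pt T N n) (mesh_pt T N (Suc n)) (\<lambda>s. j21 s - f2 s)"
    proof (intro allI impI)
      fix n assume n: "n < N"
      have "integral (?c n) (\<lambda>s. (poly (P1 n) s + (j11 s + j12 s) - f1 s) * poly q s) = 0 \<and>
          integral (?c n) (\<lambda>s. (j21 s - f2 s) * poly q s) = 0" if q: "degree q \<le> k" for q
      proof -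
        \<comment> \<open>The same polynomial on all cells is an admissible test function, and the
          equation on the cell \<open>n\<close> does not see the other cells.\<close>
        let ?\<phi> = "restrict (piecewise_poly T N (\<lambda>_. q)) {0..T}"
        have \<phi>: "?\<phi> \<in> dg_space T N (Suc k)" by (rule piecewise_poly_in_dg_space[OF T N q])
        have "?\<phi> s = poly q s" if "s \<in> {mesh_pt T N n<..mesh_pt T N (Suc n)}" for s
          using that mesh_cell_subset[OF T n] by (auto simp: piecewise_poly_def)
        from eqs[OF n this] show ?thesis using sol n \<phi> unfolding dg_solution_def by blast
      qed
      then show "poly_orth k (mesh_pt T N n) (mesh_pt T N (Suc n)) (\<lambda>s. poly (P1 n) s + (j11 s + j12 s) - f1 s) \<and>
         poly_orth k (mesh_pt T N n) (mesh_pt T N (Suc n)) (\<lambda>s. j21 s - f2 s)"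
        unfolding poly_orth_def by simp
    qed
  next
    assume orth: "\<forall>n<N. poly_orth k (mesh_pt T N n) (mesh_pt T N (Suc n)) (\<lambda>s. poly (P1 n) s + (j11 s + j12 s) - f1 s) \<and>
       poly_orth k (mesh_pt T N n) (mesh_pt T N (Suc n)) (\<lambda>s. j21 s - f2 s)"
    have "integral (?c n) (\<lambda>s. ?l1 s * \<phi> s) = integral (?c n) (\<lambda>s. f1 s * \<phi> s) \<and>
        integral (?c n) (\<lambda>s. ?l2 s * \<phi> s) = integral (?c n) (\<lambda>s. f2 s * \<phi> s)"
      if \<phi>: "\<phi> \<in> dg_space T N (Suc k)" and n: "n < N" for \<phi> n
    proof -
      obtain Q where Q: "\<And>n. degree (Q n) \<le> k" "\<And>s. s \<in> {0..T} \<Longrightarrow> \<phi> s = piecewise_poly T N Q s"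
        by (rule dg_space_piecewise[OF T N \<phi>]) blast
      have \<phi>Q: "\<phi> s = poly (Q n) s" if "s \<in> {mesh_pt T N n<..mesh_pt T N (Suc n)}" for s
        using that mesh_cell_subset[OF T n] Q(2)[of s] piecewise_poly_cell[OF T, of N n s Q] by auto
      have o1: "integral (?c n) (\<lambda>s. (poly (P1 n) s + (j11 s + j12 s) - f1 s) * poly (Q n) s) = 0"
        by (rule poly_orthD[OF _ Q(1)]) (use orth n in blast)
      have o2: "integral (?c n) (\<lambda>s. (j21 s - f2 s) * poly (Q n) s) = 0"
        by (rule poly_orthD[OF _ Q(1)]) (use orth n in blast)
      show ?thesis using eqs[OF n \<phi>Q] o1 o2 by simp
    qed
    then show "dg_solution T N (Suc k) K11 K12 K21 f1 f2 u1 u2"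
      unfolding dg_solution_def using u by blast
  qed
qed

definition piecewise_primitive :: "real \<Rightarrow> nat \<Rightarrow> nat \<Rightarrow> (nat \<Rightarrow> real poly) \<Rightarrow> (nat \<Rightarrow> real poly) \<Rightarrow> bool" where
  "piecewise_primitive T N k P A \<longleftrightarrow>
     (\<forall>n. degree (P n) \<le> k \<and> degree (A n) \<le> Suc k \<and> pderiv (A n) = P n) \<and>
     continuous_on {0..T} (piecewise_poly T N A) \<and> piecewise_poly T N A 0 = 0 \<and>
     (\<forall>n<N. \<forall>s\<in>{mesh_pt T N n..mesh_pt T N (Suc n)}. piecewise_poly T N A s = poly (A n) s)"

lemma piecewise_primitiveD:
  assumes "piecewise_primitive T N k P A"
  shows "degree (P n) \<le> k" "degree (A n) \<le> Suc k" "pderiv (A n) = P n"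
    "continuous_on {0..T} (piecewise_poly T N A)" "piecewise_poly T N A 0 = 0"
    "\<And>n s. n < N \<Longrightarrow> s \<in> {mesh_pt T N n..mesh_pt T N (Suc n)} \<Longrightarrow> piecewise_poly T N A s = poly (A n) s"
  using assms by (simp_all add: piecewise_primitive_def)

lemma piecewise_primitive_exists:
  assumes "T > 0" "N > 0" "\<And>n. degree (P n) \<le> k"
  obtains A where "piecewise_primitive T N k P A"
proof -
  obtain A where "\<And>n. degree (A n) \<le> Suc k" "\<And>n. pderiv (A n) = P n"
    "continuous_on {0..T} (piecewise_poly T N A)" "piecewise_poly T N A 0 = 0"
    "\<And>n s. n < N \<Longrightarrow> s \<in> {mesh_pt T N n..mesh_pt T N (Suc n)} \<Longrightarrow> piecewise_poly T N A s = poly (A n) s"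
    by (rule piecewise_poly_primitive[of T N P k, OF assms(1,2) assms(3)]) blast
  then show ?thesis by (intro that[of A]) (simp add: piecewise_primitive_def assms(3))
qed

lemma piecewise_poly_diff:
  "piecewise_poly T N (\<lambda>n. A n - B n) s = piecewise_poly T N A s - piecewise_poly T N B s"
  by (simp add: piecewise_poly_def)

lemma piecewise_primitive_diff:
  assumes "piecewise_primitive T N k P A" "piecewise_primitive T N k Q B"
  shows "piecewise_primitive T N k (\<lambda>n. P n - Q n) (\<lambda>n. A n - B n)"
  using assms unfolding piecewise_primitive_def piecewise_poly_diff
  by (simp add: pderiv_diff degree_diff_le continuous_on_diff)

lemma has_integral_volterra_piecewise:
  assumes T: "T > 0" and N: "N > 0" and K: "regular_kernel T B K Ks" and A: "piecewise_primitive T N k P A"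
    and t: "t \<in> {0..T}"
  shows "((\<lambda>s. K t s * piecewise_poly T N P s) has_integral volterra_parts K Ks (piecewise_poly T N A) t) {0..t}"
proof (rule has_integral_volterra_parts[OF K t piecewise_primitiveD(4,5)[OF A], of "mesh_pt T N ` {..N}"])
  fix s assume "s \<in> {0<..<T} - mesh_pt T N ` {..N}"
  from piecewise_poly_glued_derivative[OF T N this, of A]
  show "(piecewise_poly T N A has_real_derivative piecewise_poly T N P s) (at s)"
    using piecewise_primitiveD(3)[OF A] by simp
qed simp

lemma volterra_parts_zero:
  assumes "t \<in> {0..T}" "\<And>s. s \<in> {0..T} \<Longrightarrow> F s = 0"
  shows "volterra_parts K Ks F t = 0"
proof -
  have "integral {0..t} (\<lambda>s. Ks t s * F s) = integral {0..t} (\<lambda>s. 0)"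
    by (rule integral_cong) (use assms in auto)
  then show ?thesis using assms by (simp add: volterra_parts_def)
qed

lemma volterra_parts_diff:
  assumes K: "regular_kernel T B K Ks" and F: "continuous_on {0..T} F" "continuous_on {0..T} G" and t: "t \<in> {0..T}"
  shows "volterra_parts K Ks (\<lambda>s. F s - G s) t = volterra_parts K Ks F t - volterra_parts K Ks G t"
proof -
  have "integral {0..t} (\<lambda>s. Ks t s * F s - Ks t s * G s) = integral {0..t} (\<lambda>s. Ks t s * F s) - integral {0..t} (\<lambda>s. Ks t s * G s)"
    by (intro integral_diff integrable_continuous_real integrable_volterra_parts[OF K] F t)
  then show ?thesis by (simp add: volterra_parts_def right_diff_distrib)
qed

lemma poly_eq_0_on_interval:
  fixes p :: "real poly"
  assumes "a < b" "\<And>s. s \<in> {a..b} \<Longrightarrow> poly p s = 0"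
  shows "p = 0"
proof -
  have "{a..b} \<subseteq> {s. poly p s = 0}" using assms(2) by blast
  then have "infinite {s. poly p s = 0}" using infinite_Icc[OF assms(1)] by (meson finite_subset)
  then show ?thesis using poly_roots_finite[of p] by auto
qed

text \<open>Replaces orthogonality by \<open>k + 1\<close> moments on each cell, so that the
  discrete problem becomes a finite linear system.\<close>

lemma poly_orth_monomials:
  assumes g: "continuous_on {a..b} g" and z: "\<And>i. i \<le> k \<Longrightarrow> integral {a..b} (\<lambda>s. g s * s ^ i) = 0"
  shows "poly_orth k a b g"
  unfolding poly_orth_def
proof (intro allI impI)
  fix p :: "real poly" assume p: "degree p \<le> k"
  have "integral {a..b} (\<lambda>s. g s * poly p s) = integral {a..b} (\<lambda>s. \<Sum>i\<le>degree p. coeff p i * (g s * s ^ i))"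
    by (rule integral_cong) (simp add: poly_altdef sum_distrib_left mult_ac)
  also have "\<dots> = (\<Sum>i\<le>degree p. integral {a..b} (\<lambda>s. coeff p i * (g s * s ^ i)))"
    by (intro integral_sum integrable_continuous_real continuous_on_mult continuous_on_const g continuous_on_power continuous_on_id) simp
  also have "\<dots> = 0" using z p by (intro sum.neutral) simp
  finally show "integral {a..b} (\<lambda>s. g s * poly p s) = 0" .
qed

text \<open>\<open>k\<close> stands for \<open>m - 1\<close>, and each \<open>L\<close> for the
  derivative of its \<open>K\<close> in the second argument. The bound \<kappa> treats the two
  diagonals separately, because they enter two separate stability estimates.\<close>

locale dg_kernels =
  fixes T \<kappa> B11 B12 B21 :: real and K11 L11 K12 L12 K21 L21 :: "real \<Rightarrow> real \<Rightarrow> real" and k :: nat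
  assumes T: "T > 0" and \<kappa>: "\<kappa> > 0"
    and R11: "regular_kernel T B11 K11 L11" and R12: "regular_kernel T B12 K12 L12" and R21: "regular_kernel T B21 K21 L21"
    and nz12: "\<And>t. t \<in> {0..T} \<Longrightarrow> \<bar>K12 t t\<bar> \<ge> \<kappa>" and nz21: "\<And>t. t \<in> {0..T} \<Longrightarrow> \<bar>K21 t t\<bar> \<ge> \<kappa>"
begin

abbreviation "J11 \<equiv> volterra_parts K11 L11"
abbreviation "J12 \<equiv> volterra_parts K12 L12"
abbreviation "J21 \<equiv> volterra_parts K21 L21"

definition dg_orth :: "nat \<Rightarrow> (nat \<Rightarrow> real poly) \<Rightarrow> (nat \<Rightarrow> real poly) \<Rightarrow> (nat \<Rightarrow> real poly) \<Rightarrow>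
    (real \<Rightarrow> real) \<Rightarrow> (real \<Rightarrow> real) \<Rightarrow> bool" where
  "dg_orth N P1 A1 A2 f1 f2 \<longleftrightarrow> (\<forall>n<N.
     poly_orth k (mesh_pt T N n) (mesh_pt T N (Suc n))
       (\<lambda>s. poly (P1 n) s + (J11 (piecewise_poly T N A1) s + J12 (piecewise_poly T N A2) s) - f1 s) \<and>
     poly_orth k (mesh_pt T N n) (mesh_pt T N (Suc n)) (\<lambda>s. J21 (piecewise_poly T N A1) s - f2 s))"

lemma dg_solution_imp_orth:
  assumes N: "N > 0" and cf: "continuous_on {0..T} f1" "continuous_on {0..T} f2"
    and sol: "dg_solution T N (Suc k) K11 K12 K21 f1 f2 u1 u2"
  obtains P1 P2 A1 A2 where "piecewise_primitive T N k P1 A1" "piecewise_primitive T N k P2 A2"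
    "\<And>s. s \<in> {0..T} \<Longrightarrow> u1 s = piecewise_poly T N P1 s" "\<And>s. s \<in> {0..T} \<Longrightarrow> u2 s = piecewise_poly T N P2 s"
    "dg_orth N P1 A1 A2 f1 f2"
proof -
  have u: "u1 \<in> dg_space T N (Suc k)" "u2 \<in> dg_space T N (Suc k)" using sol by (simp_all add: dg_solution_def)
  obtain P1 where P1: "\<And>n. degree (P1 n) \<le> k" "\<And>s. s \<in> {0..T} \<Longrightarrow> u1 s = piecewise_poly T N P1 s"
    by (rule dg_space_piecewise[OF T N u(1)]) blast
  obtain P2 where P2: "\<And>n. degree (P2 n) \<le> k" "\<And>s. s \<in> {0..T} \<Longrightarrow> u2 s = piecewise_poly T N P2 s"
    by (rule dg_space_piecewise[OF T N u(2)]) blast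
  obtain A1 where A1: "piecewise_primitive T N k P1 A1" by (rule piecewise_primitive_exists[OF T N P1(1)])
  obtain A2 where A2: "piecewise_primitive T N k P2 A2" by (rule piecewise_primitive_exists[OF T N P2(1)])
  have i: "((\<lambda>s. K t s * u s) has_integral volterra_parts K Ks (piecewise_poly T N A) t) {0..t}"
    if K: "regular_kernel T B K Ks" and A: "piecewise_primitive T N k P A" and u: "\<And>s. s \<in> {0..T} \<Longrightarrow> u s = piecewise_poly T N P s" and t: "t \<in> {0..T}"
    for B K Ks A P t and u :: "real \<Rightarrow> real"
    by (rule has_integral_eq[OF _ has_integral_volterra_piecewise[OF T N K A t]]) (use u t in auto)
  have "dg_orth N P1 A1 A2 f1 f2"
    using dg_solution_iff[OF T N u P1(2) i[OF R11 A1 P1(2)] i[OF R12 A2 P2(2)] i[OF R21 A1 P1(2)]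
       continuous_on_volterra_parts[OF R11 piecewise_primitiveD(4)[OF A1]]
       continuous_on_volterra_parts[OF R12 piecewise_primitiveD(4)[OF A2]]
       continuous_on_volterra_parts[OF R21 piecewise_primitiveD(4)[OF A1]] cf] sol
    unfolding dg_orth_def by simp
  with A1 A2 P1(2) P2(2) show ?thesis by (rule that)
qed

lemma dg_orth_imp_solution:
  assumes N: "N > 0" and cf: "continuous_on {0..T} f1" "continuous_on {0..T} f2"
    and A: "piecewise_primitive T N k P1 A1" "piecewise_primitive T N k P2 A2" and o: "dg_orth N P1 A1 A2 f1 f2"
  shows "dg_solution T N (Suc k) K11 K12 K21 f1 f2 (restrict (piecewise_poly T N P1) {0..T}) (restrict (piecewise_poly T N P2) {0..T})"
proof -
  let ?u1 = "restrict (piecewise_poly T N P1) {0..T}" and ?u2 = "restrict (piecewise_poly T N P2) {0..T}"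
  have i: "((\<lambda>s. K t s * restrict (piecewise_poly T N P) {0..T} s) has_integral volterra_parts K Ks (piecewise_poly T N A) t) {0..t}"
    if K: "regular_kernel T B K Ks" and A: "piecewise_primitive T N k P A" and t: "t \<in> {0..T}" for B K Ks A P t
    by (rule has_integral_eq[OF _ has_integral_volterra_piecewise[OF T N K A t]]) (use t in auto)
  have u: "?u1 \<in> dg_space T N (Suc k)" "?u2 \<in> dg_space T N (Suc k)"
    using piecewise_poly_in_dg_space[OF T N] piecewise_primitiveD(1) A by blast+
  have eq: "?u1 s = piecewise_poly T N P1 s" if "s \<in> {0..T}" for s using that by simp
  show ?thesis
    using dg_solution_iff[OF T N u eq i[OF R11 A(1)] i[OF R12 A(2)] i[OF R21 A(1)]
       continuous_on_volterra_parts[OF R11 piecewise_primitiveD(4)[OF A(1)]]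
       continuous_on_volterra_parts[OF R12 piecewise_primitiveD(4)[OF A(2)]]
       continuous_on_volterra_parts[OF R21 piecewise_primitiveD(4)[OF A(1)]] cf] o
    unfolding dg_orth_def by (simp only:)
qed

text \<open>The system is triangular: the second equation contains the first component only.
  Stability with residual zero makes \<open>U1\<close> vanish; what is left of the first equation is
  of the first kind for \<open>U2\<close>, and stability applies again.\<close>

lemma dg_homogeneous:
  "\<exists>h0>0. \<forall>N P1 P2 A1 A2. N > 0 \<longrightarrow> T / real N < h0 \<longrightarrow>
     piecewise_primitive T N k P1 A1 \<longrightarrow> piecewise_primitive T N k P2 A2 \<longrightarrow>
     dg_orth N P1 A1 A2 (\<lambda>_. 0) (\<lambda>_. 0) \<longrightarrow> (\<forall>n<N. P1 n = 0 \<and> P2 n = 0)"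
proof -
  obtain C1 h1 where h1: "h1 > 0" and S1: "volterra_stable T k K21 L21 C1 h1"
    using volterra_stability[OF R21 T \<kappa>, of k] nz21 by blast
  obtain C2 h2 where h2: "h2 > 0" and S2: "volterra_stable T k K12 L12 C2 h2"
    using volterra_stability[OF R12 T \<kappa>, of k] nz12 by blast
  have main: "P1 n = 0 \<and> P2 n = 0"
    if N: "N > 0" and h: "T / real N < min h1 h2" and A: "piecewise_primitive T N k P1 A1" "piecewise_primitive T N k P2 A2"
      and o: "dg_orth N P1 A1 A2 (\<lambda>_. 0) (\<lambda>_. 0)" and n: "n < N" for N P1 P2 A1 A2 n
  proof -
    have zero: "P n = 0 \<and> A n = 0" if A: "piecewise_primitive T N k P A" and z: "\<And>s. s \<in> {0..T} \<Longrightarrow> piecewise_poly T N A s = 0"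
      and n: "n < N" for P A n
    proof -
      have "A n = 0"
      proof (rule poly_eq_0_on_interval[OF mesh_cell_nonempty[OF T N, of n]])
        fix s assume s: "s \<in> {mesh_pt T N n..mesh_pt T N (Suc n)}"
        then have "s \<in> {0..T}" using mesh_cell_subset[OF T n] by blast
        then show "poly (A n) s = 0" using z piecewise_primitiveD(6)[OF A n s] by simp
      qed
      then show ?thesis using piecewise_primitiveD(3)[OF A, of n] by simp
    qed
    let ?U1 = "piecewise_poly T N A1" and ?U2 = "piecewise_poly T N A2"
    have "\<bar>?U1 s\<bar> \<le> C1 * 0 * real N" if "s \<in> {0..T}" for s
      by (rule volterra_stableD[where r="\<lambda>_ _. 0", OF S1 N _ piecewise_primitiveD(4,5)[OF A(1)] piecewise_primitiveD(2,6)[OF A(1)]])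
        (use h o that in \<open>auto simp: dg_orth_def\<close>)
    then have U1: "?U1 s = 0" if "s \<in> {0..T}" for s using that by fastforce
    have r2: "poly_orth k (mesh_pt T N n) (mesh_pt T N (Suc n)) (\<lambda>s. J12 ?U2 s - 0)" if n: "n < N" for n
    proof -
      have "poly_orth k (mesh_pt T N n) (mesh_pt T N (Suc n)) (\<lambda>s. poly (P1 n) s + (J11 ?U1 s + J12 ?U2 s) - 0)"
        using o n by (simp add: dg_orth_def)
      then show "poly_orth k (mesh_pt T N n) (mesh_pt T N (Suc n)) (\<lambda>s. J12 ?U2 s - 0)"
      proof (rule poly_orth_cong)
        fix s assume "s \<in> {mesh_pt T N n..mesh_pt T N (Suc n)}"
        then have sI: "s \<in> {0..T}" using mesh_cell_subset[OF T n] by blast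
        show "poly (P1 n) s + (J11 ?U1 s + J12 ?U2 s) - 0 = J12 ?U2 s - 0"
          using zero[OF A(1) U1 n] volterra_parts_zero[OF sI U1] by simp
      qed
    qed
    have "\<bar>?U2 s\<bar> \<le> C2 * 0 * real N" if "s \<in> {0..T}" for s
      by (rule volterra_stableD[where r="\<lambda>_ _. 0", OF S2 N _ piecewise_primitiveD(4,5)[OF A(2)] piecewise_primitiveD(2,6)[OF A(2)]])
        (use h r2 that in auto)
    then have U2: "?U2 s = 0" if "s \<in> {0..T}" for s using that by fastforce
    show ?thesis using zero[OF A(1) U1 n] zero[OF A(2) U2 n] by blast
  qed
  show ?thesis
  proof (rule exI[of _ "min h1 h2"], rule conjI)
    show "min h1 h2 > 0" using h1 h2 by simp
  qed (intro allI impI, rule main; assumption)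
qed

text \<open>By linearity, the difference of two solutions satisfies the homogeneous orthogonality
  conditions.\<close>

lemma dg_unique:
  "\<exists>h0>0. \<forall>N f1 f2 u1 u2 v1 v2. N > 0 \<longrightarrow> T / real N < h0 \<longrightarrow> continuous_on {0..T} f1 \<longrightarrow> continuous_on {0..T} f2 \<longrightarrow>
     dg_solution T N (Suc k) K11 K12 K21 f1 f2 u1 u2 \<longrightarrow> dg_solution T N (Suc k) K11 K12 K21 f1 f2 v1 v2 \<longrightarrow>
     u1 = v1 \<and> u2 = v2"
proof -
  obtain h0 where h0: "h0 > 0" and H: "\<forall>N P1 P2 A1 A2. N > 0 \<longrightarrow> T / real N < h0 \<longrightarrow>
     piecewise_primitive T N k P1 A1 \<longrightarrow> piecewise_primitive T N k P2 A2 \<longrightarrow>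
     dg_orth N P1 A1 A2 (\<lambda>_. 0) (\<lambda>_. 0) \<longrightarrow> (\<forall>n<N. P1 n = 0 \<and> P2 n = 0)"
    using dg_homogeneous by (elim exE conjE) (rule that)
  have main: "u1 = v1 \<and> u2 = v2"
    if N: "N > 0" and h: "T / real N < h0" and cf: "continuous_on {0..T} f1" "continuous_on {0..T} f2"
      and u: "dg_solution T N (Suc k) K11 K12 K21 f1 f2 u1 u2" and v: "dg_solution T N (Suc k) K11 K12 K21 f1 f2 v1 v2"
    for N f1 f2 u1 u2 v1 v2
  proof -
    obtain P1 P2 A1 A2 where P: "piecewise_primitive T N k P1 A1" "piecewise_primitive T N k P2 A2"
      "\<And>s. s \<in> {0..T} \<Longrightarrow> u1 s = piecewise_poly T N P1 s" "\<And>s. s \<in> {0..T} \<Longrightarrow> u2 s = piecewise_poly T N P2 s"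
      "dg_orth N P1 A1 A2 f1 f2" by (rule dg_solution_imp_orth[OF N cf u]) blast
    obtain Q1 Q2 B1 B2 where Q: "piecewise_primitive T N k Q1 B1" "piecewise_primitive T N k Q2 B2"
      "\<And>s. s \<in> {0..T} \<Longrightarrow> v1 s = piecewise_poly T N Q1 s" "\<And>s. s \<in> {0..T} \<Longrightarrow> v2 s = piecewise_poly T N Q2 s"
      "dg_orth N Q1 B1 B2 f1 f2" by (rule dg_solution_imp_orth[OF N cf v]) blast
    note c = piecewise_primitiveD(4)[OF P(1)] piecewise_primitiveD(4)[OF P(2)]
      piecewise_primitiveD(4)[OF Q(1)] piecewise_primitiveD(4)[OF Q(2)]
    have J: "volterra_parts K Ks (piecewise_poly T N (\<lambda>n. A n - B n)) s
        = volterra_parts K Ks (piecewise_poly T N A) s - volterra_parts K Ks (piecewise_poly T N B) s"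
      if "regular_kernel T b K Ks" "continuous_on {0..T} (piecewise_poly T N A)" "continuous_on {0..T} (piecewise_poly T N B)" "s \<in> {0..T}"
      for b K Ks A B s
      using volterra_parts_diff[OF that] by (simp add: piecewise_poly_diff[abs_def])
    have "dg_orth N (\<lambda>n. P1 n - Q1 n) (\<lambda>n. A1 n - B1 n) (\<lambda>n. A2 n - B2 n) (\<lambda>_. 0) (\<lambda>_. 0)"
      unfolding dg_orth_def
    proof (intro allI impI conjI)
      fix n assume n: "n < N"
      let ?c = "{mesh_pt T N n..mesh_pt T N (Suc n)}"
      note sub = mesh_cell_subset[OF T n]
      have cc: "continuous_on ?c g" if "continuous_on {0..T} g" for g :: "real \<Rightarrow> real" by (rule continuous_on_subset[OF that sub])
      note cJ = continuous_on_volterra_parts[OF R11 c(1)] continuous_on_volterra_parts[OF R11 c(3)]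
        continuous_on_volterra_parts[OF R12 c(2)] continuous_on_volterra_parts[OF R12 c(4)]
        continuous_on_volterra_parts[OF R21 c(1)] continuous_on_volterra_parts[OF R21 c(3)]
      have "poly_orth k (mesh_pt T N n) (mesh_pt T N (Suc n))
        (\<lambda>s. (poly (P1 n) s + (J11 (piecewise_poly T N A1) s + J12 (piecewise_poly T N A2) s) - f1 s)
          - (poly (Q1 n) s + (J11 (piecewise_poly T N B1) s + J12 (piecewise_poly T N B2) s) - f1 s))"
        by (rule poly_orth_diff)
          (use P(5) Q(5) n in \<open>auto simp: dg_orth_def intro!: continuous_on_diff continuous_on_add continuous_on_poly_real cc cJ cf\<close>)
      then show "poly_orth k (mesh_pt T N n) (mesh_pt T N (Suc n))
        (\<lambda>s. poly (P1 n - Q1 n) s + (J11 (piecewise_poly T N (\<lambda>n. A1 n - B1 n)) s + J12 (piecewise_poly T N (\<lambda>n. A2 n - B2 n)) s) - 0)"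
      proof (rule poly_orth_cong)
        fix s assume "s \<in> ?c"
        then have sI: "s \<in> {0..T}" using sub by blast
        show "(poly (P1 n) s + (J11 (piecewise_poly T N A1) s + J12 (piecewise_poly T N A2) s) - f1 s)
          - (poly (Q1 n) s + (J11 (piecewise_poly T N B1) s + J12 (piecewise_poly T N B2) s) - f1 s)
          = poly (P1 n - Q1 n) s + (J11 (piecewise_poly T N (\<lambda>n. A1 n - B1 n)) s + J12 (piecewise_poly T N (\<lambda>n. A2 n - B2 n)) s) - 0"
          unfolding J[OF R11 c(1,3) sI] J[OF R12 c(2,4) sI] by simp
      qed
      have "poly_orth k (mesh_pt T N n) (mesh_pt T N (Suc n))
        (\<lambda>s. (J21 (piecewise_poly T N A1) s - f2 s) - (J21 (piecewise_poly T N B1) s - f2 s))"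
        by (rule poly_orth_diff)
          (use P(5) Q(5) n in \<open>auto simp: dg_orth_def intro!: continuous_on_diff cc cJ cf\<close>)
      then show "poly_orth k (mesh_pt T N n) (mesh_pt T N (Suc n)) (\<lambda>s. J21 (piecewise_poly T N (\<lambda>n. A1 n - B1 n)) s - 0)"
      proof (rule poly_orth_cong)
        fix s assume "s \<in> ?c"
        then have sI: "s \<in> {0..T}" using sub by blast
        show "(J21 (piecewise_poly T N A1) s - f2 s) - (J21 (piecewise_poly T N B1) s - f2 s) = J21 (piecewise_poly T N (\<lambda>n. A1 n - B1 n)) s - 0"
          unfolding J[OF R21 c(1,3) sI] by simp
      qed
    qed
    then have eq: "\<forall>n<N. P1 n - Q1 n = 0 \<and> P2 n - Q2 n = 0"
      by (intro H[THEN spec, THEN spec, THEN spec, THEN spec, THEN spec, THEN mp, THEN mp, THEN mp, THEN mp, THEN mp,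
        OF N h piecewise_primitive_diff[OF P(1) Q(1)] piecewise_primitive_diff[OF P(2) Q(2)]])
    have pw: "piecewise_poly T N P s = piecewise_poly T N Q s" if PQ: "\<forall>n<N. P n = Q n" and s: "s \<in> {0..T}" for P Q s
    proof (cases "s = 0")
      case True then show ?thesis using piecewise_poly_0[OF T] PQ N by simp
    next
      case False
      then have "0 < s" "s \<le> T" using s by auto
      then obtain n where n: "n < N" "s \<in> {mesh_pt T N n<..mesh_pt T N (Suc n)}" by (rule half_open_cell_exists[OF T N])
      then show ?thesis using piecewise_poly_cell[OF T, of N n s] PQ by simp
    qed
    \<comment> \<open>Members of the DG space are extensional, so agreement on the interval is
      equality of functions.\<close>
    have ext: "f = g" if "f \<in> dg_space T N (Suc k)" "g \<in> dg_space T N (Suc k)" "\<And>s. s \<in> {0..T} \<Longrightarrow> f s = g s" for f g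
      by (rule extensionalityI[of _ "{0..T}"]) (use that in \<open>auto simp: dg_space_def\<close>)
    have "u1 = v1" using u v P(3) Q(3) pw[of P1 Q1] eq by (intro ext) (auto simp: dg_solution_def)
    moreover have "u2 = v2" using u v P(4) Q(4) pw[of P2 Q2] eq by (intro ext) (auto simp: dg_solution_def)
    ultimately show ?thesis by blast
  qed
  show ?thesis by (rule exI[of _ h0], rule conjI[OF h0]) (intro allI impI, rule main; assumption)
qed

end

text \<open>The matrix statement recast for a linear map on families of coefficients. Such families
  are total functions, so \<Phi> is asked to ignore what lies outside \<open>C\<close>.\<close>

lemma linear_system_solvable:
  fixes \<Phi> :: "('j \<Rightarrow> real) \<Rightarrow> 'j \<Rightarrow> real"
  assumes fin: "finite C"
    and lin: "\<And>a b x r. r \<in> C \<Longrightarrow> \<Phi> (\<lambda>j. a j + x * b j) r = \<Phi> a r + x * \<Phi> b r"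
    and ext: "\<And>a r. r \<in> C \<Longrightarrow> \<Phi> a r = \<Phi> (\<lambda>j. if j \<in> C then a j else 0) r"
    and inj: "\<And>a. (\<And>r. r \<in> C \<Longrightarrow> \<Phi> a r = 0) \<Longrightarrow> \<forall>j\<in>C. a j = 0"
  shows "\<exists>a. \<forall>r\<in>C. \<Phi> a r = b r"
proof -
  define \<delta> where "\<delta> = (\<lambda>(i :: 'j) j. if j = i then 1 else 0 :: real)"
  have part: "\<Phi> (\<lambda>j. if j \<in> S then a j else 0) r = (\<Sum>j\<in>S. \<Phi> (\<delta> j) r * a j)" if "finite S" "r \<in> C" for S a r
    using that(1)
  proof (induction S rule: finite_induct)
    case empty
    \<comment> \<open>Linearity with factor \<open>-1\<close> at the zero family makes \<Phi> vanish
      there.\<close>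
    show ?case using lin[OF that(2), of "\<lambda>_. 0" "-1" "\<lambda>_. 0"] by simp
  next
    case (insert i S)
    have "(\<lambda>j. if j \<in> insert i S then a j else 0) = (\<lambda>j. (if j \<in> S then a j else 0) + a i * \<delta> i j)"
      using insert.hyps by (auto simp: \<delta>_def fun_eq_iff)
    then show ?case using lin[OF that(2), of "\<lambda>j. if j \<in> S then a j else 0" "a i" "\<delta> i"] insert by simp
  qed
  have full: "\<Phi> a r = (\<Sum>j\<in>C. \<Phi> (\<delta> j) r * a j)" if "r \<in> C" for a r
    using ext[OF that, of a] part[OF fin that, of a] by simp
  have "\<exists>a. \<forall>r\<in>C. (\<Sum>j\<in>C. \<Phi> (\<delta> j) r * a j) = b r"
    by (rule square_linear_system[OF fin fin refl]) (use inj full in auto)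
  then show ?thesis using full by auto
qed

text \<open>An unknown is labelled by component, cell and power, with \<open>False\<close> for the
  first component and \<open>True\<close> for the second. The value \<open>0\<close> from index
  \<open>N\<close> on keeps the number of coefficients finite.\<close>

definition coefficient_poly :: "nat \<Rightarrow> nat \<Rightarrow> (bool \<times> nat \<times> nat \<Rightarrow> real) \<Rightarrow> bool \<Rightarrow> nat \<Rightarrow> real poly" where
  "coefficient_poly N k a c n = (if n < N then \<Sum>i\<le>k. monom (a (c, n, i)) i else 0)"

lemma degree_coefficient_poly: "degree (coefficient_poly N k a c n) \<le> k"
proof -
  have "degree (\<Sum>i\<le>k. monom (a (c, n, i)) i) \<le> k"
    by (rule degree_sum_le) (auto intro: order_trans[OF degree_monom_le])
  then show ?thesis by (simp add: coefficient_poly_def)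
qed

lemma coeff_coefficient_poly: "n < N \<Longrightarrow> i \<le> k \<Longrightarrow> coeff (coefficient_poly N k a c n) i = a (c, n, i)"
  by (simp add: coefficient_poly_def coeff_sum)

lemma poly_coefficient_poly_linear:
  "poly (coefficient_poly N k (\<lambda>j. a j + x * b j) c n) s
     = poly (coefficient_poly N k a c n) s + x * poly (coefficient_poly N k b c n) s"
  by (simp add: coefficient_poly_def poly_sum poly_monom sum.distrib sum_distrib_left algebra_simps)

context dg_kernels
begin

text \<open>Left sides of the discrete equations. Here the Boolean labels the equation,
  \<open>True\<close> being the second one, so that equations and unknowns share one index set and
  the system is square.\<close>

definition dg_residual :: "nat \<Rightarrow> (bool \<times> nat \<times> nat \<Rightarrow> real) \<Rightarrow> bool \<Rightarrow> nat \<Rightarrow> real \<Rightarrow> real" where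
  "dg_residual N a c n s =
    (if c then integral {0..s} (\<lambda>\<tau>. K21 s \<tau> * piecewise_poly T N (coefficient_poly N k a False) \<tau>)
     else poly (coefficient_poly N k a False n) s
       + (integral {0..s} (\<lambda>\<tau>. K11 s \<tau> * piecewise_poly T N (coefficient_poly N k a False) \<tau>)
        + integral {0..s} (\<lambda>\<tau>. K12 s \<tau> * piecewise_poly T N (coefficient_poly N k a True) \<tau>)))"

lemma dg_residual_eq:
  assumes N: "N > 0" and s: "s \<in> {0..T}"
    and A: "piecewise_primitive T N k (coefficient_poly N k a False) A1" "piecewise_primitive T N k (coefficient_poly N k a True) A2"
  shows "dg_residual N a False n s = poly (coefficient_poly N k a False n) s + (J11 (piecewise_poly T N A1) s + J12 (piecewise_poly T N A2) s)"
    "dg_residual N a True n s = J21 (piecewise_poly T N A1) s"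
  using has_integral_volterra_piecewise[OF T N R11 A(1) s, THEN integral_unique]
    has_integral_volterra_piecewise[OF T N R12 A(2) s, THEN integral_unique]
    has_integral_volterra_piecewise[OF T N R21 A(1) s, THEN integral_unique]
  by (simp_all add: dg_residual_def)

lemma continuous_on_dg_residual:
  assumes N: "N > 0"
  shows "continuous_on {0..T} (dg_residual N a c n)"
proof -
  obtain A1 where A1: "piecewise_primitive T N k (coefficient_poly N k a False) A1"
    by (rule piecewise_primitive_exists[OF T N degree_coefficient_poly])
  obtain A2 where A2: "piecewise_primitive T N k (coefficient_poly N k a True) A2"
    by (rule piecewise_primitive_exists[OF T N degree_coefficient_poly])
  note cJ = continuous_on_volterra_parts[OF R11 piecewise_primitiveD(4)[OF A1]]
    continuous_on_volterra_parts[OF R12 piecewise_primitiveD(4)[OF A2]]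
    continuous_on_volterra_parts[OF R21 piecewise_primitiveD(4)[OF A1]]
  have "continuous_on {0..T} (\<lambda>s. poly (coefficient_poly N k a False n) s + (J11 (piecewise_poly T N A1) s + J12 (piecewise_poly T N A2) s))"
    by (intro continuous_on_add continuous_on_poly_real cJ)
  then have F: "continuous_on {0..T} (dg_residual N a False n)"
    by (rule continuous_on_cong[THEN iffD1, OF refl, rotated]) (simp only: dg_residual_eq(1)[OF N _ A1 A2])
  from cJ(3) have "continuous_on {0..T} (dg_residual N a True n)"
    by (rule continuous_on_cong[THEN iffD1, OF refl, rotated]) (simp only: dg_residual_eq(2)[OF N _ A1 A2])
  with F show ?thesis by (cases c) simp_all
qed

lemma dg_residual_linear:
  assumes N: "N > 0" and s: "s \<in> {0..T}"
  shows "dg_residual N (\<lambda>j. a j + x * b j) c n s = dg_residual N a c n s + x * dg_residual N b c n s"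
proof -
  have pw: "piecewise_poly T N (coefficient_poly N k (\<lambda>j. a j + x * b j) e) \<tau>
      = piecewise_poly T N (coefficient_poly N k a e) \<tau> + x * piecewise_poly T N (coefficient_poly N k b e) \<tau>" for e \<tau>
    by (simp add: piecewise_poly_def poly_coefficient_poly_linear)
  have int: "(\<lambda>\<tau>. K s \<tau> * piecewise_poly T N (coefficient_poly N k a e) \<tau>) integrable_on {0..s}"
    if K: "regular_kernel T B K Ks" for B K Ks a e
  proof -
    obtain A where "piecewise_primitive T N k (coefficient_poly N k a e) A"
      by (rule piecewise_primitive_exists[OF T N degree_coefficient_poly])
    from has_integral_volterra_piecewise[OF T N K this s] show ?thesis by (rule has_integral_integrable)
  qed
  have I: "integral {0..s} (\<lambda>\<tau>. K s \<tau> * piecewise_poly T N (coefficient_poly N k (\<lambda>j. a j + x * b j) e) \<tau>)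
     = integral {0..s} (\<lambda>\<tau>. K s \<tau> * piecewise_poly T N (coefficient_poly N k a e) \<tau>)
      + x * integral {0..s} (\<lambda>\<tau>. K s \<tau> * piecewise_poly T N (coefficient_poly N k b e) \<tau>)"
    if K: "regular_kernel T B K Ks" for B K Ks e
  proof -
    have "integral {0..s} (\<lambda>\<tau>. K s \<tau> * piecewise_poly T N (coefficient_poly N k (\<lambda>j. a j + x * b j) e) \<tau>)
       = integral {0..s} (\<lambda>\<tau>. K s \<tau> * piecewise_poly T N (coefficient_poly N k a e) \<tau>
          + x * (K s \<tau> * piecewise_poly T N (coefficient_poly N k b e) \<tau>))"
      by (rule integral_cong) (simp add: pw algebra_simps)
    also have "\<dots> = integral {0..s} (\<lambda>\<tau>. K s \<tau> * piecewise_poly T N (coefficient_poly N k a e) \<tau>)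
        + integral {0..s} (\<lambda>\<tau>. x * (K s \<tau> * piecewise_poly T N (coefficient_poly N k b e) \<tau>))"
      by (intro integral_add int[OF K] integrable_on_mult_right)
    finally show ?thesis by simp
  qed
  show ?thesis
    unfolding dg_residual_def I[OF R11] I[OF R12] I[OF R21] poly_coefficient_poly_linear
    by (simp add: algebra_simps)
qed

text \<open>Moments up to the power \<open>k\<close> for two equations on \<open>N\<close> cells are
  as many as the coefficients of two piecewise polynomials, and for small \<open>h\<close> the
  homogeneous system has only the zero solution.\<close>

lemma dg_exists:
  "\<exists>h0>0. \<forall>N f1 f2. N > 0 \<longrightarrow> T / real N < h0 \<longrightarrow> continuous_on {0..T} f1 \<longrightarrow> continuous_on {0..T} f2 \<longrightarrow>
     (\<exists>u1 u2. dg_solution T N (Suc k) K11 K12 K21 f1 f2 u1 u2)"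
proof -
  obtain h0 where h0: "h0 > 0" and H: "\<forall>N P1 P2 A1 A2. N > 0 \<longrightarrow> T / real N < h0 \<longrightarrow>
     piecewise_primitive T N k P1 A1 \<longrightarrow> piecewise_primitive T N k P2 A2 \<longrightarrow>
     dg_orth N P1 A1 A2 (\<lambda>_. 0) (\<lambda>_. 0) \<longrightarrow> (\<forall>n<N. P1 n = 0 \<and> P2 n = 0)"
    using dg_homogeneous by (elim exE conjE) (rule that)
  have main: "\<exists>u1 u2. dg_solution T N (Suc k) K11 K12 K21 f1 f2 u1 u2"
    if N: "N > 0" and h: "T / real N < h0" and cf: "continuous_on {0..T} f1" "continuous_on {0..T} f2" for N f1 f2
  proof -
    let ?c = "\<lambda>n. {mesh_pt T N n..mesh_pt T N (Suc n)}"
    define C where "C = (UNIV :: bool set) \<times> {..<N} \<times> {..k}"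
    define \<Phi> where "\<Phi> = (\<lambda>a (c, n, i). integral (?c n) (\<lambda>s. dg_residual N a c n s * s ^ i))"
    define f where "f = (\<lambda>c. if c then f2 else f1)"
    have cf': "continuous_on {0..T} (f c)" for c using cf by (simp add: f_def)
    have cc: "continuous_on (?c n) g" if "continuous_on {0..T} g" "n < N" for g :: "real \<Rightarrow> real" and n
      by (rule continuous_on_subset[OF that(1) mesh_cell_subset[OF T that(2)]])
    have cr: "continuous_on (?c n) (\<lambda>s. g s * s ^ i)" if "continuous_on {0..T} g" "n < N" for g :: "real \<Rightarrow> real" and n i
      by (intro continuous_on_mult continuous_on_power continuous_on_id cc that)
    have orth: "poly_orth k (mesh_pt T N n) (mesh_pt T N (Suc n)) (\<lambda>s. dg_residual N a c n s - g c s)"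
      if a: "\<And>r. r \<in> C \<Longrightarrow> \<Phi> a r = (case r of (c, n, i) \<Rightarrow> integral (?c n) (\<lambda>s. g c s * s ^ i))"
        and g: "continuous_on {0..T} (g c)" and n: "n < N" for a g c n
    proof (rule poly_orth_monomials)
      show "continuous_on (?c n) (\<lambda>s. dg_residual N a c n s - g c s)"
        by (intro continuous_on_diff cc continuous_on_dg_residual N g n)
      fix i assume i: "i \<le> k"
      have "integral (?c n) (\<lambda>s. dg_residual N a c n s * s ^ i) = integral (?c n) (\<lambda>s. g c s * s ^ i)"
        using a[of "(c, n, i)"] i n by (simp add: C_def \<Phi>_def)
      moreover have "integral (?c n) (\<lambda>s. dg_residual N a c n s * s ^ i - g c s * s ^ i)
         = integral (?c n) (\<lambda>s. dg_residual N a c n s * s ^ i) - integral (?c n) (\<lambda>s. g c s * s ^ i)"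
        by (intro integral_diff integrable_continuous_real cr continuous_on_dg_residual N g n)
      ultimately show "integral (?c n) (\<lambda>s. (dg_residual N a c n s - g c s) * s ^ i) = 0"
        by (simp add: left_diff_distrib)
    qed
    have dg: "dg_orth N (coefficient_poly N k a False) A1 A2 (g False) (g True)"
      if a: "\<And>r. r \<in> C \<Longrightarrow> \<Phi> a r = (case r of (c, n, i) \<Rightarrow> integral (?c n) (\<lambda>s. g c s * s ^ i))"
        and g: "\<And>c. continuous_on {0..T} (g c)"
        and A: "piecewise_primitive T N k (coefficient_poly N k a False) A1" "piecewise_primitive T N k (coefficient_poly N k a True) A2"
      for a g A1 A2
      unfolding dg_orth_def
    proof (intro allI impI conjI)
      fix n assume n: "n < N"
      have sI: "s \<in> {0..T}" if "s \<in> ?c n" for s using that mesh_cell_subset[OF T n] by blast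
      show "poly_orth k (mesh_pt T N n) (mesh_pt T N (Suc n)) (\<lambda>s. poly (coefficient_poly N k a False n) s
           + (J11 (piecewise_poly T N A1) s + J12 (piecewise_poly T N A2) s) - g False s)"
        by (rule poly_orth_cong[OF orth[of a g False n, OF a g n]]) (simp_all only: dg_residual_eq(1)[OF N sI A])
      show "poly_orth k (mesh_pt T N n) (mesh_pt T N (Suc n)) (\<lambda>s. J21 (piecewise_poly T N A1) s - g True s)"
        by (rule poly_orth_cong[OF orth[of a g True n, OF a g n]]) (simp_all only: dg_residual_eq(2)[OF N sI A])
    qed
    have "\<exists>a. \<forall>r\<in>C. \<Phi> a r = (case r of (c, n, i) \<Rightarrow> integral (?c n) (\<lambda>s. f c s * s ^ i))"
    proof (rule linear_system_solvable)
      show "finite C" by (simp add: C_def)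
      fix a b x and r :: "bool \<times> nat \<times> nat" assume "r \<in> C"
      then obtain c n i where r: "r = (c, n, i)" "n < N" "i \<le> k" by (auto simp: C_def)
      have "integral (?c n) (\<lambda>s. dg_residual N (\<lambda>j. a j + x * b j) c n s * s ^ i)
         = integral (?c n) (\<lambda>s. dg_residual N a c n s * s ^ i + x * (dg_residual N b c n s * s ^ i))"
        by (rule integral_cong) (use mesh_cell_subset[OF T r(2)] in \<open>auto simp: dg_residual_linear[OF N] algebra_simps\<close>)
      also have "\<dots> = integral (?c n) (\<lambda>s. dg_residual N a c n s * s ^ i) + integral (?c n) (\<lambda>s. x * (dg_residual N b c n s * s ^ i))"
        by (intro integral_add integrable_on_mult_right integrable_continuous_real cr continuous_on_dg_residual N r(2))
      finally show "\<Phi> (\<lambda>j. a j + x * b j) r = \<Phi> a r + x * \<Phi> b r" by (simp add: \<Phi>_def r(1))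
    next
      fix a and r :: "bool \<times> nat \<times> nat" assume "r \<in> C"
      have "coefficient_poly N k (\<lambda>j. if j \<in> C then a j else 0) c n = coefficient_poly N k a c n" for c n
        by (auto simp: coefficient_poly_def C_def intro!: sum.cong)
      then have "coefficient_poly N k (\<lambda>j. if j \<in> C then a j else 0) = coefficient_poly N k a" by (simp add: fun_eq_iff)
      then show "\<Phi> a r = \<Phi> (\<lambda>j. if j \<in> C then a j else 0) r"
        by (simp only: \<Phi>_def dg_residual_def[abs_def])
    next
      fix a assume a: "\<And>r. r \<in> C \<Longrightarrow> \<Phi> a r = 0"
      obtain A1 where A1: "piecewise_primitive T N k (coefficient_poly N k a False) A1"
        by (rule piecewise_primitive_exists[OF T N degree_coefficient_poly])
      obtain A2 where A2: "piecewise_primitive T N k (coefficient_poly N k a True) A2"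
        by (rule piecewise_primitive_exists[OF T N degree_coefficient_poly])
      have "dg_orth N (coefficient_poly N k a False) A1 A2 ((\<lambda>_ _. 0) False) ((\<lambda>_ _. 0) True)"
        by (rule dg[of a "\<lambda>_ _. 0", OF _ _ A1 A2]) (use a in auto)
      then have z: "\<forall>n<N. coefficient_poly N k a False n = 0 \<and> coefficient_poly N k a True n = 0"
        by (intro H[THEN spec, THEN spec, THEN spec, THEN spec, THEN spec, THEN mp, THEN mp, THEN mp, THEN mp, THEN mp, OF N h A1 A2])
      show "\<forall>j\<in>C. a j = 0"
      proof
        fix j assume "j \<in> C"
        then obtain c n i where j: "j = (c, n, i)" "n < N" "i \<le> k" by (auto simp: C_def)
        have "coefficient_poly N k a c n = 0" using z j(2) by (cases c) auto
        then show "a j = 0" using coeff_coefficient_poly[OF j(2,3), of a c] j(1) by simp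
      qed
    qed
    then obtain a where a: "\<And>r. r \<in> C \<Longrightarrow> \<Phi> a r = (case r of (c, n, i) \<Rightarrow> integral (?c n) (\<lambda>s. f c s * s ^ i))" by blast
    obtain A1 where A1: "piecewise_primitive T N k (coefficient_poly N k a False) A1"
      by (rule piecewise_primitive_exists[OF T N degree_coefficient_poly])
    obtain A2 where A2: "piecewise_primitive T N k (coefficient_poly N k a True) A2"
      by (rule piecewise_primitive_exists[OF T N degree_coefficient_poly])
    have "dg_orth N (coefficient_poly N k a False) A1 A2 (f False) (f True)"
      by (rule dg[OF a cf' A1 A2])
    then have "dg_orth N (coefficient_poly N k a False) A1 A2 f1 f2" by (simp add: f_def)
    from dg_orth_imp_solution[OF N cf A1 A2 this] show ?thesis by blast
  qed
  show ?thesis by (rule exI[of _ h0], rule conjI[OF h0]) (intro allI impI, rule main; assumption)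
qed

lemma dg_uniquely_solvable:
  assumes cf: "continuous_on {0..T} f1" "continuous_on {0..T} f2"
  shows "\<exists>hbar>0. dg_uniquely_solvable_below hbar T (Suc k) K11 K12 K21 f1 f2"
proof -
  obtain h1 where h1: "h1 > 0" and U: "\<forall>N f1 f2 u1 u2 v1 v2. N > 0 \<longrightarrow> T / real N < h1 \<longrightarrow> continuous_on {0..T} f1 \<longrightarrow> continuous_on {0..T} f2 \<longrightarrow>
     dg_solution T N (Suc k) K11 K12 K21 f1 f2 u1 u2 \<longrightarrow> dg_solution T N (Suc k) K11 K12 K21 f1 f2 v1 v2 \<longrightarrow>
     u1 = v1 \<and> u2 = v2"
    using dg_unique by (elim exE conjE) (rule that)
  obtain h2 where h2: "h2 > 0" and E: "\<forall>N f1 f2. N > 0 \<longrightarrow> T / real N < h2 \<longrightarrow> continuous_on {0..T} f1 \<longrightarrow> continuous_on {0..T} f2 \<longrightarrow>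
     (\<exists>u1 u2. dg_solution T N (Suc k) K11 K12 K21 f1 f2 u1 u2)"
    using dg_exists by (elim exE conjE) (rule that)
  have "dg_uniquely_solvable_below (min h1 h2) T (Suc k) K11 K12 K21 f1 f2"
    unfolding dg_uniquely_solvable_below_def
  proof (intro allI impI)
    fix N :: nat assume N: "2 \<le> N" and h: "T / real N < min h1 h2"
    have N0: "N > 0" using N by simp
    have "\<exists>u1 u2. dg_solution T N (Suc k) K11 K12 K21 f1 f2 u1 u2"
      by (rule E[rule_format, OF N0 _ cf]) (use h in simp)
    then obtain u1 u2 where u: "dg_solution T N (Suc k) K11 K12 K21 f1 f2 u1 u2" by (elim exE)
    show "\<exists>!u. dg_solution T N (Suc k) K11 K12 K21 f1 f2 (fst u) (snd u)"
    proof (rule ex1I[of _ "(u1, u2)"])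
      fix v assume v: "dg_solution T N (Suc k) K11 K12 K21 f1 f2 (fst v) (snd v)"
      have "fst v = u1 \<and> snd v = u2" by (rule U[rule_format, OF N0 _ cf v u]) (use h in simp)
      then show "v = (u1, u2)" by (simp add: prod_eq_iff)
    qed (use u in simp)
  qed
  then show ?thesis using h1 h2 by (intro exI[of _ "min h1 h2"]) simp
qed

end

section \<open>Convergence\<close>

lemma piecewise_poly_cell_closed:
  assumes T: "T > 0" and N: "N > 0" and s: "s \<in> {0..T}"
  obtains n where "n < N" "s \<in> {mesh_pt T N n..mesh_pt T N (Suc n)}" "\<And>P. piecewise_poly T N P s = poly (P n) s"
proof (cases "s = 0")
  case True
  show ?thesis by (rule that[of 0]) (use True N piecewise_poly_0[OF T] mesh_pt_nonneg[OF T] in auto)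
next
  case False
  then have "0 < s" "s \<le> T" using s by auto
  then obtain n where "n < N" "s \<in> {mesh_pt T N n<..mesh_pt T N (Suc n)}" by (rule half_open_cell_exists[OF T N])
  then show ?thesis by (intro that[of n]) (auto intro: piecewise_poly_cell[OF T])
qed

context dg_kernels
begin

lemma has_integral_volterra_continuous:
  assumes K: "regular_kernel T B K Ks" and x: "continuous_on {0..T} x" and t: "t \<in> {0..T}"
  shows "((\<lambda>s. K t s * x s) has_integral volterra_parts K Ks (\<lambda>s. integral {0..s} x) t) {0..t}"
proof (rule has_integral_volterra_parts[OF K t _ _ finite.emptyI])
  show "continuous_on {0..T} (\<lambda>s. integral {0..s} x)"
    by (rule DERIV_continuous_on[OF integral_has_real_derivative[OF x]])
  fix s assume s: "s \<in> {0<..<T} - {}"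
  have "((\<lambda>s. integral {0..s} x) has_real_derivative x s) (at s within {0..T})"
    by (rule integral_has_real_derivative[OF x]) (use s in auto)
  moreover have "at s within {0..T} = at s" by (rule at_within_interior) (use s in simp)
  ultimately show "((\<lambda>s. integral {0..s} x) has_real_derivative x s) (at s)" by simp
qed simp

text \<open>With the comparison function \<open>Z\<close> the error splits by
  \<open>W = Z - X\<close> and \<open>G = Z - U\<close>. The residual for \<open>G1\<close> has the
  size \<open>h * |W1|\<close>. That for \<open>G2\<close> contains the error of \<open>x1\<close>
  itself, where orthogonality brings no gain: \<open>h ^ \<rho>\<close> is multiplied by
  \<open>N\<close>, and differentiation divides it by \<open>h\<close> once more.\<close>

lemma dg_error_estimate:
  assumes x: "Ck_on (k + 2) {0..T} x1" "Ck_on (k + 2) {0..T} x2"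
    and sol: "iae_solution T K11 K12 K21 f1 f2 x1 x2"
    and cf: "continuous_on {0..T} f1" "continuous_on {0..T} f2"
    and \<rho>: "\<rho> = (if even k then k + 1 else k)"
  shows "\<exists>C\<ge>0. \<exists>h0>0. \<forall>N u1 u2. N > 0 \<longrightarrow> T / real N < h0 \<longrightarrow> dg_solution T N (Suc k) K11 K12 K21 f1 f2 u1 u2 \<longrightarrow>
     (\<forall>s\<in>{0..T}. \<bar>x1 s - u1 s\<bar> \<le> C * (T / real N) ^ \<rho> \<and> \<bar>x2 s - u2 s\<bar> \<le> C * ((T / real N) ^ \<rho> / (T / real N)\<^sup>2))"
proof -
  note B = regular_kernelD(1)[OF R11] regular_kernelD(1)[OF R12] regular_kernelD(1)[OF R21]
  have cx: "continuous_on {0..T} x1" "continuous_on {0..T} x2" using x[THEN Ck_on_imp_continuous_on] by auto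
  define X1 where "X1 = (\<lambda>s. integral {0..s} x1)"
  define X2 where "X2 = (\<lambda>s. integral {0..s} x2)"
  have cP: "continuous_on {0..T} (\<lambda>s. integral {0..s} x)" if "continuous_on {0..T} x" for x :: "real \<Rightarrow> real"
    by (rule DERIV_continuous_on[OF integral_has_real_derivative[OF that]])
  have cX: "continuous_on {0..T} X1" "continuous_on {0..T} X2" using cP[OF cx(1)] cP[OF cx(2)] by (simp_all add: X1_def X2_def)
  have f1: "f1 s = x1 s + (J11 X1 s + J12 X2 s)" if s: "s \<in> {0..T}" for s
  proof -
    have "integral {0..s} (\<lambda>\<tau>. K11 s \<tau> * x1 \<tau> + K12 s \<tau> * x2 \<tau>) = J11 X1 s + J12 X2 s"
      unfolding X1_def X2_def
      by (rule integral_unique[OF has_integral_add[OF has_integral_volterra_continuous[OF R11 cx(1) s] has_integral_volterra_continuous[OF R12 cx(2) s]]])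
    moreover have "x1 s + integral {0..s} (\<lambda>\<tau>. K11 s \<tau> * x1 \<tau> + K12 s \<tau> * x2 \<tau>) = f1 s"
      using sol s unfolding iae_solution_def by blast
    ultimately show ?thesis by simp
  qed
  have f2: "f2 s = J21 X1 s" if s: "s \<in> {0..T}" for s
  proof -
    have "integral {0..s} (\<lambda>\<tau>. K21 s \<tau> * x1 \<tau>) = f2 s" using sol s unfolding iae_solution_def by blast
    then show ?thesis
      using integral_unique[OF has_integral_volterra_continuous[OF R21 cx(1) s]] by (simp add: X1_def)
  qed
  have Xe: "integral {0..s} x1 = X1 s" "integral {0..s} x2 = X2 s" for s by (simp_all add: X1_def X2_def)
  obtain CV1 where CV1: "CV1 \<ge> 0" and V1ex: "\<forall>N>0. \<exists>V. orthogonal_interpolant T N k X1 V \<and>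
     (\<forall>n<N. \<forall>s\<in>{mesh_pt T N n..mesh_pt T N (Suc n)}.
        \<bar>poly (V n) s - X1 s\<bar> \<le> CV1 * (T / real N) ^ (\<rho> + 1) \<and>
        \<bar>poly (pderiv (V n)) s - x1 s\<bar> \<le> CV1 * (T / real N) ^ \<rho>)"
    using orthogonal_interpolant_bounds[OF T x(1), unfolded Xe, folded \<rho>] by (elim exE conjE) (rule that)
  obtain CV2 where CV2: "CV2 \<ge> 0" and V2ex: "\<forall>N>0. \<exists>V. orthogonal_interpolant T N k X2 V \<and>
     (\<forall>n<N. \<forall>s\<in>{mesh_pt T N n..mesh_pt T N (Suc n)}.
        \<bar>poly (V n) s - X2 s\<bar> \<le> CV2 * (T / real N) ^ (\<rho> + 1) \<and>
        \<bar>poly (pderiv (V n)) s - x2 s\<bar> \<le> CV2 * (T / real N) ^ \<rho>)"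
    using orthogonal_interpolant_bounds[OF T x(2), unfolded Xe, folded \<rho>] by (elim exE conjE) (rule that)
  obtain C1 h1 where C1: "C1 \<ge> 0" and h1: "h1 > 0" and S1: "volterra_stable T k K21 L21 C1 h1"
    using volterra_stability[OF R21 T \<kappa>, of k] nz21 by blast
  obtain C2 h2 where C2: "C2 \<ge> 0" and h2: "h2 > 0" and S2: "volterra_stable T k K12 L12 C2 h2"
    using volterra_stability[OF R12 T \<kappa>, of k] nz12 by blast
  obtain CM where CM: "CM \<ge> 0" and Mk: "\<forall>a b (p::real poly) M. a < b \<longrightarrow> degree p \<le> Suc k \<longrightarrow> (\<forall>s\<in>{a..b}. \<bar>poly p s\<bar> \<le> M) \<longrightarrow>
     (\<forall>s\<in>{a..b}. \<bar>poly (pderiv p) s\<bar> \<le> CM * M / (b - a))"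
    using poly_markov_inequality[of "Suc k"] by (elim exE conjE) (rule that)
  \<comment> \<open>\<open>g1\<close> bounds \<open>G1\<close> in units of
    \<open>h ^ (\<rho> + 1)\<close>, \<open>c1\<close> the error of \<open>x1\<close> and
    \<open>c2\<close> the residual for \<open>G2\<close> in units of \<open>h ^ \<rho>\<close>, and
    \<open>c3\<close> the error of \<open>x2\<close> in units of
    \<open>h ^ \<rho> / h ^ 2\<close>.\<close>
  define g1 where "g1 = C1 * ((2 + T) * B21 * CV1) * T"
  define c1 where "c1 = CV1 + CM * g1"
  define c2 where "c2 = B12 * (1 + T) * CV2 * T + c1 + B11 * (1 + T) * (g1 + CV1) * T"
  define c3 where "c3 = CV2 * T\<^sup>2 + CM * (C2 * c2 * T)"
  define C where "C = c1 + c3"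
  have g1: "g1 \<ge> 0" using C1 B CV1 T by (simp add: g1_def)
  have c1: "c1 \<ge> 0" using CV1 CM g1 by (simp add: c1_def)
  have c2: "c2 \<ge> 0" using B CV1 CV2 T c1 g1 by (simp add: c2_def)
  have c3: "c3 \<ge> 0" using CV2 T CM C2 c2 by (simp add: c3_def)
  have main: "\<bar>x1 s - u1 s\<bar> \<le> C * (T / real N) ^ \<rho> \<and> \<bar>x2 s - u2 s\<bar> \<le> C * ((T / real N) ^ \<rho> / (T / real N)\<^sup>2)"
    if N: "N > 0" and hN: "T / real N < min h1 h2" and dg: "dg_solution T N (Suc k) K11 K12 K21 f1 f2 u1 u2" and s: "s \<in> {0..T}"
    for N u1 u2 s
  proof -
    let ?t = "mesh_pt T N"
    let ?c = "\<lambda>n. {?t n..?t (Suc n)}"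
    define h where "h = T / real N"
    have h: "h > 0" using T N by (simp add: h_def)
    have hT: "h \<le> T" using N T by (simp add: h_def field_simps)
    have hN': "h * real N = T" using N by (simp add: h_def)
    have tS: "?t (Suc n) = ?t n + h" for n by (simp add: mesh_pt_Suc h_def)
    note lt = mesh_cell_nonempty[OF T N]
    have cellI: "s \<in> {0..T}" if "n < N" "s \<in> ?c n" for n s using mesh_cell_subset[OF T that(1)] that(2) by blast
    have cc: "continuous_on (?c n) g" if "continuous_on {0..T} g" "n < N" for g :: "real \<Rightarrow> real" and n
      by (rule continuous_on_subset[OF that(1) mesh_cell_subset[OF T that(2)]])
    have hpow: "h ^ (\<rho> + 1) \<le> T * h ^ \<rho>" using hT h by (auto intro!: mult_right_mono)
    obtain P1 P2 A1 A2 where P: "piecewise_primitive T N k P1 A1" "piecewise_primitive T N k P2 A2"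
      "\<And>s. s \<in> {0..T} \<Longrightarrow> u1 s = piecewise_poly T N P1 s" "\<And>s. s \<in> {0..T} \<Longrightarrow> u2 s = piecewise_poly T N P2 s"
      "dg_orth N P1 A1 A2 f1 f2" by (rule dg_solution_imp_orth[OF N cf dg]) blast
    define U1 where "U1 = piecewise_poly T N A1"
    define U2 where "U2 = piecewise_poly T N A2"
    have cU: "continuous_on {0..T} U1" "continuous_on {0..T} U2"
      using piecewise_primitiveD(4)[OF P(1)] piecewise_primitiveD(4)[OF P(2)] by (simp_all add: U1_def U2_def)
    have o1: "poly_orth k (?t n) (?t (Suc n)) (\<lambda>s. poly (P1 n) s + (J11 U1 s + J12 U2 s) - f1 s)"
      and o2: "poly_orth k (?t n) (?t (Suc n)) (\<lambda>s. J21 U1 s - f2 s)" if "n < N" for n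
      using P(5) that by (simp_all add: dg_orth_def U1_def U2_def)
    obtain V1 where V1: "\<forall>n<N. degree (V1 n) \<le> Suc k \<and> poly_orth k (?t n) (?t (Suc n)) (\<lambda>s. poly (V1 n) s - X1 s)"
     "poly (V1 0) 0 = 0" "\<forall>n. Suc n < N \<longrightarrow> poly (V1 (Suc n)) (?t (Suc n)) = poly (V1 n) (?t (Suc n))"
     "\<forall>n<N. \<forall>s\<in>?c n. \<bar>poly (V1 n) s - X1 s\<bar> \<le> CV1 * h ^ (\<rho> + 1) \<and> \<bar>poly (pderiv (V1 n)) s - x1 s\<bar> \<le> CV1 * h ^ \<rho>"
      using V1ex[THEN spec[of _ N], THEN mp, OF N, folded h_def] unfolding orthogonal_interpolant_def by blast
    obtain V2 where V2: "\<forall>n<N. degree (V2 n) \<le> Suc k \<and> poly_orth k (?t n) (?t (Suc n)) (\<lambda>s. poly (V2 n) s - X2 s)"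
     "poly (V2 0) 0 = 0" "\<forall>n. Suc n < N \<longrightarrow> poly (V2 (Suc n)) (?t (Suc n)) = poly (V2 n) (?t (Suc n))"
     "\<forall>n<N. \<forall>s\<in>?c n. \<bar>poly (V2 n) s - X2 s\<bar> \<le> CV2 * h ^ (\<rho> + 1) \<and> \<bar>poly (pderiv (V2 n)) s - x2 s\<bar> \<le> CV2 * h ^ \<rho>"
      using V2ex[THEN spec[of _ N], THEN mp, OF N, folded h_def] unfolding orthogonal_interpolant_def by blast
    define Z1 where "Z1 = piecewise_poly T N V1"
    define Z2 where "Z2 = piecewise_poly T N V2"
    have Z1: "Z1 s = poly (V1 n) s" if "n < N" "s \<in> ?c n" for n s
      unfolding Z1_def by (rule piecewise_poly_glued[OF T _ that]) (use V1(3) in blast)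
    have Z2: "Z2 s = poly (V2 n) s" if "n < N" "s \<in> ?c n" for n s
      unfolding Z2_def by (rule piecewise_poly_glued[OF T _ that]) (use V2(3) in blast)
    have cZ: "continuous_on {0..T} Z1" "continuous_on {0..T} Z2"
      unfolding Z1_def Z2_def using V1(3) V2(3) by (intro continuous_on_piecewise_poly_glued[OF T N]; blast)+
    have Z0: "Z1 0 = 0" "Z2 0 = 0" using piecewise_poly_0[OF T] V1(2) V2(2) by (simp_all add: Z1_def Z2_def)
    define W1 where "W1 = (\<lambda>s. Z1 s - X1 s)"
    define W2 where "W2 = (\<lambda>s. Z2 s - X2 s)"
    have cW: "continuous_on {0..T} W1" "continuous_on {0..T} W2"
      unfolding W1_def W2_def by (intro continuous_on_diff cZ cX)+
    have W1b: "\<bar>W1 s\<bar> \<le> CV1 * h ^ (\<rho> + 1)" if s: "s \<in> {0..T}" for s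
    proof -
      obtain n where n: "n < N" "s \<in> ?c n" using mesh_cell_exists[OF T N s] .
      then show ?thesis using V1(4) Z1[OF n] by (simp add: W1_def del: power_Suc)
    qed
    have W2b: "\<bar>W2 s\<bar> \<le> CV2 * h ^ (\<rho> + 1)" if s: "s \<in> {0..T}" for s
    proof -
      obtain n where n: "n < N" "s \<in> ?c n" using mesh_cell_exists[OF T N s] .
      then show ?thesis using V2(4) Z2[OF n] by (simp add: W2_def del: power_Suc)
    qed
    have oW: "poly_orth k (?t n) (?t (Suc n)) W1" if n: "n < N" for n
    proof (rule poly_orth_cong)
      show "poly_orth k (?t n) (?t (Suc n)) (\<lambda>s. poly (V1 n) s - X1 s)" using V1(1) n by blast
    qed (use Z1[OF n] in \<open>simp add: W1_def\<close>)
    define G1 where "G1 = (\<lambda>s. Z1 s - U1 s)"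
    define G2 where "G2 = (\<lambda>s. Z2 s - U2 s)"
    have cG: "continuous_on {0..T} G1" "continuous_on {0..T} G2"
      unfolding G1_def G2_def by (intro continuous_on_diff cZ cU)+
    have G0: "G1 0 = 0" "G2 0 = 0"
      using Z0 piecewise_primitiveD(5)[OF P(1)] piecewise_primitiveD(5)[OF P(2)] by (simp_all add: G1_def G2_def U1_def U2_def)
    have Gp: "G1 s = poly (V1 n - A1 n) s" "G2 s = poly (V2 n - A2 n) s" if n: "n < N" "s \<in> ?c n" for n s
      using Z1[OF n] Z2[OF n] piecewise_primitiveD(6)[OF P(1) n] piecewise_primitiveD(6)[OF P(2) n]
      by (simp_all add: G1_def G2_def U1_def U2_def)
    have degG: "degree (V1 n - A1 n) \<le> Suc k" "degree (V2 n - A2 n) \<le> Suc k" if "n < N" for n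
      using that V1(1) V2(1) piecewise_primitiveD(2)[OF P(1), of n] piecewise_primitiveD(2)[OF P(2), of n]
      by (auto intro: degree_diff_le)
    note J21c = continuous_on_volterra_parts[OF R21] note J12c = continuous_on_volterra_parts[OF R12]
    note J11c = continuous_on_volterra_parts[OF R11]
    \<comment> \<open>The subtracted term is a multiple of \<open>W1\<close>, orthogonal on the
      cell, so it can be removed without affecting the equation; what remains is of order
      \<open>h * |W1|\<close>.\<close>
    define r1 where "r1 = (\<lambda>n s. J21 W1 s - K21 (?t n) (?t n) * W1 s)"
    have G1b: "\<bar>G1 s\<bar> \<le> g1 * h ^ (\<rho> + 1)" if s: "s \<in> {0..T}" for s
    proof -
      have "\<bar>G1 s\<bar> \<le> C1 * ((2 + T) * B21 * (CV1 * h ^ (\<rho> + 1)) * h) * real N"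
      proof (rule volterra_stableD[where r=r1, OF S1 N _ cG(1) G0(1) degG(1) Gp(1) _ _ _ s])
        show "T / real N < h1" using hN by simp
        fix n assume n: "n < N"
        show "continuous_on (?c n) (r1 n)" unfolding r1_def
          by (intro continuous_on_diff continuous_on_mult continuous_on_const cc[OF _ n] J21c cW)
        show "\<bar>r1 n s\<bar> \<le> (2 + T) * B21 * (CV1 * h ^ (\<rho> + 1)) * h" if "s \<in> ?c n" for s
          unfolding r1_def h_def by (rule volterra_parts_orthogonal[OF R21 T cW(1) W1b[unfolded h_def] oW n that])
        have "poly_orth k (?t n) (?t (Suc n)) (\<lambda>s. K21 (?t n) (?t n) * W1 s - (J21 U1 s - f2 s))"
          by (rule poly_orth_diff[OF _ _ poly_orth_cmult[OF oW[OF n]] o2[OF n]])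
            (intro continuous_on_diff continuous_on_mult continuous_on_const cc[OF _ n] J21c cW cU cf)+
        then show "poly_orth k (?t n) (?t (Suc n)) (\<lambda>s. J21 G1 s - r1 n s)"
        proof (rule poly_orth_cong)
          fix s assume "s \<in> ?c n"
          then have sI: "s \<in> {0..T}" using cellI n by blast
          have "J21 G1 s = J21 Z1 s - J21 U1 s" unfolding G1_def by (rule volterra_parts_diff[OF R21 cZ(1) cU(1) sI])
          moreover have "J21 W1 s = J21 Z1 s - J21 X1 s" unfolding W1_def by (rule volterra_parts_diff[OF R21 cZ(1) cX(1) sI])
          ultimately show "K21 (?t n) (?t n) * W1 s - (J21 U1 s - f2 s) = J21 G1 s - r1 n s"
            by (simp add: r1_def f2[OF sI])
        qed
      qed
      \<comment> \<open>The extra \<open>h\<close> of this residual cancels the factor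
        \<open>N\<close> of the stability estimate.\<close>
      also have "\<dots> = C1 * ((2 + T) * B21 * CV1) * (h * real N) * h ^ (\<rho> + 1)" by (simp add: mult_ac)
      also have "\<dots> = g1 * h ^ (\<rho> + 1)" unfolding hN' g1_def ..
      finally show ?thesis .
    qed
    have mk: "\<bar>poly (pderiv p) s\<bar> \<le> CM * b / h"
      if "n < N" "degree p \<le> Suc k" "\<And>s. s \<in> ?c n \<Longrightarrow> \<bar>poly p s\<bar> \<le> b" "s \<in> ?c n" for p :: "real poly" and n b s
    proof -
      have "\<forall>s\<in>?c n. \<bar>poly (pderiv p) s\<bar> \<le> CM * b / (?t (Suc n) - ?t n)"
        by (rule Mk[THEN spec, THEN spec, THEN spec, THEN spec, THEN mp, THEN mp, THEN mp, OF lt that(2)]) (use that(3) in blast)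
      then show ?thesis using that(4) by (simp add: tS)
    qed
    have e1: "\<bar>x1 s - poly (P1 n) s\<bar> \<le> c1 * h ^ \<rho>" if n: "n < N" "s \<in> ?c n" for n s
    proof -
      have "\<bar>poly (pderiv (V1 n - A1 n)) s\<bar> \<le> CM * (g1 * h ^ (\<rho> + 1)) / h"
        by (rule mk[OF n(1) degG(1)[OF n(1)] _ n(2)]) (use G1b Gp(1)[OF n(1)] cellI[OF n(1)] in metis)
      also have "\<dots> = CM * g1 * h ^ \<rho>" using h by simp
      finally have "\<bar>poly (pderiv (V1 n)) s - poly (P1 n) s\<bar> \<le> CM * g1 * h ^ \<rho>"
        using piecewise_primitiveD(3)[OF P(1), of n] by (simp add: pderiv_diff)
      moreover have "\<bar>poly (pderiv (V1 n)) s - x1 s\<bar> \<le> CV1 * h ^ \<rho>" using V1(4) n by blast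
      ultimately show ?thesis unfolding c1_def distrib_right by linarith
    qed
    define E1 where "E1 = (\<lambda>s. X1 s - U1 s)"
    have cE: "continuous_on {0..T} E1" unfolding E1_def by (intro continuous_on_diff cX cU)
    have E1b: "\<bar>E1 s\<bar> \<le> (g1 + CV1) * h ^ (\<rho> + 1)" if "s \<in> {0..T}" for s
    proof -
      have "E1 s = G1 s - W1 s" by (simp add: E1_def G1_def W1_def)
      then show ?thesis using G1b[OF that] W1b[OF that] unfolding distrib_right by linarith
    qed
    \<comment> \<open>The error of \<open>x1\<close> dominates here, being
      \<open>O(h ^ \<rho>)\<close>, whereas both memory terms are
      \<open>O(h ^ (\<rho> + 1))\<close>.\<close>
    define r2 where "r2 = (\<lambda>n s. J12 W2 s - (x1 s - poly (P1 n) s) - J11 E1 s)"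
    have G2b: "\<bar>G2 s\<bar> \<le> C2 * (c2 * h ^ \<rho>) * real N" if s: "s \<in> {0..T}" for s
    proof (rule volterra_stableD[where r=r2, OF S2 N _ cG(2) G0(2) degG(2) Gp(2) _ _ _ s])
      show "T / real N < h2" using hN by simp
      fix n assume n: "n < N"
      show "continuous_on (?c n) (r2 n)" unfolding r2_def
        by (intro continuous_on_diff continuous_on_poly_real cc[OF _ n] J12c J11c cW cE cx)
      show "\<bar>r2 n s\<bar> \<le> c2 * h ^ \<rho>" if s: "s \<in> ?c n" for s
      proof -
        have sI: "s \<in> {0..T}" by (rule cellI[OF n s])
        have 1: "\<bar>J12 W2 s\<bar> \<le> B12 * (1 + T) * (CV2 * h ^ (\<rho> + 1))" by (rule abs_volterra_parts_le[OF R12 cW(2) sI W2b])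
        have 2: "\<bar>J11 E1 s\<bar> \<le> B11 * (1 + T) * ((g1 + CV1) * h ^ (\<rho> + 1))" by (rule abs_volterra_parts_le[OF R11 cE sI E1b])
        have "B12 * (1 + T) * (CV2 * h ^ (\<rho> + 1)) \<le> B12 * (1 + T) * (CV2 * (T * h ^ \<rho>))"
          using B T CV2 hpow by (intro mult_left_mono) auto
        moreover have "B11 * (1 + T) * ((g1 + CV1) * h ^ (\<rho> + 1)) \<le> B11 * (1 + T) * ((g1 + CV1) * (T * h ^ \<rho>))"
          using B T CV1 g1 hpow by (intro mult_left_mono) auto
        ultimately have "\<bar>r2 n s\<bar> \<le> B12 * (1 + T) * (CV2 * (T * h ^ \<rho>)) + c1 * h ^ \<rho> + B11 * (1 + T) * ((g1 + CV1) * (T * h ^ \<rho>))"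
          using 1 2 e1[OF n s] unfolding r2_def by linarith
        also have "\<dots> = c2 * h ^ \<rho>" by (simp add: c2_def algebra_simps)
        finally show ?thesis .
      qed
      have "poly_orth k (?t n) (?t (Suc n)) (\<lambda>s. (- 1) * (poly (P1 n) s + (J11 U1 s + J12 U2 s) - f1 s))"
        by (rule poly_orth_cmult[OF o1[OF n]])
      then show "poly_orth k (?t n) (?t (Suc n)) (\<lambda>s. J12 G2 s - r2 n s)"
      proof (rule poly_orth_cong)
        fix s assume "s \<in> ?c n"
        then have sI: "s \<in> {0..T}" using cellI n by blast
        have "J12 G2 s = J12 Z2 s - J12 U2 s" unfolding G2_def by (rule volterra_parts_diff[OF R12 cZ(2) cU(2) sI])
        moreover have "J12 W2 s = J12 Z2 s - J12 X2 s" unfolding W2_def by (rule volterra_parts_diff[OF R12 cZ(2) cX(2) sI])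
        moreover have "J11 E1 s = J11 X1 s - J11 U1 s" unfolding E1_def by (rule volterra_parts_diff[OF R11 cX(1) cU(1) sI])
        ultimately show "(- 1) * (poly (P1 n) s + (J11 U1 s + J12 U2 s) - f1 s) = J12 G2 s - r2 n s"
          by (simp add: r2_def f1[OF sI])
      qed
    qed
    have e2: "\<bar>x2 s - poly (P2 n) s\<bar> \<le> c3 * (h ^ \<rho> / h\<^sup>2)" if n: "n < N" "s \<in> ?c n" for n s
    proof -
      have "\<bar>poly (pderiv (V2 n - A2 n)) s\<bar> \<le> CM * (C2 * (c2 * h ^ \<rho>) * real N) / h"
        by (rule mk[OF n(1) degG(2)[OF n(1)] _ n(2)]) (use G2b Gp(2)[OF n(1)] cellI[OF n(1)] in metis)
      also have "\<dots> = CM * (C2 * c2 * (h * real N)) * (h ^ \<rho> / h\<^sup>2)"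
        using h by (simp add: power2_eq_square)
      finally have "\<bar>poly (pderiv (V2 n)) s - poly (P2 n) s\<bar> \<le> CM * (C2 * c2 * T) * (h ^ \<rho> / h\<^sup>2)"
        unfolding hN' using piecewise_primitiveD(3)[OF P(2), of n] by (simp add: pderiv_diff)
      moreover have "\<bar>poly (pderiv (V2 n)) s - x2 s\<bar> \<le> CV2 * h ^ \<rho>" using V2(4) n by blast
      \<comment> \<open>The interpolation error is better by two powers of \<open>h\<close>; since
        \<open>h <= T\<close>, these are replaced by the constant \<open>T ^ 2\<close>.\<close>
      moreover have "CV2 * h ^ \<rho> \<le> CV2 * T\<^sup>2 * (h ^ \<rho> / h\<^sup>2)"
      proof -
        have "h\<^sup>2 \<le> T\<^sup>2" using hT h by (intro power_mono) auto
        then have "h\<^sup>2 * (h ^ \<rho> / h\<^sup>2) \<le> T\<^sup>2 * (h ^ \<rho> / h\<^sup>2)" using h by (intro mult_right_mono) auto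
        moreover have "h\<^sup>2 * (h ^ \<rho> / h\<^sup>2) = h ^ \<rho>" using h by simp
        ultimately show ?thesis using CV2 mult_left_mono[of "h ^ \<rho>" "T\<^sup>2 * (h ^ \<rho> / h\<^sup>2)" CV2] by (simp only: mult.assoc)
      qed
      ultimately show ?thesis unfolding c3_def distrib_right by linarith
    qed
    obtain n where n: "n < N" "s \<in> ?c n" "\<And>P. piecewise_poly T N P s = poly (P n) s"
      by (rule piecewise_poly_cell_closed[OF T N s]) blast
    have "c1 * h ^ \<rho> \<le> C * h ^ \<rho>" using c3 h by (intro mult_right_mono) (auto simp: C_def)
    moreover have "c3 * (h ^ \<rho> / h\<^sup>2) \<le> C * (h ^ \<rho> / h\<^sup>2)" using c1 h by (intro mult_right_mono) (auto simp: C_def)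
    ultimately show ?thesis
      using e1[OF n(1,2)] e2[OF n(1,2)] P(3)[OF s] P(4)[OF s] n(3) unfolding h_def by simp
  qed
  have "min h1 h2 > 0" "C \<ge> 0" using h1 h2 c1 c3 by (auto simp: C_def)
  then show ?thesis
    by (intro exI[of _ C] exI[of _ "min h1 h2"] conjI) (assumption | intro allI impI ballI; rule main; assumption)+
qed

end

section \<open>Coarse meshes and the final bound\<close>

lemma dg_space_bounded:
  assumes T: "T > 0" and N: "N > 0" and u: "u \<in> dg_space T N (Suc k)"
  obtains D where "D \<ge> 0" "\<And>s. s \<in> {0..T} \<Longrightarrow> \<bar>u s\<bar> \<le> D"
proof -
  obtain P where P: "\<And>s. s \<in> {0..T} \<Longrightarrow> u s = piecewise_poly T N P s"
    by (rule dg_space_piecewise[OF T N u]) blast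
  have "\<exists>b\<ge>0. \<forall>s\<in>{0..T}. \<bar>poly (P n) s\<bar> \<le> b" for n
    using continuous_bounded_interval[OF continuous_on_poly_real, of 0 T "P n"] by metis
  then obtain b where b: "\<And>n. b n \<ge> 0" "\<And>n s. s \<in> {0..T} \<Longrightarrow> \<bar>poly (P n) s\<bar> \<le> b n" by metis
  have "\<bar>u s\<bar> \<le> (\<Sum>n<N. b n)" if s: "s \<in> {0..T}" for s
  proof -
    obtain n where n: "n < N" "\<And>P. piecewise_poly T N P s = poly (P n) s"
      by (rule piecewise_poly_cell_closed[OF T N s]) blast
    have "\<bar>u s\<bar> \<le> b n" using P[OF s] n(2) b(2)[OF s] by simp
    also have "b n \<le> (\<Sum>n<N. b n)" by (rule member_le_sum) (use n(1) b(1) in auto)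
    finally show ?thesis .
  qed
  then show ?thesis by (intro that[of "\<Sum>n<N. b n"] sum_nonneg b(1))
qed

text \<open>On one fixed mesh the solution is a single bounded function, so any positive bounds are
  met with a suitable constant, which here may depend on the mesh.\<close>

lemma unique_solution_error_bounded:
  assumes T: "T > 0" and N: "N > 0" and cx: "continuous_on {0..T} x1" "continuous_on {0..T} x2"
    and uni: "\<exists>!u. dg_solution T N (Suc k) K11 K12 K21 f1 f2 (fst u) (snd u)" and e: "e1 > 0" "e2 > 0"
  shows "\<exists>E\<ge>0. \<forall>u1 u2. dg_solution T N (Suc k) K11 K12 K21 f1 f2 u1 u2 \<longrightarrow>
    (\<forall>s\<in>{0..T}. \<bar>x1 s - u1 s\<bar> \<le> E * e1 \<and> \<bar>x2 s - u2 s\<bar> \<le> E * e2)"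
proof -
  obtain u where u: "dg_solution T N (Suc k) K11 K12 K21 f1 f2 (fst u) (snd u)"
    and only: "\<And>v. dg_solution T N (Suc k) K11 K12 K21 f1 f2 (fst v) (snd v) \<Longrightarrow> v = u"
    using uni by (elim ex1E) blast
  obtain D1 where D1: "D1 \<ge> 0" "\<And>s. s \<in> {0..T} \<Longrightarrow> \<bar>fst u s\<bar> \<le> D1"
    by (rule dg_space_bounded[OF T N, of "fst u" k]) (use u in \<open>auto simp: dg_solution_def\<close>)
  obtain D2 where D2: "D2 \<ge> 0" "\<And>s. s \<in> {0..T} \<Longrightarrow> \<bar>snd u s\<bar> \<le> D2"
    by (rule dg_space_bounded[OF T N, of "snd u" k]) (use u in \<open>auto simp: dg_solution_def\<close>)
  obtain M1 where M1: "M1 \<ge> 0" "\<And>s. s \<in> {0..T} \<Longrightarrow> \<bar>x1 s\<bar> \<le> M1"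
    by (rule continuous_bounded_interval[OF cx(1)]) blast
  obtain M2 where M2: "M2 \<ge> 0" "\<And>s. s \<in> {0..T} \<Longrightarrow> \<bar>x2 s\<bar> \<le> M2"
    by (rule continuous_bounded_interval[OF cx(2)]) blast
  define E where "E = (M1 + D1) / e1 + (M2 + D2) / e2"
  have E: "E \<ge> 0" "M1 + D1 \<le> E * e1" "M2 + D2 \<le> E * e2"
  proof -
    show "E \<ge> 0" using M1(1) M2(1) D1(1) D2(1) e by (simp add: E_def)
    have "E * e1 = (M1 + D1) + (M2 + D2) / e2 * e1" "E * e2 = (M1 + D1) / e1 * e2 + (M2 + D2)"
      using e unfolding E_def by (simp_all only: distrib_right) simp_all
    moreover have "0 \<le> (M2 + D2) / e2 * e1" "0 \<le> (M1 + D1) / e1 * e2"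
      using M1(1) M2(1) D1(1) D2(1) e by simp_all
    ultimately show "M1 + D1 \<le> E * e1" "M2 + D2 \<le> E * e2" by linarith+
  qed
  show ?thesis
  proof (rule exI[of _ E], rule conjI[OF E(1)], intro allI impI ballI)
    fix u1 u2 s assume v: "dg_solution T N (Suc k) K11 K12 K21 f1 f2 u1 u2" and s: "s \<in> {0..T}"
    have "(u1, u2) = u" by (rule only) (use v in simp)
    then have "fst u = u1" "snd u = u2" by auto
    then show "\<bar>x1 s - u1 s\<bar> \<le> E * e1 \<and> \<bar>x2 s - u2 s\<bar> \<le> E * e2"
      using M1(2)[OF s] M2(2)[OF s] D1(2)[OF s] D2(2)[OF s] E(2,3) by auto
  qed
qed

lemma sup_norm_on_le:
  assumes "S \<noteq> {}" "\<And>s. s \<in> S \<Longrightarrow> \<bar>g s\<bar> \<le> c"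
  shows "sup_norm_on S g \<le> c"
  unfolding sup_norm_on_def using assms by (rule cSUP_least)

text \<open>As \<open>hbar\<close> is arbitrary, there may be meshes with
  \<open>h0 <= h < hbar\<close>, for which stability says nothing. They are finitely many, and
  unique solvability gives a finite error on each.\<close>

theorem theorem4p1:
  fixes T k0 :: real and m d :: nat
    and K11 K12 K21 :: "real \<Rightarrow> real \<Rightarrow> real"
    and f1 f2 x1 x2 :: "real \<Rightarrow> real"
  assumes "T > 0"
    and "m \<ge> 1" and "d = m + 2"
    and "f2 0 = 0"
    and "k0 > 0" and "\<forall>t\<in>{0..T}. \<bar>K21 t t * K12 t t\<bar> \<ge> k0"
    and "Ck_on (d + 1) {0..T} f1"
    and "Ck_on (d + 2) {0..T} f2"
    and "Ck_on (d + 1) (kernel_domain T) (\<lambda>(t, s). K11 t s)"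
    and "Ck_on (d + 2) (kernel_domain T) (\<lambda>(t, s). K12 t s)"
    and "Ck_on (d + 2) (kernel_domain T) (\<lambda>(t, s). K21 t s)"
    and "iae_solution T K11 K12 K21 f1 f2 x1 x2"
  shows "Ck_on (m + 2) {0..T} x1 \<and> Ck_on (m + 2) {0..T} x2 \<and>
    (\<exists>hbar>0. dg_uniquely_solvable_below hbar T m K11 K12 K21 f1 f2) \<and>
    (\<forall>hbar>0. dg_uniquely_solvable_below hbar T m K11 K12 K21 f1 f2 \<longrightarrow>
      (\<exists>C. \<forall>N h x1h x2h.
         N \<ge> 2 \<longrightarrow> h = T / real N \<longrightarrow> h < hbar \<longrightarrow>
         dg_solution T N m K11 K12 K21 f1 f2 x1h x2h \<longrightarrow>
           sup_norm_on {0..T} (\<lambda>t. x1 t - x1h t)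
             \<le> C * (if odd m then h ^ m else h ^ (m - 1)) \<and>
           sup_norm_on {0..T} (\<lambda>t. x2 t - x2h t)
             \<le> C * (if odd m then h powi (int m - 2) else h powi (int m - 3))))"
proof -
  note T = \<open>T > 0\<close>
  obtain k where m: "m = Suc k" using \<open>m \<ge> 1\<close> by (cases m) auto
  have nz: "K21 t t \<noteq> 0" "K12 t t \<noteq> 0" if "t \<in> {0..T}" for t
    using assms(5,6) that by force+
  note reg = iae_solution_Ck[OF T nz assms(7-12)]
  have X1: "Ck_on (m + 2) {0..T} x1" by (rule Ck_on_mono[OF reg(1)]) (use assms(3) in auto)
  have X2: "Ck_on (m + 2) {0..T} x2" using reg(2) assms(3) by simp
  obtain B11 L11 where R11: "regular_kernel T B11 K11 L11" by (rule Ck_on_regular_kernel[OF assms(9)]) (use assms(3) in auto)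
  obtain B12 L12 where R12: "regular_kernel T B12 K12 L12" by (rule Ck_on_regular_kernel[OF assms(10)]) (use assms(3) in auto)
  obtain B21 L21 where R21: "regular_kernel T B21 K21 L21" by (rule Ck_on_regular_kernel[OF assms(11)]) (use assms(3) in auto)
  \<comment> \<open>Both diagonals are bounded above, so a lower bound of the product bounds each
    factor from below; the summand \<open>1\<close> keeps the denominator positive.\<close>
  define \<kappa> where "\<kappa> = k0 / (B12 + B21 + 1)"
  have Bpos: "B12 \<ge> 0" "B21 \<ge> 0" using regular_kernelD(1)[OF R12] regular_kernelD(1)[OF R21] .
  have lower: "\<kappa> \<le> \<bar>K12 t t\<bar>" "\<kappa> \<le> \<bar>K21 t t\<bar>" if t: "t \<in> {0..T}" for t
  proof -
    have b: "\<bar>K12 t t\<bar> \<le> B12" "\<bar>K21 t t\<bar> \<le> B21"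
      using regular_kernelD(5)[OF R12, of t t] regular_kernelD(5)[OF R21, of t t] t by (auto simp: mem_kernel_domain)
    have p: "k0 \<le> \<bar>K21 t t\<bar> * \<bar>K12 t t\<bar>" using assms(6) t by (simp add: abs_mult)
    also have "\<dots> \<le> (B12 + B21 + 1) * \<bar>K12 t t\<bar>" using b Bpos by (intro mult_right_mono) auto
    finally show "\<kappa> \<le> \<bar>K12 t t\<bar>" using Bpos by (simp add: \<kappa>_def pos_divide_le_eq mult.commute)
    have "\<bar>K21 t t\<bar> * \<bar>K12 t t\<bar> \<le> \<bar>K21 t t\<bar> * (B12 + B21 + 1)" using b Bpos by (intro mult_left_mono) auto
    with p have "k0 \<le> \<bar>K21 t t\<bar> * (B12 + B21 + 1)" by linarith
    then show "\<kappa> \<le> \<bar>K21 t t\<bar>" using Bpos by (simp add: \<kappa>_def pos_divide_le_eq)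
  qed
  have \<kappa>: "\<kappa> > 0" using assms(5) Bpos by (simp add: \<kappa>_def)
  interpret dg_kernels T \<kappa> B11 B12 B21 K11 L11 K12 L12 K21 L21 k
    by unfold_locales (use T \<kappa> R11 R12 R21 lower in auto)
  have cf: "continuous_on {0..T} f1" "continuous_on {0..T} f2"
    by (rule Ck_on_imp_continuous_on[OF assms(7)]) (rule Ck_on_imp_continuous_on[OF assms(8)])
  \<comment> \<open>In terms of \<open>m = k + 1\<close> this is \<open>m\<close> for odd
    \<open>m\<close> and \<open>m - 1\<close> for even \<open>m\<close>.\<close>
  define \<rho> where "\<rho> = (if even k then k + 1 else k)"
  have x: "Ck_on (k + 2) {0..T} x1" "Ck_on (k + 2) {0..T} x2"
    by (rule Ck_on_mono[OF X1], simp add: m) (rule Ck_on_mono[OF X2], simp add: m)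
  obtain C0 h0 where C0: "C0 \<ge> 0" and h0: "h0 > 0" and est: "\<forall>N u1 u2. N > 0 \<longrightarrow> T / real N < h0 \<longrightarrow> dg_solution T N (Suc k) K11 K12 K21 f1 f2 u1 u2 \<longrightarrow>
     (\<forall>s\<in>{0..T}. \<bar>x1 s - u1 s\<bar> \<le> C0 * (T / real N) ^ \<rho> \<and> \<bar>x2 s - u2 s\<bar> \<le> C0 * ((T / real N) ^ \<rho> / (T / real N)\<^sup>2))"
    using dg_error_estimate[OF x assms(12) cf \<rho>_def] by (elim exE conjE) (rule that)
  \<comment> \<open>For \<open>m = 1\<close> and \<open>m = 2\<close> the exponent of the second
    bound is \<open>-1\<close>, hence the integer power; division by \<open>h ^ 2\<close> gives a
    form with natural exponents.\<close>
  have pow: "(if odd m then h ^ m else h ^ (m - 1)) = h ^ \<rho>"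
    "(if odd m then h powi (int m - 2) else h powi (int m - 3)) = h ^ \<rho> / h\<^sup>2" if "h > 0" for h :: real
  proof -
    show "(if odd m then h ^ m else h ^ (m - 1)) = h ^ \<rho>" by (simp add: m \<rho>_def)
    have "h powi (int \<rho> - 2) = h ^ \<rho> / h\<^sup>2"
      using that by (simp add: power_int_diff)
    moreover have "(if odd m then int m - 2 else int m - 3) = int \<rho> - 2" by (simp add: m \<rho>_def)
    ultimately show "(if odd m then h powi (int m - 2) else h powi (int m - 3)) = h ^ \<rho> / h\<^sup>2"
      by (cases "odd m") simp_all
  qed
  have bound: "\<exists>C. \<forall>N h x1h x2h.
         N \<ge> 2 \<longrightarrow> h = T / real N \<longrightarrow> h < hbar \<longrightarrow>
         dg_solution T N m K11 K12 K21 f1 f2 x1h x2h \<longrightarrow>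
           sup_norm_on {0..T} (\<lambda>t. x1 t - x1h t)
             \<le> C * (if odd m then h ^ m else h ^ (m - 1)) \<and>
           sup_norm_on {0..T} (\<lambda>t. x2 t - x2h t)
             \<le> C * (if odd m then h powi (int m - 2) else h powi (int m - 3))"
    if uni: "dg_uniquely_solvable_below hbar T m K11 K12 K21 f1 f2" for hbar
  proof -
    \<comment> \<open>Outside the admissible range \<open>0\<close> serves as a dummy, so that a
      constant can be chosen for every \<open>N\<close>.\<close>
    have "\<forall>N. \<exists>E. E \<ge> 0 \<and> (N \<ge> 2 \<longrightarrow> T / real N < hbar \<longrightarrow> (\<forall>u1 u2. dg_solution T N (Suc k) K11 K12 K21 f1 f2 u1 u2 \<longrightarrow>
       (\<forall>s\<in>{0..T}. \<bar>x1 s - u1 s\<bar> \<le> E * (T / real N) ^ \<rho> \<and> \<bar>x2 s - u2 s\<bar> \<le> E * ((T / real N) ^ \<rho> / (T / real N)\<^sup>2))))"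
    proof
      fix N
      show "\<exists>E. E \<ge> 0 \<and> (N \<ge> 2 \<longrightarrow> T / real N < hbar \<longrightarrow> (\<forall>u1 u2. dg_solution T N (Suc k) K11 K12 K21 f1 f2 u1 u2 \<longrightarrow>
       (\<forall>s\<in>{0..T}. \<bar>x1 s - u1 s\<bar> \<le> E * (T / real N) ^ \<rho> \<and> \<bar>x2 s - u2 s\<bar> \<le> E * ((T / real N) ^ \<rho> / (T / real N)\<^sup>2))))"
    proof (cases "N \<ge> 2 \<and> T / real N < hbar")
      case True
      then have N: "N > 0" by simp
      have hp: "T / real N > 0" using T N by simp
      have pos: "(T / real N) ^ \<rho> > 0" "(T / real N) ^ \<rho> / (T / real N)\<^sup>2 > 0"
        using zero_less_power[OF hp] divide_pos_pos[OF zero_less_power[OF hp] zero_less_power[OF hp]] by blast+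
      have u:  "\<exists>!u. dg_solution T N (Suc k) K11 K12 K21 f1 f2 (fst u) (snd u)"
        using uni True unfolding dg_uniquely_solvable_below_def m by blast
      show ?thesis
        using unique_solution_error_bounded[OF T N x[THEN Ck_on_imp_continuous_on] u pos] by (elim exE conjE) (intro exI conjI impI)
    next
      case False
      then show ?thesis by (intro exI[of _ 0]) auto
    qed
    qed
    from choice[OF this] obtain E where E': "\<forall>N. E N \<ge> 0 \<and> (N \<ge> 2 \<longrightarrow> T / real N < hbar \<longrightarrow>
      (\<forall>u1 u2. dg_solution T N (Suc k) K11 K12 K21 f1 f2 u1 u2 \<longrightarrow>
       (\<forall>s\<in>{0..T}. \<bar>x1 s - u1 s\<bar> \<le> E N * (T / real N) ^ \<rho> \<and> \<bar>x2 s - u2 s\<bar> \<le> E N * ((T / real N) ^ \<rho> / (T / real N)\<^sup>2))))"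
      by (elim exE) (rule that)
    have E: "\<And>N. E N \<ge> 0"
      "\<And>N u1 u2 s. N \<ge> 2 \<Longrightarrow> T / real N < hbar \<Longrightarrow> dg_solution T N (Suc k) K11 K12 K21 f1 f2 u1 u2 \<Longrightarrow> s \<in> {0..T} \<Longrightarrow>
        \<bar>x1 s - u1 s\<bar> \<le> E N * (T / real N) ^ \<rho> \<and> \<bar>x2 s - u2 s\<bar> \<le> E N * ((T / real N) ^ \<rho> / (T / real N)\<^sup>2)"
      using E' by blast+
    \<comment> \<open>A step \<open>h >= h0\<close> forces \<open>N <= T / h0\<close>, so only
      finitely many constants \<open>E N\<close> are to be added to \<open>C0\<close>.\<close>
    define N0 where "N0 = nat \<lceil>T / h0\<rceil>"
    define C where "C = C0 + (\<Sum>N\<le>N0. E N)"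
    have CN: "C0 \<le> C" "\<And>N. N \<le> N0 \<Longrightarrow> E N \<le> C"
    proof -
      show "C0 \<le> C" using E(1) by (simp add: C_def sum_nonneg)
      fix N assume "N \<le> N0"
      then have "E N \<le> (\<Sum>N\<le>N0. E N)" by (intro member_le_sum) (use E(1) in auto)
      then show "E N \<le> C" using C0 by (simp add: C_def)
    qed
    show ?thesis
    proof (rule exI[of _ C], intro allI impI)
      fix N h x1h x2h
      assume N: "N \<ge> 2" and h: "h = T / real N" "h < hbar" and dg: "dg_solution T N m K11 K12 K21 f1 f2 x1h x2h"
      have N0: "N > 0" using N by simp
      have hp: "h > 0" using T N0 by (simp add: h(1))
      note dg' = dg[unfolded m]
      have "\<exists>D\<le>C. \<forall>s\<in>{0..T}. \<bar>x1 s - x1h s\<bar> \<le> D * h ^ \<rho> \<and> \<bar>x2 s - x2h s\<bar> \<le> D * (h ^ \<rho> / h\<^sup>2)"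
      proof (cases "h < h0")
        case True
        have "\<forall>s\<in>{0..T}. \<bar>x1 s - x1h s\<bar> \<le> C0 * h ^ \<rho> \<and> \<bar>x2 s - x2h s\<bar> \<le> C0 * (h ^ \<rho> / h\<^sup>2)"
          unfolding h(1) by (rule est[THEN spec, THEN spec, THEN spec, THEN mp, THEN mp, THEN mp, OF N0 True[unfolded h(1)] dg'])
        then show ?thesis using CN(1) by blast
      next
        case False
        then have "real N \<le> T / h0" using h0 N0 by (simp add: h(1) field_simps)
        then have "N \<le> N0" unfolding N0_def by linarith
        then show ?thesis using CN(2) E(2)[OF N _ dg'] h by blast
      qed
      then obtain D where D: "D \<le> C" "\<And>s. s \<in> {0..T} \<Longrightarrow> \<bar>x1 s - x1h s\<bar> \<le> D * h ^ \<rho>"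
        "\<And>s. s \<in> {0..T} \<Longrightarrow> \<bar>x2 s - x2h s\<bar> \<le> D * (h ^ \<rho> / h\<^sup>2)" by blast
      have le: "D * h ^ \<rho> \<le> C * h ^ \<rho>" "D * (h ^ \<rho> / h\<^sup>2) \<le> C * (h ^ \<rho> / h\<^sup>2)"
        using D(1) hp by (intro mult_right_mono; simp)+
      have ne: "{0..T} \<noteq> {}" using T by simp
      show "sup_norm_on {0..T} (\<lambda>t. x1 t - x1h t) \<le> C * (if odd m then h ^ m else h ^ (m - 1)) \<and>
           sup_norm_on {0..T} (\<lambda>t. x2 t - x2h t) \<le> C * (if odd m then h powi (int m - 2) else h powi (int m - 3))"
        unfolding pow[OF hp]
        by (intro conjI order_trans[OF sup_norm_on_le[OF ne D(2)] le(1)] order_trans[OF sup_norm_on_le[OF ne D(3)] le(2)])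
    qed
  qed
  show ?thesis
    using X1 X2 dg_uniquely_solvable[OF cf] bound unfolding m[symmetric] by (intro conjI allI impI)
qed

end
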